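(* Let $u_1$ and $u_2$ be entropy solutions (in the sense given in the context) of the two-lane system $$\partial_t u_1+\partial_x(u_1v_1(u_1))=-S(u_1,u_2),\qquad \partial_t u_2+\partial_x(u_2v_2(u_2))=S(u_1,u_2),\qquad t>0,\ x\in\mathbb R,$$ with initial data $u_{i,0}$ for $i=1,2$. If $u_{i,0}(x)\in[0,1]$ for all $x$ and $i=1,2$, then $u_i(t,x)\in[0,1]$ for (almost) all $x$ and for $t>0$, $i=1,2$.
   Context: Notation: $a^+=\max\{a,0\}$, $a^-=-\min\{a,0\}$. The velocity functions $v_1,v_2$ are Lipschitz continuous and strictly decreasing with $v_1(1)=v_2(1)=0$ (so they are positive for densities below $1$). The lane-change term is $$S(u_1,u_2)=\big(v_2(u_2)-v_1(u_1)\big)^+u_1-\big(v_2(u_2)-v_1(u_1)\big)^-u_2 .$$ Set $f_i(u)=u\,v_i(u)$. The initial data satisfy $u_{i,0}\in L^1(\mathbb R)\cap BV(\mathbb R)$, $i=1,2$, where $BV$ denotes functions of finite total variation. A weak solution is a pair $u_i\in C([0,\infty);L^1(\mathbb R))$, $i=1,2$, with $u_i(t,\cdot)\in BV(\mathbb R)$ for $t\in[0,\infty)$, such that $$\int_0^\infty\!\!\int_{\mathbb R}\big(u_1\varphi_t+u_1v_1(u_1)\varphi_x-S(u_1,u_2)\varphi\big)\,dx\,dt+\int_{\mathbb R}u_{1,0}\varphi|_{t=0}\,dx=0,$$ $$\int_0^\infty\!\!\int_{\mathbb R}\big(u_2\varphi_t+u_2v_2(u_2)\varphi_x+S(u_1,u_2)\varphi\big)\,dx\,dt+\int_{\mathbb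 R}u_{2,0}\varphi|_{t=0}\,dx=0$$ for all $\varphi\in C_0^\infty([0,\infty)\times\mathbb R)$. It is an entropy solution if $$\int_0^\infty\!\!\int_{\mathbb R}\big(\eta(u_1)\varphi_t+q_1(u_1)\varphi_x\big)\,dx\,dt+\int_{\mathbb R}\eta(u_{1,0})\varphi|_{t=0}\,dx\ge\int_0^\infty\!\!\int_{\mathbb R}\eta'(u_1)\varphi\,S(u_1,u_2)\,dx\,dt,$$ $$\int_0^\infty\!\!\int_{\mathbb R}\big(\eta(u_2)\varphi_t+q_2(u_2)\varphi_x\big)\,dx\,dt+\int_{\mathbb R}\eta(u_{2,0})\varphi|_{t=0}\,dx\ge-\int_0^\infty\!\!\int_{\mathbb R}\eta'(u_2)\varphi\,S(u_1,u_2)\,dx\,dt$$ for all convex functions $\eta$, where $q_i'(u)=\eta'(u)f_i'(u)$, and all non-negative $\varphi\in C_0^\infty([0,\infty)\times\mathbb R)$. *)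

theory Defs
  imports "HOL-Analysis.Analysis"
begin

section \<open>Velocities, fluxes and the lane-change term\<close>

definition pos_part :: "real \<Rightarrow> real" where
  "pos_part a = max a 0"

definition neg_part :: "real \<Rightarrow> real" where
  "neg_part a = - min a 0"

text \<open>The densities are not known a priori to take values in the unit interval, so velocities are
  functions on the whole real line.\<close>

definition velocity :: "(real \<Rightarrow> real) \<Rightarrow> bool" where
  "velocity v \<longleftrightarrow> (\<exists>L. L-lipschitz_on UNIV v) \<and> strict_antimono_on UNIV v \<and> v 1 = 0"

definition flux :: "(real \<Rightarrow> real) \<Rightarrow> real \<Rightarrow> real" where
  "flux v u = u * v u"

definition lane_change :: "(real \<Rightarrow> real) \<Rightarrow> (real \<Rightarrow> real) \<Rightarrow> real \<Rightarrow> real \<Rightarrow> real" where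
  "lane_change v1 v2 u1 u2 = pos_part (v2 u2 - v1 u1) * u1 - neg_part (v2 u2 - v1 u1) * u2"


section \<open>Function spaces\<close>

definition finite_total_variation :: "(real \<Rightarrow> real) \<Rightarrow> bool" where
  "finite_total_variation g \<longleftrightarrow>
     (\<exists>M. \<forall>n (p :: nat \<Rightarrow> real). mono p \<longrightarrow> (\<Sum>i<n. \<bar>g (p (Suc i)) - g (p i)\<bar>) \<le> M)"

text \<open>Elements of \<open>L\<^sup>1(\<real>)\<close> are represented by Borel functions; membership in \<open>BV\<close> is a property of
  the class modulo null sets, so some representative has to have finite total variation.\<close>

definition L1_BV :: "(real \<Rightarrow> real) \<Rightarrow> bool" where
  "L1_BV f \<longleftrightarrow> integrable lborel f \<and>
     (\<exists>g. (AE x in lborel. f x = g x) \<and> finite_total_variation g)"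

text \<open>\<open>u \<in> C([0,\<infinity>); L\<^sup>1(\<real>))\<close>, where \<open>u t\<close> is the function \<open>x \<mapsto> u(t,x)\<close>.\<close>

definition continuous_into_L1 :: "(real \<Rightarrow> real \<Rightarrow> real) \<Rightarrow> bool" where
  "continuous_into_L1 u \<longleftrightarrow>
     (\<forall>t\<ge>0. integrable lborel (u t)) \<and>
     (\<forall>t\<ge>0. ((\<lambda>s. LINT x|lborel. \<bar>u s x - u t x\<bar>) \<longlongrightarrow> 0) (at t within {0..}))"

text \<open>Smooth functions of \<open>(t,x)\<close>: \<open>D i j\<close> is the partial derivative of order \<open>i\<close> in \<open>t\<close> and of
  order \<open>j\<close> in \<open>x\<close>.\<close>

definition smooth :: "(real \<Rightarrow> real \<Rightarrow> real) \<Rightarrow> bool" where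
  "smooth \<phi> \<longleftrightarrow> (\<exists>D :: nat \<Rightarrow> nat \<Rightarrow> real \<Rightarrow> real \<Rightarrow> real. D 0 0 = \<phi> \<and>
     (\<forall>i j. continuous_on UNIV (\<lambda>(t, x). D i j t x) \<and>
       (\<forall>t x. ((\<lambda>s. D i j s x) has_real_derivative D (Suc i) j t x) (at t) \<and>
              ((\<lambda>y. D i j t y) has_real_derivative D i (Suc j) t x) (at x))))"

text \<open>Functions in \<open>C\<^sub>0\<^sup>\<infinity>([0,\<infinity>) \<times> \<real>)\<close> are the restrictions to \<open>t \<ge> 0\<close> of smooth functions with
  compact support in the plane. In particular they need not vanish at \<open>t = 0\<close>.\<close>

definition test_function :: "(real \<Rightarrow> real \<Rightarrow> real) \<Rightarrow> bool" where
  "test_function \<phi> \<longleftrightarrow> smooth \<phi> \<and> (\<exists>R. \<forall>t x. \<phi> t x \<noteq> 0 \<longrightarrow> \<bar>t\<bar> \<le> R \<and> \<bar>x\<bar> \<le> R)"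

definition partial_t :: "(real \<Rightarrow> real \<Rightarrow> real) \<Rightarrow> real \<Rightarrow> real \<Rightarrow> real" where
  "partial_t \<phi> t x = deriv (\<lambda>s. \<phi> s x) t"

definition partial_x :: "(real \<Rightarrow> real \<Rightarrow> real) \<Rightarrow> real \<Rightarrow> real \<Rightarrow> real" where
  "partial_x \<phi> t x = deriv (\<lambda>y. \<phi> t y) x"


section \<open>Weak and entropy solutions\<close>

text \<open>A Bochner integral of a non-integrable function has the default value 0; the existence of the
  integrals that occur in the notions of solution is therefore always stated separately, by
  \<open>spacetime_integrable\<close>. It includes joint measurability in \<open>(t,x)\<close>.\<close>

definition spacetime_integrable :: "(real \<Rightarrow> real \<Rightarrow> real) \<Rightarrow> bool" where
  "spacetime_integrable F \<longleftrightarrow>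
     set_integrable (lborel :: (real \<times> real) measure) ({0..} \<times> UNIV) (\<lambda>(t, x). F t x)"

definition spacetime_integral :: "(real \<Rightarrow> real \<Rightarrow> real) \<Rightarrow> real" where
  "spacetime_integral F = (LINT t:{0..}|lborel. (LINT x|lborel. F t x))"

text \<open>The weak form of \<open>\<partial>\<^sub>t u + \<partial>\<^sub>x (u v(u)) = G\<close>, \<open>u(0,\<cdot>) = u0\<close>, for a source \<open>G(t,x)\<close>.\<close>

definition weak_form ::
  "(real \<Rightarrow> real) \<Rightarrow> (real \<Rightarrow> real \<Rightarrow> real) \<Rightarrow> (real \<Rightarrow> real) \<Rightarrow> (real \<Rightarrow> real \<Rightarrow> real) \<Rightarrow> bool" where
  "weak_form v G u0 u \<longleftrightarrow> (\<forall>\<phi>. test_function \<phi> \<longrightarrow>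
     spacetime_integrable (\<lambda>t x. u t x * partial_t \<phi> t x) \<and>
     spacetime_integrable (\<lambda>t x. flux v (u t x) * partial_x \<phi> t x) \<and>
     spacetime_integrable (\<lambda>t x. G t x * \<phi> t x) \<and>
     spacetime_integral (\<lambda>t x. u t x * partial_t \<phi> t x + flux v (u t x) * partial_x \<phi> t x
                               + G t x * \<phi> t x)
       + (LINT x|lborel. u0 x * \<phi> 0 x) = 0)"

text \<open>Entropies are convex functions for which \<open>\<eta>'\<close> exists everywhere. Since \<open>flux v\<close> is only locally
  Lipschitz, the relation \<open>q' = \<eta>' f'\<close> can only be required almost everywhere; the points at which
  \<open>f\<close> is not differentiable form a null set by Rademacher's theorem. Local Lipschitz continuity of
  \<open>q\<close> makes \<open>q\<close> a primitive of \<open>\<eta>' f'\<close>, i.e. it determines \<open>q\<close> up to a constant.\<close>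

definition entropy_pair ::
  "(real \<Rightarrow> real) \<Rightarrow> (real \<Rightarrow> real) \<Rightarrow> (real \<Rightarrow> real) \<Rightarrow> bool" where
  "entropy_pair v \<eta> q \<longleftrightarrow>
     convex_on UNIV \<eta> \<and> (\<forall>u. \<eta> differentiable (at u)) \<and>
     (\<forall>a b. \<exists>L. L-lipschitz_on {a..b} q) \<and>
     (AE u in lborel. \<forall>d. (flux v has_real_derivative d) (at u) \<longrightarrow>
        (q has_real_derivative deriv \<eta> u * d) (at u))"

definition entropy_inequality ::
  "(real \<Rightarrow> real) \<Rightarrow> (real \<Rightarrow> real \<Rightarrow> real) \<Rightarrow> (real \<Rightarrow> real) \<Rightarrow> (real \<Rightarrow> real \<Rightarrow> real) \<Rightarrow> bool" where
  "entropy_inequality v G u0 u \<longleftrightarrow>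
     (\<forall>\<eta> q \<phi>. entropy_pair v \<eta> q \<longrightarrow> test_function \<phi> \<longrightarrow> (\<forall>t\<ge>0. \<forall>x. \<phi> t x \<ge> 0) \<longrightarrow>
       spacetime_integrable (\<lambda>t x. \<eta> (u t x) * partial_t \<phi> t x) \<and>
       spacetime_integrable (\<lambda>t x. q (u t x) * partial_x \<phi> t x) \<and>
       spacetime_integrable (\<lambda>t x. deriv \<eta> (u t x) * \<phi> t x * G t x) \<and>
       spacetime_integral (\<lambda>t x. \<eta> (u t x) * partial_t \<phi> t x + q (u t x) * partial_x \<phi> t x)
         + (LINT x|lborel. \<eta> (u0 x) * \<phi> 0 x)
       \<ge> - spacetime_integral (\<lambda>t x. deriv \<eta> (u t x) * \<phi> t x * G t x))"

definition weak_solution ::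
  "(real \<Rightarrow> real) \<Rightarrow> (real \<Rightarrow> real) \<Rightarrow> (real \<Rightarrow> real) \<Rightarrow> (real \<Rightarrow> real) \<Rightarrow>
   (real \<Rightarrow> real \<Rightarrow> real) \<Rightarrow> (real \<Rightarrow> real \<Rightarrow> real) \<Rightarrow> bool" where
  "weak_solution v1 v2 u10 u20 u1 u2 \<longleftrightarrow>
     continuous_into_L1 u1 \<and> continuous_into_L1 u2 \<and>
     (\<forall>t\<ge>0. L1_BV (u1 t) \<and> L1_BV (u2 t)) \<and>
     weak_form v1 (\<lambda>t x. - lane_change v1 v2 (u1 t x) (u2 t x)) u10 u1 \<and>
     weak_form v2 (\<lambda>t x. lane_change v1 v2 (u1 t x) (u2 t x)) u20 u2"

definition entropy_solution ::
  "(real \<Rightarrow> real) \<Rightarrow> (real \<Rightarrow> real) \<Rightarrow> (real \<Rightarrow> real) \<Rightarrow> (real \<Rightarrow> real) \<Rightarrow>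
   (real \<Rightarrow> real \<Rightarrow> real) \<Rightarrow> (real \<Rightarrow> real \<Rightarrow> real) \<Rightarrow> bool" where
  "entropy_solution v1 v2 u10 u20 u1 u2 \<longleftrightarrow>
     weak_solution v1 v2 u10 u20 u1 u2 \<and>
     entropy_inequality v1 (\<lambda>t x. - lane_change v1 v2 (u1 t x) (u2 t x)) u10 u1 \<and>
     entropy_inequality v2 (\<lambda>t x. lane_change v1 v2 (u1 t x) (u2 t x)) u20 u2"

end

theory Submission
  imports Defs
begin

text \<open>Let \<open>E(t)\<close> be the integral of \<open>\<eta>(u\<^sub>1) + \<eta>(u\<^sub>2)\<close> for a smooth convex \<open>\<eta>\<close> vanishing exactly on
  the unit interval. If the solution is uniformly bounded on a time interval, the entropy inequalities
  can be integrated over the whole line, and the signs of the lane-change term give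
  \<open>E(t) \<le> E(s) + K \<integral>\<^sub>s\<^sup>t E\<close>; hence \<open>E\<close> stays 0 by Gronwall.

  A solution is bounded at each fixed time, because it is in \<open>BV\<close>, but a bound that is locally uniform
  in time is not part of the definition, and since the wave speeds are unbounded, mass might a priori
  enter from infinity. This is excluded as follows. On a time interval with a uniform bound, the
  integrals of \<open>(|u\<^sub>i| - k)\<^sup>+\<close> at increasing thresholds \<open>k\<close> control each other by differential inequalities
  whose constants do not depend on that bound, and which turn a bound at one time into a
  bound on a time interval of definite length. As these inequalities only involve functions that
  are continuous in time on \<open>[0, \<infinity>)\<close>, Baire's theorem extends them to all times.\<close>

section \<open>Smooth cutoff functions\<close>

text \<open>The Gronwall constant for the unit interval grows with the bound on the solution, so a
  locally uniform bound must come first and from another source. A single threshold cannot provide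
  it: only at density 1 are both velocities known to vanish, while for \<open>k > 1\<close> the
  values \<open>v1 k\<close> and \<open>v2 k\<close> may differ, and then the lane change can push a
  density out of \<open>[-k, k]\<close>. The size of this gain is harmless, however: one of the two
  densities is still below the end of the smoothing zone in modulus, so the gain grows at most
  linearly in the other one, with a constant depending on the threshold alone. Such a term is not
  controlled by the excess over the same threshold, but by the excess over a slightly lower one, at
  a price inversely proportional to the gap. With \<open>N\<close> gaps of size \<open>1/N\<close>
  the price is \<open>C N\<close> per step, the nested time integrals contribute
  \<open>1/N!\<close>, and \<open>N^N / N! \<le> e^N\<close> leaves a geometric sequence. The flux
  does depend on the bound, but its contribution disappears as the spatial cutoff tends to 1, since
  the solution is integrable.\<close>

lemma power_divide_fact_le_exp:
  fixes x :: real
  assumes "0 \<le> x"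
  shows "x ^ k / fact k \<le> exp x"
proof -
  have "(\<Sum>n\<in>{k}. x ^ n /\<^sub>R fact n) \<le> (\<Sum>n. x ^ n /\<^sub>R fact n)"
    using assms by (intro sum_le_suminf summable_exp_generic) auto
  then show ?thesis by (simp add: exp_def divide_inverse mult.commute)
qed

lemma exp_minus_inverse_le:
  fixes y :: real
  assumes "0 < y"
  shows "exp (- 1 / y) \<le> fact k * y ^ k"
  using power_divide_fact_le_exp[of "1 / y" k] assms by (simp add: exp_minus field_simps)

lemma has_real_derivative_zero_of_quadratic_bound:
  fixes f :: "real \<Rightarrow> real"
  assumes "\<And>y. \<bar>f y\<bar> \<le> C * (y - a)\<^sup>2"
  shows "(f has_real_derivative 0) (at a)"
proof -
  have fa: "f a = 0" using assms[of a] by simp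
  have "((\<lambda>y. (f y - f a) / (y - a)) \<longlongrightarrow> 0) (at a)"
  proof (rule Lim_null_comparison)
    show "\<forall>\<^sub>F y in at a. norm ((f y - f a) / (y - a)) \<le> C * \<bar>y - a\<bar>"
    proof (rule eventually_at_filter[THEN iffD2], rule always_eventually, intro allI impI)
      fix y assume "y \<noteq> a"
      then show "norm ((f y - f a) / (y - a)) \<le> C * \<bar>y - a\<bar>"
        using assms[of y] by (simp add: fa abs_divide divide_le_eq power2_eq_square mult.assoc)
    qed
    show "((\<lambda>y. C * \<bar>y - a\<bar>) \<longlongrightarrow> 0) (at a)"
      by (rule tendsto_eq_intros refl | simp)+
  qed
  then show ?thesis by (simp add: has_field_derivative_iff)
qed

section \<open>Smooth functions of one variable\<close>

definition smooth_real :: "(real \<Rightarrow> real) \<Rightarrow> bool" where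
  "smooth_real f \<longleftrightarrow>
     (\<exists>D. D 0 = f \<and> (\<forall>i x. (D i has_real_derivative D (Suc i) x) (at x)))"

text \<open>A derivative can be chosen inside the class, and iterating the choice produces the whole
  sequence of derivatives.\<close>

lemma smooth_real_of_family:
  assumes "\<And>q :: 'a. \<exists>q'. \<forall>x. (G q has_real_derivative G q' x) (at x)"
  shows "smooth_real (G q)"
proof -
  obtain s where s: "\<And>q x. (G q has_real_derivative G (s q) x) (at x)"
    using assms by metis
  show ?thesis unfolding smooth_real_def
    by (rule exI[of _ "\<lambda>i. G ((s ^^ i) q)"]) (auto simp: s)
qed

lemma smooth_real_derivative:
  assumes "smooth_real f"
  obtains f' where "smooth_real f'" "\<And>x. (f has_real_derivative f' x) (at x)"
proof -
  obtain D where D: "D 0 = f" "\<And>i x. (D i has_real_derivative D (Suc i) x) (at x)"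
    using assms unfolding smooth_real_def by auto
  show ?thesis
  proof (rule that[of "D 1"])
    show "smooth_real (D 1)" unfolding smooth_real_def
      by (rule exI[of _ "\<lambda>i. D (Suc i)"]) (auto simp: D)
    show "(f has_real_derivative D 1 x) (at x)" for x using D(2)[of 0 x] D(1) by simp
  qed
qed

lemma smooth_real_antiderivative:
  assumes "smooth_real f'" "\<And>x. (f has_real_derivative f' x) (at x)"
  shows "smooth_real f"
proof -
  obtain D where D: "D 0 = f'" "\<And>i x. (D i has_real_derivative D (Suc i) x) (at x)"
    using assms(1) unfolding smooth_real_def by auto
  have "(case_nat f D i has_real_derivative case_nat f D (Suc i) x) (at x)" for i x
    using D assms(2) by (cases i) auto
  then show ?thesis unfolding smooth_real_def
    by (intro exI[of _ "case_nat f D"]) auto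
qed

lemma smooth_real_affine:
  assumes "smooth_real f"
  shows "smooth_real (\<lambda>x. c * f (a * x + b))"
proof -
  obtain D where D: "D 0 = f" "\<And>i x. (D i has_real_derivative D (Suc i) x) (at x)"
    using assms unfolding smooth_real_def by auto
  have "((\<lambda>x. c * a ^ i * D i (a * x + b)) has_real_derivative
          c * a ^ Suc i * D (Suc i) (a * x + b)) (at x)" for i x
    by (rule derivative_eq_intros DERIV_chain2[OF D(2)] refl | simp)+
  then show ?thesis unfolding smooth_real_def
    by (intro exI[of _ "\<lambda>i x. c * a ^ i * D i (a * x + b)"]) (auto simp: D(1))
qed

lemma smooth_real_diff:
  assumes "smooth_real f" "smooth_real g"
  shows "smooth_real (\<lambda>x. f x - g x)"
proof -
  obtain D E where D: "D 0 = f" "\<And>i x. (D i has_real_derivative D (Suc i) x) (at x)"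
    and E: "E 0 = g" "\<And>i x. (E i has_real_derivative E (Suc i) x) (at x)"
    using assms unfolding smooth_real_def by auto
  show ?thesis unfolding smooth_real_def
    by (rule exI[of _ "\<lambda>i x. D i x - E i x"]) (auto simp: D E intro!: DERIV_diff)
qed

lemma smooth_real_continuous: "smooth_real f \<Longrightarrow> continuous_on A f"
  by (meson DERIV_isCont continuous_at_imp_continuous_on smooth_real_derivative)

text \<open>All derivatives of the standard bump exp(-1/(1 - x^2)) have this form, so the family is
  closed under differentiation; \<open>q\<close> is the numerator and \<open>m\<close> the order of
  the pole.\<close>

definition bump_poly :: "real poly \<times> nat \<Rightarrow> real \<Rightarrow> real" where
  "bump_poly = (\<lambda>(q, m) x.
     (if \<bar>x\<bar> < 1 then poly q x / (1 - x\<^sup>2) ^ m * exp (- 1 / (1 - x\<^sup>2)) else 0))"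

text \<open>Away from 1 and -1 this is the quotient rule or trivial. At these two points the
  exponential beats the pole with two powers of 1 - x^2 to spare, so the function is quadratically
  small there and its derivative is 0.\<close>

lemma bump_poly_derivative:
  "\<exists>q'. \<forall>x. (bump_poly (q, m) has_real_derivative bump_poly (q', m + 2) x) (at x)"
proof -
  define w :: "real poly" where "w = [:1, 0, -1:]"
  \<comment> \<open>Differentiating the pole raises its order by 1, differentiating the exponent
    raises it by 2. Over the common order \<open>m + 2\<close> the three terms carry the factors
    \<open>w\<^sup>2\<close>, \<open>w\<close> and 1.\<close>
  define q' where "q' = pderiv q * w\<^sup>2 + [:0, 2 * real m:] * q * w - [:0, 2:] * q"
  have w: "poly w x = 1 - x\<^sup>2" for x by (simp add: w_def power2_eq_square algebra_simps)
  have "(bump_poly (q, m) has_real_derivative bump_poly (q', m + 2) x) (at x)" for x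
  proof (cases "\<bar>x\<bar> < 1")
    case True
    define y where "y = 1 - x\<^sup>2"
    have y: "y > 0" using True unfolding y_def by (simp add: abs_square_less_1)
    have wy: "poly w x = y" by (simp add: w y_def)
    define e where "e = exp (- 1 / y)"
    have p: "((\<lambda>x. (1 - x\<^sup>2) ^ m) has_real_derivative real m * y ^ (m - 1) * (- 2 * x)) (at x)"
      unfolding y_def by (rule derivative_eq_intros refl | simp)+
    have "((\<lambda>x. poly q x / (1 - x\<^sup>2) ^ m * exp (- 1 / (1 - x\<^sup>2))) has_real_derivative
            (poly (pderiv q) x * y ^ m - poly q x * (real m * y ^ (m - 1) * (- 2 * x))) / (y ^ m * y ^ m) * e
              + e * (- 2 * x / y\<^sup>2) * (poly q x / y ^ m)) (at x)"
      using y unfolding e_def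
      apply -
      apply (rule derivative_eq_intros p poly_DERIV refl | simp add: y_def[symmetric])+
      by (simp add: power2_eq_square)
    \<comment> \<open>By cases on \<open>m\<close>, because the exponent \<open>m - 1\<close> is
      truncated at \<open>m = 0\<close>, where its coefficient vanishes.\<close>
    also have "(poly (pderiv q) x * y ^ m - poly q x * (real m * y ^ (m - 1) * (- 2 * x))) / (y ^ m * y ^ m) * e
              + e * (- 2 * x / y\<^sup>2) * (poly q x / y ^ m) = poly q' x / y ^ (m + 2) * e"
    proof (cases m)
      case 0
      then show ?thesis using y
        by (simp add: q'_def wy field_simps power2_eq_square)
    next
      case (Suc k)
      then show ?thesis using y
        by (simp add: q'_def wy field_simps power2_eq_square)
    qed
    also have "\<dots> = bump_poly (q', m + 2) x" using True by (simp add: bump_poly_def y_def e_def)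
    finally show ?thesis
    proof (rule DERIV_cong_ev[THEN iffD1, rotated 3])
      show "\<forall>\<^sub>F x in nhds x. poly q x / (1 - x\<^sup>2) ^ m * exp (- 1 / (1 - x\<^sup>2)) = bump_poly (q, m) x"
        using eventually_nhds_in_open[of "{-1<..<1}" x] True
        by (auto elim!: eventually_mono simp: bump_poly_def abs_less_iff)
    qed auto
  next
    case False
    show ?thesis
    proof (cases "\<bar>x\<bar> = 1")
      case False
      with \<open>\<not> \<bar>x\<bar> < 1\<close> have x: "\<bar>x\<bar> > 1" by simp
      have "open {z :: real. \<bar>z\<bar> > 1}" by (intro open_Collect_less continuous_intros)
      then have "\<forall>\<^sub>F z in nhds x. bump_poly (q, m) z = 0"
        using eventually_nhds_in_open[of "{z. \<bar>z\<bar> > 1}" x] x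
        by (auto elim!: eventually_mono simp: bump_poly_def)
      then have "(bump_poly (q, m) has_real_derivative 0) (at x) \<longleftrightarrow> ((\<lambda>_. 0) has_real_derivative 0) (at x)"
        by (intro DERIV_cong_ev) auto
      then show ?thesis using x by (simp add: bump_poly_def)
    next
      case True
      have "compact ((\<lambda>x. \<bar>poly q x\<bar>) ` {-1..1})"
        by (intro compact_continuous_image continuous_intros) auto
      then obtain Q where Q: "\<And>z. z \<in> {-1..1} \<Longrightarrow> \<bar>poly q z\<bar> \<le> Q"
        by (force dest!: compact_imp_bounded simp: bounded_iff)
      have Q0: "Q \<ge> 0" using Q[of 0] by force
      have bd: "\<bar>bump_poly (q, m) z\<bar> \<le> 4 * Q * fact (m + 2) * (z - x)\<^sup>2" for z
      proof (cases "\<bar>z\<bar> < 1")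
        case z: True
        define y where "y = 1 - z\<^sup>2"
        have y: "y > 0" using z unfolding y_def by (simp add: abs_square_less_1)
        have "\<bar>y\<bar> \<le> 2 * \<bar>z - x\<bar>"
        proof -
          have "y = - ((z - x) * (z + x))" using True
            by (auto simp: y_def algebra_simps power2_eq_square abs_if split: if_splits)
          then have "\<bar>y\<bar> = \<bar>z - x\<bar> * \<bar>z + x\<bar>" by (simp add: abs_mult)
          also have "\<dots> \<le> \<bar>z - x\<bar> * 2" using z True by (intro mult_left_mono) auto
          finally show ?thesis by simp
        qed
        then have "\<bar>y\<bar>\<^sup>2 \<le> (2 * \<bar>z - x\<bar>)\<^sup>2" by (rule power_mono) simp
        then have y2: "y\<^sup>2 \<le> 4 * (z - x)\<^sup>2" by (simp add: power_mult_distrib)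
        have "\<bar>bump_poly (q, m) z\<bar> = \<bar>poly q z\<bar> / y ^ m * exp (- 1 / y)"
          using z y by (simp add: bump_poly_def y_def abs_mult)
        also have "\<dots> \<le> Q / y ^ m * (fact (m + 2) * y ^ (m + 2))"
          using y z Q[of z] Q0 abs_less_iff[of z 1]
          by (intro mult_mono divide_right_mono exp_minus_inverse_le) auto
        also have "\<dots> = Q * fact (m + 2) * y\<^sup>2" using y by (simp add: power_add power2_eq_square)
        also have "\<dots> \<le> Q * fact (m + 2) * (4 * (z - x)\<^sup>2)"
          using y2 Q0 by (intro mult_left_mono) auto
        finally show ?thesis by (simp only: mult_ac)
      qed (use Q0 in \<open>auto simp: bump_poly_def\<close>)
      show ?thesis
        using has_real_derivative_zero_of_quadratic_bound[OF bd] True by (simp add: bump_poly_def)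
    qed
  qed
  then show ?thesis by blast
qed

lemma exists_bump:
  obtains \<beta> :: "real \<Rightarrow> real" where "smooth_real \<beta>" "\<And>x. 0 \<le> \<beta> x" "\<And>x. \<beta> x \<le> 1"
    "\<beta> 0 = 1" "\<And>x. \<beta> x \<noteq> 0 \<longleftrightarrow> \<bar>x\<bar> < 1"
proof
  \<comment> \<open>The constant numerator \<open>exp 1\<close> compensates the factor
    \<open>exp (- 1)\<close> at 0.\<close>
  show "smooth_real (bump_poly ([:exp 1:], 0))"
    by (rule smooth_real_of_family[of bump_poly]) (metis bump_poly_derivative surj_pair)
  show "bump_poly ([:exp 1:], 0) x \<le> 1" for x
  proof (cases "\<bar>x\<bar> < 1")
    case True
    define y where "y = 1 - x\<^sup>2"
    have y: "0 < y" "y \<le> 1" using True by (auto simp: y_def abs_square_less_1)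
    have "bump_poly ([:exp 1:], 0) x = exp (1 + - 1 / y)"
      using True unfolding exp_add by (simp add: bump_poly_def y_def)
    also have "\<dots> \<le> 1" using y by simp
    finally show ?thesis .
  qed (simp add: bump_poly_def)
  show "bump_poly ([:exp 1:], 0) 0 = 1"
    by (simp add: bump_poly_def flip: exp_add)
qed (auto simp: bump_poly_def)

text \<open>The difference of two translates of one smooth step, the primitive of a bump, rescaled
  to half-width \<open>e\<close>. Only the signs of the slope matter later, so the height of the
  step is not normalised; the strict signs at \<open>s\<close> and \<open>t\<close> are what
  produces contradictions.\<close>

lemma exists_plateau:
  fixes s t e :: real
  assumes "0 < e" "s < t"
  obtains \<psi> \<psi>' where "smooth_real \<psi>" "\<And>\<tau>. (\<psi> has_real_derivative \<psi>' \<tau>) (at \<tau>)"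
    "\<And>\<tau>. 0 \<le> \<psi> \<tau>" "\<And>\<tau>. \<tau> \<le> s - e \<Longrightarrow> \<psi> \<tau> = 0" "\<And>\<tau>. t + e \<le> \<tau> \<Longrightarrow> \<psi> \<tau> = 0"
    "\<And>\<tau>. e \<le> \<bar>\<tau> - t\<bar> \<Longrightarrow> 0 \<le> \<psi>' \<tau>" "\<And>\<tau>. e \<le> \<bar>\<tau> - s\<bar> \<Longrightarrow> \<psi>' \<tau> \<le> 0"
    "2 * e < t - s \<Longrightarrow> 0 < \<psi>' s" "2 * e < t - s \<Longrightarrow> \<psi>' t < 0"
proof -
  obtain \<beta> :: "real \<Rightarrow> real" where \<beta>: "smooth_real \<beta>" "\<And>x. 0 \<le> \<beta> x" "\<beta> 0 = 1"
    "\<And>x. \<beta> x \<noteq> 0 \<longleftrightarrow> \<bar>x\<bar> < 1"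
    using exists_bump by metis
  have "continuous_on UNIV \<beta>" using \<beta>(1) by (rule smooth_real_continuous)
  then obtain \<Phi> where \<Phi>: "\<And>x. (\<Phi> has_real_derivative \<beta> x) (at x)"
    using einterval_antiderivative[of "- \<infinity>" \<infinity> \<beta>] continuous_on_eq_continuous_at[of UNIV \<beta>]
    by (auto simp: has_real_derivative_iff_has_vector_derivative)
  have mono: "\<Phi> x \<le> \<Phi> y" if "x \<le> y" for x y
    by (rule DERIV_nonneg_imp_nondecreasing[OF that]) (use \<Phi> \<beta>(2) in blast)
  have const: "\<Phi> x = \<Phi> y" if "\<And>z. x \<le> z \<Longrightarrow> z \<le> y \<Longrightarrow> 1 \<le> \<bar>z\<bar>" "x \<le> y" for x y
  proof -
    have "\<beta> z = 0" if "x \<le> z" "z \<le> y" for z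
      using \<beta>(4)[of z] \<open>\<And>z. x \<le> z \<Longrightarrow> z \<le> y \<Longrightarrow> 1 \<le> \<bar>z\<bar>\<close>[OF that] by auto
    then have "\<Phi> y \<le> \<Phi> x"
      using DERIV_nonpos_imp_nonincreasing[OF \<open>x \<le> y\<close>, of \<Phi>] \<Phi> by (metis order_refl)
    with mono[OF \<open>x \<le> y\<close>] show ?thesis by simp
  qed
  define \<psi> where "\<psi> \<tau> = 1 * \<Phi> (1 / e * \<tau> + - (s / e)) - 1 * \<Phi> (1 / e * \<tau> + - (t / e))" for \<tau>
  define \<psi>' where "\<psi>' \<tau> = (\<beta> ((\<tau> - s) / e) - \<beta> ((\<tau> - t) / e)) / e" for \<tau>
  have psi: "\<psi> \<tau> = \<Phi> ((\<tau> - s) / e) - \<Phi> ((\<tau> - t) / e)" for \<tau>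
    by (simp add: \<psi>_def diff_divide_distrib)
  have b0: "\<beta> ((\<tau> - z) / e) = 0" if "e \<le> \<bar>\<tau> - z\<bar>" for \<tau> z
    using \<beta>(4)[of "(\<tau> - z) / e"] that assms by (auto simp: divide_simps)
  show ?thesis
  proof (rule that[of \<psi> \<psi>'])
    show "smooth_real \<psi>"
      unfolding \<psi>_def[abs_def]
      by (intro smooth_real_diff smooth_real_affine smooth_real_antiderivative[OF \<beta>(1) \<Phi>])
    show "(\<psi> has_real_derivative \<psi>' \<tau>) (at \<tau>)" for \<tau>
    proof -
      have *: "((\<lambda>\<tau>. \<Phi> ((\<tau> - z) / e)) has_real_derivative \<beta> ((\<tau> - z) / e) * (1 / e)) (at \<tau>)" for z
        by (rule DERIV_chain2[OF \<Phi>]) (rule derivative_eq_intros refl | use assms in simp)+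
      show ?thesis
        using DERIV_diff[OF *[of s] *[of t]] by (simp add: psi[abs_def] \<psi>'_def diff_divide_distrib)
    qed
    show "0 \<le> \<psi> \<tau>" for \<tau>
      using assms by (simp add: psi mono divide_right_mono)
    show "\<psi> \<tau> = 0" if "\<tau> \<le> s - e" for \<tau>
    proof -
      have "(\<tau> - s) / e \<le> -1" "(\<tau> - t) / e \<le> (\<tau> - s) / e"
        using that assms by (auto simp: divide_simps)
      then show ?thesis unfolding psi by (subst const[of "(\<tau> - t) / e" "(\<tau> - s) / e"]) auto
    qed
    show "\<psi> \<tau> = 0" if "t + e \<le> \<tau>" for \<tau>
    proof -
      have "1 \<le> (\<tau> - t) / e" "(\<tau> - t) / e \<le> (\<tau> - s) / e"
        using that assms by (auto simp: divide_simps)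
      then show ?thesis unfolding psi by (subst const[of "(\<tau> - t) / e" "(\<tau> - s) / e"]) auto
    qed
    show "0 \<le> \<psi>' \<tau>" if "e \<le> \<bar>\<tau> - t\<bar>" for \<tau>
      using b0[OF that] assms \<beta>(2) by (simp add: \<psi>'_def)
    show "\<psi>' \<tau> \<le> 0" if "e \<le> \<bar>\<tau> - s\<bar>" for \<tau>
      using b0[OF that] assms \<beta>(2) by (simp add: \<psi>'_def)
    show "0 < \<psi>' s" if "2 * e < t - s" using b0[of s t] that assms \<beta>(3) by (simp add: \<psi>'_def)
    show "\<psi>' t < 0" if "2 * e < t - s" using b0[of t s] that assms \<beta>(3) by (simp add: \<psi>'_def)
  qed
qed

lemma test_function_product:
  assumes "smooth_real \<psi>" "smooth_real \<theta>"
    and "\<And>t. \<psi> t \<noteq> 0 \<Longrightarrow> \<bar>t\<bar> \<le> R" "\<And>x. \<theta> x \<noteq> 0 \<Longrightarrow> \<bar>x\<bar> \<le> R"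
  shows "test_function (\<lambda>t x. \<psi> t * \<theta> x)"
proof -
  obtain D E where D: "D 0 = \<psi>" "\<And>i x. (D i has_real_derivative D (Suc i) x) (at x)"
    and E: "E 0 = \<theta>" "\<And>i x. (E i has_real_derivative E (Suc i) x) (at x)"
    using assms unfolding smooth_real_def by auto
  have [continuous_intros]: "continuous_on A (D i)" "continuous_on A (E i)" for i A
    by (meson D E DERIV_isCont continuous_at_imp_continuous_on)+
  have "smooth (\<lambda>t x. \<psi> t * \<theta> x)"
    unfolding smooth_def
  proof (intro exI[of _ "\<lambda>i j t x. D i t * E j x"] conjI allI)
    show "continuous_on UNIV (\<lambda>(t, x). D i t * E j x)" for i j
      unfolding case_prod_beta
      by (intro continuous_intros continuous_on_compose2[of UNIV "D i" _ fst]
          continuous_on_compose2[of UNIV "E j" _ snd]) auto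
  qed (auto simp: D E intro!: derivative_eq_intros DERIV_cmult_right DERIV_cmult)
  with assms show ?thesis unfolding test_function_def
    by (intro conjI exI[of _ R]) auto
qed

section \<open>A Baire category argument\<close>

lemma antimono_on_closure_interval:
  fixes W :: "real \<Rightarrow> real"
  assumes cont: "continuous_on {a..b} W" and anti: "antimono_on {a<..<b} W"
  shows "antimono_on {a..b} W"
proof (rule monotone_onI)
  fix s t assume st: "s \<in> {a..b}" "t \<in> {a..b}" "s \<le> t"
  show "W t \<le> W s"
  proof (cases "s = t")
    case False
    \<comment> \<open>Moving both points inwards by at most a third of their distance keeps their
      order.\<close>
    define r where "r n = (t - s) / 3 * inverse (real (Suc n))" for n
    have r0: "r \<longlonglongrightarrow> 0" unfolding r_def by (intro tendsto_mult_right_zero LIMSEQ_inverse_real_of_nat)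
    have r: "0 < r n" "r n \<le> (t - s) / 3" for n
      using False st mult_left_le[of "inverse (real (Suc n))" "(t - s) / 3"]
      unfolding r_def by (auto intro!: mult_pos_pos simp: inverse_le_1_iff)
    have mem: "s + r n \<in> {a<..<b}" "t - r n \<in> {a<..<b}" "s + r n \<le> t - r n" for n
      using r[of n] st False by (auto simp: field_simps)
    show ?thesis
    proof (rule LIMSEQ_le)
      show "(\<lambda>n. W (t - r n)) \<longlonglongrightarrow> W t"
        by (rule continuous_on_tendsto_compose[OF cont])
          (use mem st tendsto_diff[OF tendsto_const[of t] r0] in \<open>auto intro!: always_eventually less_imp_le\<close>)
      show "(\<lambda>n. W (s + r n)) \<longlonglongrightarrow> W s"
        by (rule continuous_on_tendsto_compose[OF cont])
          (use mem st tendsto_add[OF tendsto_const[of s] r0] in \<open>auto intro!: always_eventually less_imp_le\<close>)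
      show "\<exists>N. \<forall>n\<ge>N. W (t - r n) \<le> W (s + r n)"
        using mem by (auto intro!: monotone_onD[OF anti])
    qed
  qed simp
qed

lemma antimono_on_of_local:
  fixes W :: "real \<Rightarrow> real"
  assumes "\<And>x. x \<in> {a<..<b} \<Longrightarrow> \<exists>e>0. antimono_on ({a<..<b} \<inter> {x - e..x + e}) W"
  shows "antimono_on {a<..<b} W"
proof (rule monotone_onI)
  fix s t assume st: "s \<in> {a<..<b}" "t \<in> {a<..<b}" "s \<le> t"
  from \<open>s \<le> t\<close> have "s \<in> {a<..<b} \<longrightarrow> t \<in> {a<..<b} \<longrightarrow> W t \<le> W s"
  proof (induction rule: Bolzano)
    case (trans p q r)
    then show ?case by force
  next
    case (local x)
    then have "x \<in> {a<..<b}" using st by auto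
    then obtain e where "e > 0" and e: "antimono_on ({a<..<b} \<inter> {x - e..x + e}) W"
      using assms by blast
    show ?case
    proof (intro exI[of _ e] conjI allI impI)
      fix p q assume "p \<le> x \<and> x \<le> q \<and> q - p < e" "p \<in> {a<..<b}" "q \<in> {a<..<b}"
      then show "W q \<le> W p" by (intro monotone_onD[OF e]) auto
    qed fact
  qed
  then show "W t \<le> W s" using st by blast
qed

text \<open>Let \<open>F\<close> be the set of times near which some \<open>W\<close> fails to be nonincreasing. By Baire's theorem one
  of the sets \<open>good n\<close> contains a relatively open part of \<open>F\<close>; on the gaps of \<open>F\<close> next to that part
  \<open>growth\<close> applies, so that the whole neighbourhood is uniformly good, contradicting the choice of \<open>F\<close>.\<close>

lemma baire_antimono:
  fixes good :: "nat \<Rightarrow> real \<Rightarrow> bool" and \<W> :: "(real \<Rightarrow> real) set"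
  assumes cont: "\<And>W. W \<in> \<W> \<Longrightarrow> continuous_on {0..} W"
    and closed_good: "\<And>n. closed {t. 0 \<le> t \<and> good n t}"
    and cover: "\<And>t. 0 \<le> t \<Longrightarrow> \<exists>n. good n t"
    and slab: "\<And>n a b W. 0 \<le> a \<Longrightarrow> a < b \<Longrightarrow> (\<And>t. t \<in> {a..b} \<Longrightarrow> good n t) \<Longrightarrow> W \<in> \<W>
                 \<Longrightarrow> antimono_on {a..b} W"
    and growth: "\<And>n. \<exists>\<tau>>0. \<exists>m. \<forall>a b. 0 \<le> a \<and> a \<le> b \<and> b \<le> a + \<tau> \<and> good n a \<and>
                   (\<forall>W\<in>\<W>. antimono_on {a..b} W) \<longrightarrow> good m b"
    and W: "W \<in> \<W>"
  shows "antimono_on {0..} W"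
proof -
  define loc where "loc t \<longleftrightarrow> (\<exists>e>0. \<forall>W\<in>\<W>. antimono_on ({0..} \<inter> {t - e..t + e}) W)" for t
  define F where "F = {t. 0 \<le> t \<and> \<not> loc t}"
  have loc_antimono: "antimono_on {a..b} W"
    if ab: "0 \<le> a" and l: "\<And>t. t \<in> {a<..<b} \<Longrightarrow> loc t" and "W \<in> \<W>" for a b W
  proof (rule antimono_on_closure_interval)
    show "continuous_on {a..b} W"
      using cont[OF \<open>W \<in> \<W>\<close>] by (rule continuous_on_subset) (use ab in auto)
    show "antimono_on {a<..<b} W"
    proof (rule antimono_on_of_local)
      fix x assume x: "x \<in> {a<..<b}"
      then obtain e where "e > 0" and e: "antimono_on ({0..} \<inter> {x - e..x + e}) W"
        using l \<open>W \<in> \<W>\<close> unfolding loc_def by blast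
      have "antimono_on ({a<..<b} \<inter> {x - e..x + e}) W"
        by (rule monotone_on_subset[OF e]) (use ab in auto)
      with \<open>e > 0\<close> show "\<exists>e>0. antimono_on ({a<..<b} \<inter> {x - e..x + e}) W" by blast
    qed
  qed
  have "open {t. loc t}"
    unfolding open_dist
  proof clarify
    fix t assume "loc t"
    then obtain e where e: "e > 0" "\<And>W. W \<in> \<W> \<Longrightarrow> antimono_on ({0..} \<inter> {t - e..t + e}) W"
      unfolding loc_def by blast
    show "\<exists>d>0. \<forall>s. dist s t < d \<longrightarrow> s \<in> {t. loc t}"
    proof (intro exI[of _ "e / 2"] conjI allI impI CollectI)
      fix s assume s: "dist s t < e / 2"
      have "antimono_on ({0..} \<inter> {s - e / 2..s + e / 2}) W" if "W \<in> \<W>" for W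
      proof (rule monotone_on_subset[OF e(2)[OF that]], rule subsetI)
        fix x assume "x \<in> {0..} \<inter> {s - e / 2..s + e / 2}"
        moreover have "t - e / 2 < s" "s < t + e / 2" using s unfolding dist_real_def by linarith+
        ultimately show "x \<in> {0..} \<inter> {t - e..t + e}" by auto
      qed
      then show "loc s" unfolding loc_def using e(1) half_gt_zero by blast
    qed (use e in auto)
  qed
  moreover have "F = {0..} \<inter> - {t. loc t}" by (auto simp: F_def)
  ultimately have "closed F" by (auto intro!: closed_Int)
  have "F = {}"
  proof (rule ccontr)
    assume "F \<noteq> {}"
    define C where "C n = {t. 0 \<le> t \<and> good n t}" for n
    \<comment> \<open>Otherwise the relatively open sets \<open>F - C n\<close> would all be dense
      in \<open>F\<close>, although their intersection is empty because the sets \<open>C n\<close>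
      cover all times.\<close>
    have "\<exists>n. \<not> F \<subseteq> closure (F - C n)"
    proof (rule ccontr)
      assume *: "\<nexists>n. \<not> F \<subseteq> closure (F - C n)"
      have "F \<subseteq> closure (\<Inter> (range (\<lambda>n. F - C n)))"
      proof (rule Baire)
        fix T assume "T \<in> range (\<lambda>n. F - C n)"
        then obtain n where T: "T = F - C n" by blast
        have "openin (top_of_set F) (F - C n)"
          using closed_good[of n] unfolding C_def[symmetric]
          by (metis Diff_eq Int_commute open_Compl openin_open)
        then show "openin (top_of_set F) T \<and> F \<subseteq> closure T" using * T by blast
      qed (use \<open>closed F\<close> in auto)
      also have "\<Inter> (range (\<lambda>n. F - C n)) = {}"
        using cover by (auto simp: C_def F_def)
      finally show False using \<open>F \<noteq> {}\<close> by simp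
    qed
    then obtain n t0 where t0: "t0 \<in> F" "t0 \<notin> closure (F - C n)" by blast
    then obtain e where e: "e > 0" and "\<And>s. s \<in> F - C n \<Longrightarrow> \<not> dist s t0 < e"
      unfolding closure_approachable by blast
    then have good_n: "good n s" if "s \<in> F" "\<bar>s - t0\<bar> < e" for s
      using that by (auto simp: C_def F_def dist_real_def)
    obtain \<tau> m where "\<tau> > 0" and \<tau>: "\<And>a b. 0 \<le> a \<Longrightarrow> a \<le> b \<Longrightarrow> b \<le> a + \<tau> \<Longrightarrow> good n a \<Longrightarrow>
                   (\<And>W. W \<in> \<W> \<Longrightarrow> antimono_on {a..b} W) \<Longrightarrow> good m b"
      using growth[of n] by blast
    \<comment> \<open>With a third of the minimum, two times within \<open>d\<close> of
      \<open>t0\<close> are less than \<open>\<tau>\<close> apart, and points of \<open>F\<close>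
      within \<open>d\<close> of \<open>t0\<close> are also within \<open>e\<close>.\<close>
    define d where "d = min e \<tau> / 3"
    have d: "d > 0" "d < e" "2 * d < \<tau>" using \<open>e > 0\<close> \<open>\<tau> > 0\<close> by (auto simp: d_def)
    have good_m: "good m s" if r: "r \<in> F" "\<bar>r - t0\<bar> < d" and s: "r \<le> s" "s \<le> t0 + d" for r s
    proof -
      \<comment> \<open>The last point of \<open>F\<close> up to \<open>s\<close>. It is close
        enough to \<open>t0\<close> to be good with index \<open>n\<close>, and no point of
        \<open>F\<close> lies between it and \<open>s\<close>, so \<open>growth\<close> carries the
        bound to \<open>s\<close> with index \<open>m\<close>.\<close>
      define a where "a = Sup (F \<inter> {..s})"
      have ne: "F \<inter> {..s} \<noteq> {}" and bdd: "bdd_above (F \<inter> {..s})" using r s by auto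
      have aF: "a \<in> F \<inter> {..s}"
        unfolding a_def using \<open>closed F\<close> by (intro closed_contains_Sup ne bdd closed_Int) auto
      have ra: "r \<le> a" unfolding a_def using r s by (intro cSup_upper bdd) auto
      have l: "loc t" if "t \<in> {a<..<s}" for t
      proof (rule ccontr)
        assume "\<not> loc t"
        then have "t \<in> F \<inter> {..s}" using that aF by (auto simp: F_def)
        then have "t \<le> a" unfolding a_def by (intro cSup_upper bdd)
        with that show False by simp
      qed
      show ?thesis
      proof (rule \<tau>)
        show "0 \<le> a" "a \<le> s" using aF by (auto simp: F_def)
        show "s \<le> a + \<tau>" using ra r s d by auto
        show "good n a" using aF ra r s d by (intro good_n) auto
        show "antimono_on {a..s} W" if "W \<in> \<W>" for W
          using aF l that by (intro loc_antimono) (auto simp: F_def)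
      qed
    qed
    have t0': "0 \<le> t0" "\<not> loc t0" using t0 by (auto simp: F_def)
    \<comment> \<open>If \<open>F\<close> has points just to the left of \<open>t0\<close>, the
      uniform bound starts at one of them and covers a neighbourhood. If not, the left side is a gap
      of \<open>F\<close>, where monotonicity is already known, and the two sides are glued at
      \<open>t0\<close>.\<close>
    have "loc t0"
    proof (cases "\<exists>r\<in>F. t0 - d < r \<and> r < t0")
      case True
      then obtain r where r: "r \<in> F" "t0 - d < r" "r < t0" by blast
      have anti: "antimono_on {r..t0 + d} W" if "W \<in> \<W>" for W
        using r d good_m[of r] that by (intro slab[of r "t0 + d" m]) (auto simp: F_def)
      have "antimono_on ({0..} \<inter> {t0 - (t0 - r)..t0 + (t0 - r)}) W" if "W \<in> \<W>" for W
        by (rule monotone_on_subset[OF anti[OF that]]) (use r in auto)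
      then show ?thesis unfolding loc_def using r by (intro exI[of _ "t0 - r"]) auto
    next
      case False
      have right: "antimono_on {t0..t0 + d} W" if "W \<in> \<W>" for W
        using t0 d good_m[of t0] that by (intro slab[of t0 "t0 + d" m]) (auto simp: F_def)
      have left: "antimono_on {max 0 (t0 - d)..t0} W" if "W \<in> \<W>" for W
        using False that by (intro loc_antimono) (auto simp: F_def)
      have "antimono_on ({0..} \<inter> {t0 - d..t0 + d}) W" if "W \<in> \<W>" for W
      proof (rule monotone_onI)
        fix p q assume pq: "p \<in> {0..} \<inter> {t0 - d..t0 + d}" "q \<in> {0..} \<inter> {t0 - d..t0 + d}" "p \<le> q"
        have "W t0 \<le> W p" if "p \<le> t0"
          using pq that t0' by (intro monotone_onD[OF left[OF \<open>W \<in> \<W>\<close>]]) auto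
        moreover have "W q \<le> W t0" if "t0 \<le> q"
          using pq that t0' d by (intro monotone_onD[OF right[OF \<open>W \<in> \<W>\<close>]]) auto
        moreover have "W q \<le> W p" if "q \<le> t0"
          using pq that t0' by (intro monotone_onD[OF left[OF \<open>W \<in> \<W>\<close>]]) auto
        moreover have "W q \<le> W p" if "t0 \<le> p"
          using pq that t0' d by (intro monotone_onD[OF right[OF \<open>W \<in> \<W>\<close>]]) auto
        ultimately show "W q \<le> W p" by linarith
      qed
      then show ?thesis unfolding loc_def using d by blast
    qed
    with t0' show False by blast
  qed
  show ?thesis
  proof (rule monotone_onI)
    fix s t :: real assume st: "s \<in> {0..}" "t \<in> {0..}" "s \<le> t"
    have "antimono_on {s..t} W" using \<open>F = {}\<close> st W by (intro loc_antimono) (auto simp: F_def)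
    then show "W t \<le> W s" by (rule monotone_onD) (use st in auto)
  qed
qed

section \<open>Entropies\<close>

lemma has_real_derivative_max_power:
  assumes "n \<ge> 2"
  shows "((\<lambda>x::real. (max 0 (x - c)) ^ n) has_real_derivative real n * (max 0 (x - c)) ^ (n - 1)) (at x)"
proof (cases "x = c")
  case False
  then consider "x > c" | "x < c" by linarith
  then show ?thesis
  proof cases
    case 1
    have "((\<lambda>x. (x - c) ^ n) has_real_derivative real n * (x - c) ^ (n - 1)) (at x)"
      by (rule derivative_eq_intros refl | simp)+
    then show ?thesis
      using 1 eventually_nhds_in_open[of "{c<..}" x]
      by (subst DERIV_cong_ev[OF refl _ refl, of _ "\<lambda>x. (x - c) ^ n"])
        (auto elim!: eventually_mono)
  next
    case 2
    then show ?thesis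
      using assms eventually_nhds_in_open[of "{..<c}" x]
      by (subst DERIV_cong_ev[OF refl _ refl, of _ "\<lambda>x. 0"])
        (auto elim!: eventually_mono simp: power_0_left)
  qed
next
  case True
  have "((\<lambda>x. (max 0 (x - c)) ^ n) has_real_derivative 0) (at c)"
    unfolding has_field_derivative_iff
  proof (rule Lim_null_comparison)
    show "\<forall>\<^sub>F y in at c. norm ((max 0 (y - c) ^ n - max 0 (c - c) ^ n) / (y - c)) \<le> \<bar>y - c\<bar> ^ (n - 1)"
    proof (rule always_eventually, rule allI)
      show "norm ((max 0 (y - c) ^ n - max 0 (c - c) ^ n) / (y - c)) \<le> \<bar>y - c\<bar> ^ (n - 1)" for y
        using assms by (cases "c < y"; cases n) simp_all
    qed
    show "((\<lambda>y. \<bar>y - c\<bar> ^ (n - 1)) \<longlongrightarrow> 0) (at c)"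
      using assms by (auto intro!: tendsto_eq_intros)
  qed
  then show ?thesis using True assms by (simp add: power_0_left)
qed

text \<open>\<open>step_fn\<close> is the quadratic spline rising from 0 to 1 on the unit interval.\<close>

definition step_slope :: "real \<Rightarrow> real" where
  "step_slope x = 4 * (max 0 x - 2 * max 0 (x - 1 / 2) + max 0 (x - 1))"

definition step_fn :: "real \<Rightarrow> real" where
  "step_fn x = 2 * ((max 0 x)\<^sup>2 - 2 * (max 0 (x - 1 / 2))\<^sup>2 + (max 0 (x - 1))\<^sup>2)"

text \<open>A positive part smoothed on \<open>[0, 1]\<close>: zero to the left,
  \<open>x - 1/2\<close> to the right, and cubic at the onset. It is twice continuously
  differentiable with derivatives \<open>step_fn\<close> and \<open>step_slope\<close>.\<close>

definition step_prim :: "real \<Rightarrow> real" where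
  "step_prim x = 2 / 3 * ((max 0 x) ^ 3 - 2 * (max 0 (x - 1 / 2)) ^ 3 + (max 0 (x - 1)) ^ 3)"

lemma DERIV_step_prim [derivative_intros]:
  assumes "(f has_real_derivative f') (at x within A)"
  shows "((\<lambda>x. step_prim (f x)) has_real_derivative step_fn (f x) * f') (at x within A)"
proof -
  note D = has_real_derivative_max_power[of 3, simplified]
  have "(step_prim has_real_derivative step_fn y) (at y)" for y
    unfolding step_prim_def[abs_def] step_fn_def
    using DERIV_cmult[OF DERIV_add[OF DERIV_diff[OF D[of 0] DERIV_cmult[OF D[of "1/2"]]] D[of 1]], of "2/3" 2 y]
    by (simp add: algebra_simps)
  from DERIV_chain2[OF this assms] show ?thesis .
qed

lemma DERIV_step_fn [derivative_intros]:
  assumes "(f has_real_derivative f') (at x within A)"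
  shows "((\<lambda>x. step_fn (f x)) has_real_derivative step_slope (f x) * f') (at x within A)"
proof -
  note D = has_real_derivative_max_power[of 2, simplified]
  have "(step_fn has_real_derivative step_slope y) (at y)" for y
    unfolding step_fn_def[abs_def] step_slope_def
    using DERIV_cmult[OF DERIV_add[OF DERIV_diff[OF D[of 0] DERIV_cmult[OF D[of "1/2"]]] D[of 1]], of 2 2 y]
    by (simp add: algebra_simps)
  from DERIV_chain2[OF this assms] show ?thesis .
qed

lemma step_slope_nonneg: "0 \<le> step_slope x"
  by (auto simp: step_slope_def max_def)

lemma step_fn_mono: "x \<le> y \<Longrightarrow> step_fn x \<le> step_fn y"
  by (rule DERIV_nonneg_imp_nondecreasing[of x y step_fn])
    (auto intro!: exI[of _ "step_slope _"] DERIV_step_fn[OF DERIV_ident, simplified] step_slope_nonneg)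

lemma step_fn_0: "x \<le> 0 \<Longrightarrow> step_fn x = 0"
  by (simp add: step_fn_def)

lemma step_fn_1: "1 \<le> x \<Longrightarrow> step_fn x = 1"
  by (simp add: step_fn_def power2_eq_square algebra_simps)

lemma step_fn_bounds: "0 \<le> step_fn x" "step_fn x \<le> 1"
  using step_fn_mono[of "min 0 x" x] step_fn_mono[of x "max 1 x"] by (auto simp: step_fn_0 step_fn_1)

lemma step_prim_0: "x \<le> 0 \<Longrightarrow> step_prim x = 0"
  by (simp add: step_prim_def)

lemma step_prim_mono: "x \<le> y \<Longrightarrow> step_prim x \<le> step_prim y"
  by (rule DERIV_nonneg_imp_nondecreasing[of x y step_prim])
    (auto intro!: exI[of _ "step_fn _"] DERIV_step_prim[OF DERIV_ident, simplified] step_fn_bounds)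

lemma step_prim_nonneg: "0 \<le> step_prim x"
  using step_prim_mono[of "min 0 x" x] by (simp add: step_prim_0)

lemma step_prim_ge_1:
  assumes "1 \<le> x"
  shows "step_prim x = x - 1 / 2"
proof -
  have "max 0 x = x" "max 0 (x - 1 / 2) = x - 1 / 2" "max 0 (x - 1) = x - 1"
    using assms by auto
  then show ?thesis by (simp only: step_prim_def) (simp add: power3_eq_cube algebra_simps)
qed

lemma step_prim_half: "step_prim (1 / 2) = 1 / 12"
  by (simp add: step_prim_def power3_eq_cube)

lemma step_prim_ge: "x - 1 / 2 \<le> step_prim x"
proof (cases "x \<ge> 1")
  case False
  have "x - step_prim x \<le> 1 - step_prim 1"
  proof (rule DERIV_nonneg_imp_nondecreasing[of x 1 "\<lambda>x. x - step_prim x"])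
    show "\<exists>D. ((\<lambda>x. x - step_prim x) has_real_derivative D) (at z) \<and> 0 \<le> D" for z
      using DERIV_diff[OF DERIV_ident DERIV_step_prim[OF DERIV_ident], of z UNIV] step_fn_bounds[of z]
      by (intro exI[of _ "1 - step_fn z * 1"]) auto
  qed (use False in auto)
  then show ?thesis by (simp add: step_prim_ge_1)
qed (simp add: step_prim_ge_1)

lemma step_prim_pos: "0 < x \<Longrightarrow> 0 < step_prim x"
proof -
  assume "0 < x"
  then have "0 < step_prim (min x (1 / 2))" by (auto simp: step_prim_def min_def)
  also have "\<dots> \<le> step_prim x" by (rule step_prim_mono) simp
  finally show ?thesis .
qed

text \<open>Up to 1/2 the spline is a pure cubic \<open>f\<close>, so \<open>x f' = 3 f\<close>;
  beyond, \<open>step_prim\<close> is at least 1/12 and the left side at most \<open>M\<close>. The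
  polynomial onset is essential: for a flat function such as exp(-1/x) the quotient
  \<open>x f' / f\<close> is unbounded near 0.\<close>

lemma step_fn_mult_le:
  assumes "0 \<le> x" "x \<le> M"
  shows "x * step_fn x \<le> (3 + 12 * M) * step_prim x"
proof (cases "x \<le> 1 / 2")
  case True
  then have "max 0 x = x" "max 0 (x - 1 / 2) = 0" "max 0 (x - 1) = 0" using assms by auto
  then have "x * step_fn x = 3 * step_prim x"
    by (simp add: step_fn_def step_prim_def power2_eq_square power3_eq_cube)
  also have "\<dots> \<le> (3 + 12 * M) * step_prim x"
    using assms step_prim_nonneg[of x] by (intro mult_right_mono) auto
  finally show ?thesis .
next
  case False
  have "step_prim (1 / 2) \<le> step_prim x" using False by (intro step_prim_mono) auto
  then have p: "1 / 12 \<le> step_prim x" by (simp add: step_prim_half)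
  have "x * step_fn x \<le> M * 1" using assms step_fn_bounds[of x] by (intro mult_mono) auto
  also have "\<dots> \<le> 12 * M * step_prim x" using p assms mult_left_mono[of "1/12" "step_prim x" "12 * M"] by simp
  also have "\<dots> \<le> (3 + 12 * M) * step_prim x"
    using assms step_prim_nonneg[of x] by (intro mult_right_mono) auto
  finally show ?thesis .
qed

text \<open>\<open>ent k l d\<close> measures the distance to the interval \<open>[-l, k]\<close>, smoothed at scale \<open>d\<close>.\<close>

definition ent :: "real \<Rightarrow> real \<Rightarrow> real \<Rightarrow> real \<Rightarrow> real" where
  "ent k l d u = d * step_prim ((u - k) / d) + d * step_prim ((- u - l) / d)"

definition dent :: "real \<Rightarrow> real \<Rightarrow> real \<Rightarrow> real \<Rightarrow> real" where
  "dent k l d u = step_fn ((u - k) / d) - step_fn ((- u - l) / d)"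

definition ddent :: "real \<Rightarrow> real \<Rightarrow> real \<Rightarrow> real \<Rightarrow> real" where
  "ddent k l d u = step_slope ((u - k) / d) / d + step_slope ((- u - l) / d) / d"

lemma DERIV_ent:
  assumes "d > 0"
  shows "(ent k l d has_real_derivative dent k l d u) (at u)"
proof -
  have "(ent k l d has_real_derivative
          d * (step_fn ((u - k) / d) * (1 / d)) + d * (step_fn ((- u - l) / d) * (- 1 / d))) (at u)"
    unfolding ent_def[abs_def]
    by (intro DERIV_add DERIV_cmult DERIV_step_prim)
      (rule derivative_eq_intros refl | use assms in simp)+
  then show ?thesis using assms by (simp add: dent_def)
qed

lemma DERIV_dent:
  assumes "d > 0"
  shows "(dent k l d has_real_derivative ddent k l d u) (at u)"
proof -
  have "(dent k l d has_real_derivative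
          step_slope ((u - k) / d) * (1 / d) - step_slope ((- u - l) / d) * (- 1 / d)) (at u)"
    unfolding dent_def[abs_def]
    by (intro DERIV_diff DERIV_step_fn)
      (rule derivative_eq_intros refl | use assms in simp)+
  then show ?thesis by (simp add: ddent_def)
qed

lemma continuous_step_slope: "continuous_on UNIV step_slope"
  unfolding step_slope_def[abs_def] by (intro continuous_intros)

lemma continuous_ddent:
  assumes "d > 0"
  shows "continuous_on UNIV (ddent k l d)"
proof -
  have "continuous_on UNIV (\<lambda>u. (u - k) / d)" "continuous_on UNIV (\<lambda>u. (- u - l) / d)"
    using assms by (auto intro!: continuous_intros)
  then have "continuous_on UNIV (\<lambda>u. step_slope ((u - k) / d) / d)"
    "continuous_on UNIV (\<lambda>u. step_slope ((- u - l) / d) / d)"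
    using assms
    by (auto intro!: continuous_on_divide continuous_on_compose2[OF continuous_step_slope])
  then show ?thesis unfolding ddent_def[abs_def] by (rule continuous_on_add)
qed

lemma ddent_eq_step_fn: "d > 0 \<Longrightarrow> 0 \<le> ddent k l d u"
  by (simp add: ddent_def step_slope_nonneg)

lemma ent_nonneg: "d > 0 \<Longrightarrow> 0 \<le> ent k l d u"
  by (simp add: ent_def step_prim_nonneg)

lemma ent_eq_0: "d > 0 \<Longrightarrow> - l \<le> u \<Longrightarrow> u \<le> k \<Longrightarrow> ent k l d u = 0"
  by (simp add: ent_def step_prim_0 divide_le_0_iff)

lemma ent_pos:
  assumes "d > 0" "u \<notin> {-l..k}"
  shows "0 < ent k l d u"
proof -
  have "(u - k) / d > 0 \<or> (- u - l) / d > 0" using assms by auto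
  then have "step_prim ((u - k) / d) + step_prim ((- u - l) / d) > 0"
    using step_prim_pos step_prim_nonneg by (auto intro: add_pos_nonneg add_nonneg_pos)
  then show ?thesis using assms(1) unfolding ent_def distrib_left[symmetric] by simp
qed

lemma ent_ge:
  assumes "d > 0"
  shows "u - k - d / 2 \<le> ent k l d u" "- u - l - d / 2 \<le> ent k l d u"
proof -
  have *: "z - d / 2 \<le> d * step_prim (z / d)" for z
  proof -
    have "z - d / 2 = d * (z / d - 1 / 2)" using assms by (simp add: field_simps)
    also have "\<dots> \<le> d * step_prim (z / d)" using assms step_prim_ge by (intro mult_left_mono) auto
    finally show ?thesis .
  qed
  have **: "0 \<le> d * step_prim x" for x using assms step_prim_nonneg by simp
  show "u - k - d / 2 \<le> ent k l d u"
    using *[of "u - k"] **[of "(- u - l) / d"] unfolding ent_def by linarith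
  show "- u - l - d / 2 \<le> ent k l d u"
    using *[of "- u - l"] **[of "(u - k) / d"] unfolding ent_def by linarith
qed

lemma dent_abs_le: "\<bar>dent k l d u\<bar> \<le> 1"
  using step_fn_bounds[of "(u - k) / d"] step_fn_bounds[of "(- u - l) / d"] by (simp add: dent_def)

lemma dent_mono: "d > 0 \<Longrightarrow> u \<le> w \<Longrightarrow> dent k l d u \<le> dent k l d w"
  unfolding dent_def by (intro diff_mono step_fn_mono divide_right_mono) auto

lemma ent_lipschitz:
  assumes "d > 0"
  shows "\<bar>ent k l d u - ent k l d w\<bar> \<le> \<bar>u - w\<bar>"
proof -
  have "norm (ent k l d u - ent k l d w) \<le> 1 * norm (u - w)"
    by (rule field_differentiable_bound[of UNIV _ "dent k l d"])
      (use DERIV_ent[OF assms] dent_abs_le in auto)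
  then show ?thesis by simp
qed

section \<open>Entropy fluxes and the lane-change term\<close>

lemma lipschitz_on_mult_exists:
  fixes f g :: "real \<Rightarrow> real"
  assumes f: "\<exists>L. L-lipschitz_on {a..b} f" and g: "\<exists>L. L-lipschitz_on {a..b} g"
  shows "\<exists>L. L-lipschitz_on {a..b} (\<lambda>x. f x * g x)"
proof -
  obtain K L where K: "K-lipschitz_on {a..b} f" and L: "L-lipschitz_on {a..b} g" using f g by blast
  have "compact (f ` {a..b})" "compact (g ` {a..b})"
    using K L by (auto intro!: compact_continuous_image lipschitz_on_continuous_on)
  then obtain A B where A: "\<And>x. x \<in> {a..b} \<Longrightarrow> \<bar>f x\<bar> \<le> A" "0 < A"
    and B: "\<And>x. x \<in> {a..b} \<Longrightarrow> \<bar>g x\<bar> \<le> B" "0 < B"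
    by (metis (no_types, lifting) bounded_pos compact_imp_bounded image_eqI real_norm_def)
  have "(A * L + B * K)-lipschitz_on {a..b} (\<lambda>x. f x * g x)"
  proof (rule lipschitz_onI)
    show "0 \<le> A * L + B * K"
      using A B lipschitz_on_nonneg[OF K] lipschitz_on_nonneg[OF L] by simp
    fix x y assume xy: "x \<in> {a..b}" "y \<in> {a..b}"
    have "f x * g x - f y * g y = f x * (g x - g y) + g y * (f x - f y)" by (simp add: algebra_simps)
    then have "\<bar>f x * g x - f y * g y\<bar> \<le> \<bar>f x\<bar> * \<bar>g x - g y\<bar> + \<bar>g y\<bar> * \<bar>f x - f y\<bar>"
      by (metis abs_mult abs_triangle_ineq)
    also have "\<dots> \<le> A * (L * \<bar>x - y\<bar>) + B * (K * \<bar>x - y\<bar>)"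
      using A B xy lipschitz_onD[OF K, of x y] lipschitz_onD[OF L, of x y]
      by (intro add_mono mult_mono) (auto simp: dist_real_def)
    finally show "dist (f x * g x) (f y * g y) \<le> (A * L + B * K) * dist x y"
      by (simp add: dist_real_def algebra_simps)
  qed
  then show ?thesis by blast
qed

lemma lipschitz_on_diff_exists:
  fixes f g :: "real \<Rightarrow> real"
  assumes f: "\<exists>L. L-lipschitz_on S f" and g: "\<exists>L. L-lipschitz_on S g"
  shows "\<exists>L. L-lipschitz_on S (\<lambda>x. f x - g x)"
  using f g lipschitz_on_diff by blast

lemma lipschitz_on_interval_of_DERIV:
  fixes f :: "real \<Rightarrow> real"
  assumes "\<And>x. (f has_real_derivative f' x) (at x)" "continuous_on UNIV f'"
  shows "\<exists>L. L-lipschitz_on {a..b} f"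
proof -
  have "compact (f' ` {a..b})"
    using assms(2) by (auto intro!: compact_continuous_image elim: continuous_on_subset)
  then obtain A where A: "\<And>x. x \<in> {a..b} \<Longrightarrow> \<bar>f' x\<bar> \<le> A" "0 < A"
    by (metis (no_types, lifting) bounded_pos compact_imp_bounded image_eqI real_norm_def)
  have "A-lipschitz_on {a..b} f"
  proof (rule lipschitz_onI)
    fix x y assume xy: "x \<in> {a..b}" "y \<in> {a..b}"
    have "norm (f x - f y) \<le> A * norm (x - y)"
      by (rule field_differentiable_bound[of "{a..b}" f f'])
        (use xy A assms(1) in \<open>auto intro: DERIV_subset\<close>)
    then show "dist (f x) (f y) \<le> A * dist x y" by (simp add: dist_real_def)
  qed (use A in simp)
  then show ?thesis by blast
qed

lemma velocity_less: "velocity v \<Longrightarrow> x < y \<Longrightarrow> v y < v x"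
  unfolding velocity_def by (auto dest: monotone_onD)

lemma velocity_le: "velocity v \<Longrightarrow> x \<le> y \<Longrightarrow> v y \<le> v x"
  using velocity_less[of v x y] by (cases "x = y") auto

lemma velocity_1: "velocity v \<Longrightarrow> v 1 = 0"
  by (simp add: velocity_def)

lemma velocity_nonneg: "velocity v \<Longrightarrow> x \<le> 1 \<Longrightarrow> 0 \<le> v x"
  using velocity_le[of v x 1] velocity_1[of v] by simp

lemma velocity_nonpos: "velocity v \<Longrightarrow> 1 \<le> x \<Longrightarrow> v x \<le> 0"
  using velocity_le[of v 1 x] velocity_1[of v] by simp

lemma velocity_lipschitz:
  assumes "velocity v"
  obtains L where "0 \<le> L" "\<And>x y. \<bar>v x - v y\<bar> \<le> L * \<bar>x - y\<bar>"
proof -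
  obtain L where L: "L-lipschitz_on UNIV v" using assms unfolding velocity_def by blast
  show ?thesis using that[OF lipschitz_on_nonneg[OF L]] lipschitz_onD[OF L] by (auto simp: dist_real_def)
qed

lemma flux_lipschitz:
  assumes "velocity v"
  shows "\<exists>L. L-lipschitz_on {a..b} (flux v)"
proof -
  obtain L where "L-lipschitz_on UNIV v" using assms unfolding velocity_def by blast
  then have "\<exists>L. L-lipschitz_on {a..b} v" using lipschitz_on_subset by blast
  moreover have "\<exists>L. L-lipschitz_on {a..b} (\<lambda>x::real. x)"
    by (rule lipschitz_on_interval_of_DERIV[where f' = "\<lambda>_. 1"]) auto
  ultimately show ?thesis
    unfolding flux_def[abs_def] by (intro lipschitz_on_mult_exists)
qed

text \<open>The flux is not differentiable everywhere, so the entropy flux \<open>\<integral> \<eta>' f'\<close> is obtained by parts as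
  \<open>\<eta>' f - \<integral> \<eta>'' f\<close>.\<close>

lemma entropy_pair_ent:
  assumes v: "velocity v" and d: "d > 0"
  obtains q where "entropy_pair v (ent k l d) q" "continuous_on UNIV q" "q 0 = 0"
proof -
  define g where "g u = flux v u * ddent k l d u" for u
  obtain L where L: "L-lipschitz_on UNIV v" using v unfolding velocity_def by blast
  have fc: "continuous_on UNIV (flux v)"
    unfolding flux_def[abs_def] using lipschitz_on_continuous_on[OF L] by (intro continuous_intros)
  have gc: "continuous_on UNIV g"
    unfolding g_def[abs_def] using fc continuous_ddent[OF d] by (intro continuous_intros)
  then obtain J where J: "\<And>x. (J has_real_derivative g x) (at x)"
    using einterval_antiderivative[of "- \<infinity>" \<infinity> g] continuous_on_eq_continuous_at[of UNIV g]
    by (auto simp: has_real_derivative_iff_has_vector_derivative)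
  define q where "q u = dent k l d u * flux v u - J u" for u
  have eta': "deriv (ent k l d) u = dent k l d u" for u
    by (rule DERIV_imp_deriv[OF DERIV_ent[OF d]])
  have q': "(q has_real_derivative dent k l d u * D) (at u)"
    if "(flux v has_real_derivative D) (at u)" for u D
    using DERIV_diff[OF DERIV_mult[OF DERIV_dent[OF d, of k l] that] J]
    unfolding q_def[abs_def] g_def by (simp add: algebra_simps)
  \<comment> \<open>Normalising the flux to vanish at 0 bounds it by a multiple of
    \<open>|u|\<close> on bounded sets, so that the flux of a bounded integrable density is
    integrable.\<close>
  have "entropy_pair v (ent k l d) (\<lambda>u. q u - q 0)"
    unfolding entropy_pair_def
  proof (intro conjI allI)
    show "convex_on UNIV (ent k l d)"
      by (rule f''_ge0_imp_convex[of UNIV _ "dent k l d" "ddent k l d"])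
        (use DERIV_ent DERIV_dent ddent_eq_step_fn d in auto)
    show "ent k l d differentiable (at u)" for u
      using DERIV_ent[OF d] real_differentiable_def by blast
    have "\<exists>L. L-lipschitz_on {a..b} q" for a b
      unfolding q_def[abs_def]
      by (intro lipschitz_on_diff_exists lipschitz_on_mult_exists flux_lipschitz v
          lipschitz_on_interval_of_DERIV[OF DERIV_dent[OF d] continuous_ddent[OF d]]
          lipschitz_on_interval_of_DERIV[OF J gc])
    then show "\<exists>L. L-lipschitz_on {a..b} (\<lambda>u. q u - q 0)" for a b
      by (simp add: lipschitz_on_def dist_real_def)
    show "AE u in lborel. \<forall>D. (flux v has_real_derivative D) (at u) \<longrightarrow>
        ((\<lambda>u. q u - q 0) has_real_derivative deriv (ent k l d) u * D) (at u)"
      using DERIV_diff[OF q' DERIV_const] by (intro AE_I2) (simp add: eta')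
  qed
  moreover have "continuous_on UNIV (dent k l d)" "continuous_on UNIV J"
    using DERIV_dent[OF d] J by (meson DERIV_isCont continuous_at_imp_continuous_on)+
  then have "continuous_on UNIV (\<lambda>u. q u - q 0)"
    unfolding q_def using fc by (intro continuous_intros)
  ultimately show ?thesis using that[of "\<lambda>u. q u - q 0"] by simp
qed

section \<open>Sign and size of the lane-change term\<close>

lemma lane_change_eq:
  "lane_change v1 v2 x y = max 0 (v2 y - v1 x) * x - max 0 (v1 x - v2 y) * y"
  by (simp add: lane_change_def pos_part_def neg_part_def max_def min_def algebra_simps)

lemma lane_change_swap: "lane_change v2 v1 y x = - lane_change v1 v2 x y"
  by (simp add: lane_change_eq)

lemma lane_change_abs_le:
  assumes "\<bar>v1 x\<bar> \<le> A" "\<bar>v2 y\<bar> \<le> A"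
  shows "\<bar>lane_change v1 v2 x y\<bar> \<le> 2 * A * (\<bar>x\<bar> + \<bar>y\<bar>)"
proof -
  have "\<bar>lane_change v1 v2 x y\<bar> \<le> max 0 (v2 y - v1 x) * \<bar>x\<bar> + max 0 (v1 x - v2 y) * \<bar>y\<bar>"
    unfolding lane_change_eq by (rule order_trans[OF abs_triangle_ineq4]) (simp add: abs_mult)
  also have "\<dots> \<le> 2 * A * \<bar>x\<bar> + 2 * A * \<bar>y\<bar>"
    using assms by (intro add_mono mult_right_mono) auto
  finally show ?thesis by (simp add: algebra_simps)
qed

text \<open>The contribution of the lane change to the time derivative of \<open>\<eta>(u\<^sub>1) + \<eta>(u\<^sub>2)\<close>.\<close>

definition transfer :: "real \<Rightarrow> real \<Rightarrow> real \<Rightarrow> (real \<Rightarrow> real) \<Rightarrow> (real \<Rightarrow> real) \<Rightarrow> real \<Rightarrow> real \<Rightarrow> real" where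
  "transfer k l d v1 v2 x y = - (dent k l d x - dent k l d y) * lane_change v1 v2 x y"

text \<open>Relabelling the lanes changes nothing, so the estimates below may assume that the first
  lane has the larger entropy slope.\<close>

lemma transfer_swap: "transfer k l d v1 v2 x y = transfer k l d v2 v1 y x"
  by (simp add: transfer_def lane_change_swap[of v1 v2] algebra_simps)

lemma dent_pos_imp:
  assumes "d > 0" "l \<ge> 0" "k \<ge> 0" "0 < dent k l d u"
  shows "k < u"
proof (rule ccontr)
  assume "\<not> k < u"
  then have "step_fn ((u - k) / d) = 0" using assms by (simp add: step_fn_0 divide_le_0_iff)
  then show False using assms step_fn_bounds[of "(- u - l) / d"] by (simp add: dent_def)
qed

lemma dent_neg: "dent k l d u = - dent l k d (- u)"
  by (simp add: dent_def)

lemma dent_eq_step_fn: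
  assumes "d > 0" "- l \<le> u"
  shows "dent k l d u = step_fn ((u - k) / d)"
  using assms by (simp add: dent_def step_fn_0 divide_le_0_iff)

lemma dent_less_1_imp:
  assumes "d > 0" "- l \<le> u" "dent k l d u < 1"
  shows "u < k + d"
proof (rule ccontr)
  assume "\<not> u < k + d"
  then have "(u - k) / d \<ge> 1" using assms by (simp add: le_divide_eq)
  then show False using assms by (simp add: dent_eq_step_fn step_fn_1)
qed

text \<open>As the first lane has the larger slope, only a gain of that lane counts. If
  \<open>x\<close> is above \<open>k\<close>, then \<open>v1 x \<le> 0\<close>; where the slopes
  differ, a gain requires \<open>0 < y < K\<close>, which bounds it by \<open>|v2 K| K\<close>.
  Otherwise \<open>y\<close> is below \<open>-k\<close>; a gain then requires
  \<open>- K < x < 0\<close>, where \<open>v1 x \<ge> 0\<close>, and it is at most \<open>K\<close>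
  times \<open>|v2 0| + L |y|\<close>. Neither constant involves a bound on the density that exceeds
  the threshold.\<close>

lemma transfer_growth_half:
  assumes v: "velocity v1" "velocity v2"
    and L: "0 \<le> L" "\<And>x. \<bar>v2 x - v2 0\<bar> \<le> L * \<bar>x\<bar>"
    and k: "1 \<le> k" "0 < d" "k + d \<le> K"
    and less: "dent k k d y \<le> dent k k d x"
  shows "transfer k k d v1 v2 x y \<le>
           K * (\<bar>v2 K\<bar> + \<bar>v2 0\<bar> + L) * ((if k < \<bar>x\<bar> then 1 + \<bar>x\<bar> else 0) + (if k < \<bar>y\<bar> then 1 + \<bar>y\<bar> else 0))"
    (is "_ \<le> ?C * ?s")
proof -
  define S where "S = - lane_change v1 v2 x y"
  define \<sigma> where "\<sigma> = dent k k d x - dent k k d y"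
  have P: "transfer k k d v1 v2 x y = \<sigma> * S" by (simp only: transfer_def S_def \<sigma>_def mult_minus_left mult_minus_right)
  have K: "0 < K" "1 \<le> K" using k by auto
  define R where "R = ?C * ?s"
  have s0: "0 \<le> R" unfolding R_def using K L(1) by (intro mult_nonneg_nonneg add_nonneg_nonneg) auto
  have sig0: "0 \<le> \<sigma>" using less by (simp add: \<sigma>_def)
  have neg: "\<sigma> * S \<le> R" if "S \<le> 0"
    using s0 mult_nonneg_nonpos[OF sig0 that] by linarith
  consider "\<sigma> = 0" | "\<sigma> > 0" "dent k k d x > 0" | "\<sigma> > 0" "dent k k d x \<le> 0"
    using sig0 by linarith
  then have "\<sigma> * S \<le> R"
  proof cases
    case 1
    then show ?thesis using s0 by simp
  next
    case 2
    have x: "k < x" using dent_pos_imp[of d k k x] 2 k by auto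
    have v1x: "v1 x \<le> 0" using x k v by (intro velocity_nonpos) auto
    have S: "S = max 0 (v1 x - v2 y) * y - max 0 (v2 y - v1 x) * x"
      by (simp add: S_def lane_change_eq)
    have Sy: "S \<le> max 0 (v1 x - v2 y) * y" using x k by (simp add: S)
    show ?thesis
    proof (cases "y \<le> 0")
      case True
      then show ?thesis using Sy mult_nonneg_nonpos[of "max 0 (v1 x - v2 y)" y] by (intro neg) auto
    next
      case False
      have dy: "dent k k d y = step_fn ((y - k) / d)" using False k by (intro dent_eq_step_fn) auto
      \<comment> \<open>The slopes differ and are at most 1, so \<open>y\<close> has not passed the
        smoothing zone above \<open>k\<close>.\<close>
      have "dent k k d y < 1" using 2 dent_abs_le[of k k d x] by (simp add: \<sigma>_def)
      then have yK: "y < K" using dent_less_1_imp[of d k y k] False k by auto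
      have "v2 K \<le> v2 y" using v yK by (auto intro!: velocity_le[of v2])
      then have "max 0 (v1 x - v2 y) \<le> \<bar>v2 K\<bar>" using v1x by auto
      then have "max 0 (v1 x - v2 y) * y \<le> \<bar>v2 K\<bar> * K" using False yK by (intro mult_mono) auto
      then have S1: "S \<le> \<bar>v2 K\<bar> * K" using Sy by linarith
      have "\<sigma> \<le> 1" using dent_abs_le[of k k d x] step_fn_bounds[of "(y - k) / d"] dy by (simp add: \<sigma>_def)
      have "\<sigma> * S \<le> \<sigma> * (\<bar>v2 K\<bar> * K)" using S1 sig0 by (intro mult_left_mono)
      also have "\<dots> \<le> 1 * (\<bar>v2 K\<bar> * K)" using K \<open>\<sigma> \<le> 1\<close> by (intro mult_right_mono) auto
      also have "\<dots> \<le> ?C * 1"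
        unfolding mult_1_left mult_1_right mult.commute[of "\<bar>v2 K\<bar>"] using K L(1) by (intro mult_left_mono) auto
      also have "\<dots> \<le> ?C * ?s" using x k K L(1)
        by (intro mult_left_mono) auto
      finally show ?thesis unfolding R_def .
    qed
  next
    case 3
    then have "0 < dent k k d (- y)" using dent_neg[of k k d y] by (simp add: \<sigma>_def)
    then have y: "y < - k" using dent_pos_imp[of d k k "- y"] k by auto
    have "dent k k d (- x) < 1" using 3 dent_abs_le[of k k d y] dent_neg[of k k d x] by (simp add: \<sigma>_def)
    have S: "S = max 0 (v1 x - v2 y) * y - max 0 (v2 y - v1 x) * x"
      by (simp add: S_def lane_change_eq)
    have "max 0 (v1 x - v2 y) * y \<le> 0" using y k by (intro mult_nonneg_nonpos) auto
    then have Sx: "S \<le> max 0 (v2 y - v1 x) * (- x)" by (simp add: S)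
    show ?thesis
    proof (cases "x \<ge> 0")
      case True
      then have "max 0 (v2 y - v1 x) * (- x) \<le> 0" by (intro mult_nonneg_nonpos) auto
      then show ?thesis using Sx by (intro neg) linarith
    next
      case False
      have xK: "- x < K" using dent_less_1_imp[of d k "- x" k] \<open>dent k k d (- x) < 1\<close> False k by auto
      have "0 \<le> v1 x" using v False by (intro velocity_nonneg) auto
      then have "max 0 (v2 y - v1 x) \<le> \<bar>v2 0\<bar> + L * \<bar>y\<bar>" using L(2)[of y] by auto
      have B0: "0 \<le> \<bar>v2 0\<bar> + L * \<bar>y\<bar>" using L(1) by simp
      have S1: "S \<le> (\<bar>v2 0\<bar> + L * \<bar>y\<bar>) * K"
      proof -
        have "max 0 (v2 y - v1 x) * (- x) \<le> (\<bar>v2 0\<bar> + L * \<bar>y\<bar>) * K"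
          using \<open>max 0 (v2 y - v1 x) \<le> \<bar>v2 0\<bar> + L * \<bar>y\<bar>\<close> False xK L(1) by (intro mult_mono) auto
        then show ?thesis using Sx by linarith
      qed
      have "\<sigma> \<le> 1" using dent_abs_le[of k k d y] 3 by (simp add: \<sigma>_def)
      have "\<sigma> * S \<le> \<sigma> * ((\<bar>v2 0\<bar> + L * \<bar>y\<bar>) * K)" using S1 sig0 by (intro mult_left_mono)
      also have "\<dots> \<le> 1 * ((\<bar>v2 0\<bar> + L * \<bar>y\<bar>) * K)"
        using K B0 \<open>\<sigma> \<le> 1\<close> by (intro mult_right_mono mult_nonneg_nonneg) auto
      also have "\<dots> \<le> ?C * (1 + \<bar>y\<bar>)"
      proof -
        have "\<bar>v2 0\<bar> + L * \<bar>y\<bar> \<le> (\<bar>v2 K\<bar> + \<bar>v2 0\<bar> + L) * (1 + \<bar>y\<bar>)"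
        proof -
          have "0 \<le> \<bar>v2 K\<bar> * \<bar>y\<bar>" "0 \<le> \<bar>v2 0\<bar> * \<bar>y\<bar>" by simp_all
          then show ?thesis using L(1) by (simp only: distrib_left distrib_right mult_1_right) linarith
        qed
        from mult_left_mono[OF this, of K] show ?thesis using K by (simp only: mult_ac mult_1_left)
      qed
      also have "\<dots> \<le> ?C * ?s" using y k K L(1)
        by (intro mult_left_mono) auto
      finally show ?thesis unfolding R_def .
    qed
  qed
  then show ?thesis unfolding P R_def .
qed

lemma transfer_growth:
  assumes v: "velocity v1" "velocity v2" and K: "0 < K"
  obtains C where "0 < C" "\<And>k d x y. 1 \<le> k \<Longrightarrow> 0 < d \<Longrightarrow> k + d \<le> K \<Longrightarrow>
    transfer k k d v1 v2 x y \<le>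
      C * ((if k < \<bar>x\<bar> then 1 + \<bar>x\<bar> else 0) + (if k < \<bar>y\<bar> then 1 + \<bar>y\<bar> else 0))"
proof -
  obtain L1 where L1: "0 \<le> L1" "\<And>x y. \<bar>v1 x - v1 y\<bar> \<le> L1 * \<bar>x - y\<bar>"
    using velocity_lipschitz[OF v(1)] by blast
  obtain L2 where L2: "0 \<le> L2" "\<And>x y. \<bar>v2 x - v2 y\<bar> \<le> L2 * \<bar>x - y\<bar>"
    using velocity_lipschitz[OF v(2)] by blast
  \<comment> \<open>The two orderings of the slopes contribute one summand each; the final 1 makes
    the constant strictly positive.\<close>
  define C where "C = K * (\<bar>v2 K\<bar> + \<bar>v2 0\<bar> + L2) + K * (\<bar>v1 K\<bar> + \<bar>v1 0\<bar> + L1) + 1"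
  show ?thesis
  proof (rule that[of C])
    show "0 < C" using K L1(1) L2(1) unfolding C_def by (intro add_nonneg_pos add_nonneg_nonneg mult_nonneg_nonneg) auto
    fix k d x y :: real assume k: "1 \<le> k" "0 < d" "k + d \<le> K"
    define s where "s = (if k < \<bar>x\<bar> then 1 + \<bar>x\<bar> else 0) + (if k < \<bar>y\<bar> then 1 + \<bar>y\<bar> else 0)"
    have s: "0 \<le> s" by (simp add: s_def)
    have C: "K * (\<bar>v2 K\<bar> + \<bar>v2 0\<bar> + L2) \<le> C" "K * (\<bar>v1 K\<bar> + \<bar>v1 0\<bar> + L1) \<le> C"
      using K L1(1) L2(1) by (simp_all add: C_def)
    show "transfer k k d v1 v2 x y \<le> C * ((if k < \<bar>x\<bar> then 1 + \<bar>x\<bar> else 0) + (if k < \<bar>y\<bar> then 1 + \<bar>y\<bar> else 0))"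
    proof (cases "dent k k d y \<le> dent k k d x")
      case True
      have "transfer k k d v1 v2 x y \<le> K * (\<bar>v2 K\<bar> + \<bar>v2 0\<bar> + L2) * s"
        unfolding s_def by (rule transfer_growth_half) (use v L2(1) L2(2)[of _ 0] k True in auto)
      also have "\<dots> \<le> C * s" using C s by (intro mult_right_mono)
      finally show ?thesis by (simp add: s_def)
    next
      case False
      have "transfer k k d v2 v1 y x \<le> K * (\<bar>v1 K\<bar> + \<bar>v1 0\<bar> + L1) * s"
        unfolding s_def add.commute[of "if k < \<bar>x\<bar> then _ else _"]
        by (rule transfer_growth_half) (use v L1(1) L1(2)[of _ 0] k False in auto)
      also have "\<dots> \<le> C * s" using C s by (intro mult_right_mono)
      finally show ?thesis by (simp add: s_def transfer_swap[of k k d v1 v2])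
    qed
  qed
qed

text \<open>Both velocities vanish at the upper end of the interval, which makes the gain of the
  first lane proportional to the overshoot. If \<open>x > 1\<close>, then
  \<open>v1 x \<le> 0\<close>; a gain needs \<open>v2 y < 0\<close>, hence \<open>1 < y < x\<close>,
  and Lipschitz continuity bounds it by \<open>L (x - 1) M\<close>. If \<open>y < 0\<close>, a gain
  needs \<open>y < x < 0\<close> and is at most \<open>- x \<le> - y\<close> times a bounded
  velocity. The product of overshoot and slope is then absorbed by
  \<open>step_fn_mult_le\<close>.\<close>

lemma transfer_decay_half:
  assumes v: "velocity v1" "velocity v2"
    and L: "0 \<le> L" "\<And>x y. \<bar>v2 x - v2 y\<bar> \<le> L * \<bar>x - y\<bar>"
    and M: "\<bar>x\<bar> \<le> M" "\<bar>y\<bar> \<le> M"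
    and less: "dent 1 0 1 y \<le> dent 1 0 1 x"
  shows "transfer 1 0 1 v1 v2 x y \<le>
           (L * M + \<bar>v2 0\<bar>) * (3 + 12 * M) * (ent 1 0 1 x + ent 1 0 1 y)"
    (is "_ \<le> ?C * _ * ?s")
proof -
  define S where "S = - lane_change v1 v2 x y"
  define \<sigma> where "\<sigma> = dent 1 0 1 x - dent 1 0 1 y"
  have P: "transfer 1 0 1 v1 v2 x y = \<sigma> * S" by (simp only: transfer_def S_def \<sigma>_def mult_minus_left mult_minus_right)
  have M0: "0 \<le> M" using M by auto
  have C0: "0 \<le> ?C" using L(1) M0 by simp
  have s0: "0 \<le> ?C * (3 + 12 * M) * ?s" using C0 M0 ent_nonneg[of 1 1 0] by simp
  have sig0: "0 \<le> \<sigma>" using less by (simp add: \<sigma>_def)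
  have neg: ?thesis if "S \<le> 0"
    using s0 mult_nonneg_nonpos[OF sig0 that] P by linarith
  have S: "S = max 0 (v1 x - v2 y) * y - max 0 (v2 y - v1 x) * x"
    by (simp add: S_def lane_change_eq)
  \<comment> \<open>Here \<open>z\<close> stands for the overshoot of the more extreme of the two
    densities.\<close>
  have main: ?thesis
    if "S \<le> ?C * z" "\<sigma> \<le> step_fn z" "0 \<le> z" "z \<le> M" "step_prim z \<le> ?s" for z
  proof -
    have "\<sigma> * S \<le> \<sigma> * (?C * z)" using that sig0 by (intro mult_left_mono)
    also have "\<dots> \<le> step_fn z * (?C * z)" using that C0 by (intro mult_right_mono mult_nonneg_nonneg)
    finally have "\<sigma> * S \<le> step_fn z * (?C * z)" .
    also have "\<dots> = ?C * (z * step_fn z)" by (simp only: mult_ac)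
    also have "\<dots> \<le> ?C * ((3 + 12 * M) * step_prim z)"
      using C0 that step_fn_mult_le by (intro mult_left_mono) auto
    also have "\<dots> \<le> ?C * ((3 + 12 * M) * ?s)"
      using C0 that M0 by (intro mult_left_mono) auto
    finally show ?thesis using P by (simp add: mult_ac)
  qed
  have ent: "step_prim (u - 1) \<le> ent 1 0 1 u" "step_prim (- u) \<le> ent 1 0 1 u" "0 \<le> ent 1 0 1 u" for u
    using step_prim_nonneg[of "u - 1"] step_prim_nonneg[of "- u"] by (simp_all add: ent_def)
  consider "\<sigma> = 0" | "\<sigma> > 0" "dent 1 0 1 x > 0" | "\<sigma> > 0" "dent 1 0 1 x \<le> 0"
    using sig0 by linarith
  then show ?thesis
  proof cases
    case 1
    then show ?thesis using P s0 by simp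
  next
    case 2
    have x: "1 < x" using dent_pos_imp[of 1 0 1 x] 2 by auto
    have v1x: "v1 x \<le> 0" using x v by (intro velocity_nonpos) auto
    have Sy: "S \<le> max 0 (v1 x - v2 y) * y" using x by (simp add: S)
    show ?thesis
    proof (cases "y \<le> 1")
      case True
      then have "0 \<le> v2 y" using v by (intro velocity_nonneg) auto
      then have "max 0 (v1 x - v2 y) = 0" using v1x by auto
      then show ?thesis using Sy by (intro neg) simp
    next
      case False
      have yx: "y < x"
      proof (rule ccontr)
        assume "\<not> y < x"
        then have "dent 1 0 1 x \<le> dent 1 0 1 y" by (intro dent_mono) auto
        then show False using 2 by (simp add: \<sigma>_def)
      qed
      have "- v2 y \<le> L * (y - 1)" using L(2)[of y 1] velocity_1[OF v(2)] False by auto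
      also have "\<dots> \<le> L * (x - 1)" using L(1) yx by (intro mult_left_mono) auto
      finally have "max 0 (v1 x - v2 y) \<le> L * (x - 1)" using v1x L(1) x by auto
      then have "max 0 (v1 x - v2 y) * y \<le> L * (x - 1) * M"
        using M False L(1) x by (intro mult_mono) auto
      also have "\<dots> = L * M * (x - 1)" by simp
      also have "\<dots> \<le> ?C * (x - 1)" using x by (intro mult_right_mono) auto
      finally have "S \<le> ?C * (x - 1)" using Sy by simp
      moreover have "\<sigma> \<le> step_fn (x - 1)"
        using False x step_fn_bounds[of "y - 1"] by (simp add: \<sigma>_def dent_def step_fn_0)
      ultimately show ?thesis
        using x M ent(1)[of x] ent(3)[of y] by (intro main[of "x - 1"]) auto
    qed
  next
    case 3
    then have "0 < dent 0 1 1 (- y)" using dent_neg[of 1 0 1 y] by (simp add: \<sigma>_def)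
    then have y: "y < 0" using dent_pos_imp[of 1 1 0 "- y"] by auto
    have "max 0 (v1 x - v2 y) * y \<le> 0" using y by (intro mult_nonneg_nonpos) auto
    then have Sx: "S \<le> max 0 (v2 y - v1 x) * (- x)" by (simp add: S)
    show ?thesis
    proof (cases "x \<ge> 0")
      case True
      then have "max 0 (v2 y - v1 x) * (- x) \<le> 0" by (intro mult_nonneg_nonpos) auto
      then show ?thesis using Sx by (intro neg) linarith
    next
      case False
      have yx: "y < x"
      proof (rule ccontr)
        assume "\<not> y < x"
        then have "dent 1 0 1 x \<le> dent 1 0 1 y" by (intro dent_mono) auto
        then show False using 3 by (simp add: \<sigma>_def)
      qed
      have "0 \<le> v1 x" using v False by (intro velocity_nonneg) auto
      moreover have "L * \<bar>y\<bar> \<le> L * M" using M L(1) by (intro mult_left_mono) auto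
      ultimately have "max 0 (v2 y - v1 x) \<le> ?C" using L(2)[of y 0] C0 by auto
      then have "max 0 (v2 y - v1 x) * (- x) \<le> ?C * (- y)"
        using yx False C0 by (intro mult_mono) auto
      then have "S \<le> ?C * (- y)" using Sx by simp
      moreover have "\<sigma> \<le> step_fn (- y)"
        using False y step_fn_bounds[of "- x"] by (simp add: \<sigma>_def dent_def step_fn_0)
      ultimately show ?thesis
        using y M ent(2)[of y] ent(3)[of x] by (intro main[of "- y"]) auto
    qed
  qed
qed

lemma transfer_decay:
  assumes v: "velocity v1" "velocity v2" and M: "0 \<le> M"
  obtains C where "0 \<le> C" "\<And>x y. \<bar>x\<bar> \<le> M \<Longrightarrow> \<bar>y\<bar> \<le> M \<Longrightarrow>
    transfer 1 0 1 v1 v2 x y \<le> C * (ent 1 0 1 x + ent 1 0 1 y)"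
proof -
  obtain L1 where L1: "0 \<le> L1" "\<And>x y. \<bar>v1 x - v1 y\<bar> \<le> L1 * \<bar>x - y\<bar>"
    using velocity_lipschitz[OF v(1)] by blast
  obtain L2 where L2: "0 \<le> L2" "\<And>x y. \<bar>v2 x - v2 y\<bar> \<le> L2 * \<bar>x - y\<bar>"
    using velocity_lipschitz[OF v(2)] by blast
  define A1 where "A1 = (L1 * M + \<bar>v1 0\<bar>) * (3 + 12 * M)"
  define A2 where "A2 = (L2 * M + \<bar>v2 0\<bar>) * (3 + 12 * M)"
  have A: "0 \<le> A1" "0 \<le> A2" using L1(1) L2(1) M by (simp_all add: A1_def A2_def)
  show ?thesis
  proof (rule that[of "A1 + A2"])
    show "0 \<le> A1 + A2" using A by simp
    fix x y :: real assume xy: "\<bar>x\<bar> \<le> M" "\<bar>y\<bar> \<le> M"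
    define s where "s = ent 1 0 1 x + ent 1 0 1 y"
    have s: "0 \<le> s" using ent_nonneg[of 1 1 0] by (simp add: s_def)
    have "transfer 1 0 1 v1 v2 x y \<le> (A1 + A2) * s"
    proof (cases "dent 1 0 1 y \<le> dent 1 0 1 x")
      case True
      then have "transfer 1 0 1 v1 v2 x y \<le> A2 * s"
        unfolding s_def A2_def using v L2 xy by (intro transfer_decay_half)
      also have "\<dots> \<le> (A1 + A2) * s" using A s by (intro mult_right_mono) auto
      finally show ?thesis .
    next
      case False
      then have "transfer 1 0 1 v2 v1 y x \<le> A1 * (ent 1 0 1 y + ent 1 0 1 x)"
        unfolding A1_def using v L1 xy by (intro transfer_decay_half) auto
      also have "\<dots> = A1 * s" by (simp add: s_def)
      also have "\<dots> \<le> (A1 + A2) * s" using A s by (intro mult_right_mono) auto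
      finally show ?thesis by (simp add: transfer_swap[of 1 0 1 v1 v2])
    qed
    then show "transfer 1 0 1 v1 v2 x y \<le> (A1 + A2) * (ent 1 0 1 x + ent 1 0 1 y)" by (simp add: s_def)
  qed
qed

section \<open>Inequalities from test functions of time\<close>

lemma integral_neg_of_nonpos:
  fixes f :: "real \<Rightarrow> real"
  assumes "continuous_on {a..b} f" "a < b" "\<And>x. x \<in> {a..b} \<Longrightarrow> f x \<le> 0" "c \<in> {a..b}" "f c < 0"
  shows "integral {a..b} f < 0"
proof -
  have "0 \<le> integral {a..b} (\<lambda>x. - f x)"
    using assms by (intro integral_nonneg integrable_neg integrable_continuous_real) auto
  moreover have "integral {a..b} (\<lambda>x. - f x) \<noteq> 0"
  proof
    assume "integral {a..b} (\<lambda>x. - f x) = 0"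
    then have "\<forall>x\<in>{a..b}. - f x = 0"
      using integral_eq_0_iff[OF continuous_on_minus[OF assms(1)] assms(2)] assms(3) by simp
    then show False using assms(4,5) by auto
  qed
  ultimately show ?thesis by simp
qed

text \<open>The boundary term at \<open>a\<close> vanishes through the primitive of
  \<open>H\<close>, the one at \<open>b\<close> through \<open>\<psi>\<close>. The same identity
  therefore serves test functions that do not vanish at the initial time.\<close>

lemma integral_test_by_parts:
  fixes A H :: "real \<Rightarrow> real"
  assumes ab: "a \<le> b" and A: "continuous_on {a..b} A" and H: "continuous_on {a..b} H"
    and \<psi>: "\<And>t. (\<psi> has_real_derivative \<psi>' t) (at t)" "continuous_on UNIV \<psi>'" "\<psi> b = 0"
  shows "integral {a..b} (\<lambda>t. \<psi>' t * A t + \<psi> t * H t)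
       = integral {a..b} (\<lambda>t. \<psi>' t * (A t - integral {a..t} H))"
proof -
  define I where "I t = integral {a..t} H" for t
  have I: "(I has_real_derivative H t) (at t within {a..b})" if "t \<in> {a..b}" for t
    unfolding I_def[abs_def] using H that by (rule integral_has_real_derivative)
  have Ic: "continuous_on {a..b} I"
    using I by (meson DERIV_continuous continuous_on_eq_continuous_within)
  have \<psi>c: "continuous_on {a..b} \<psi>" "continuous_on {a..b} \<psi>'"
    using \<psi> by (meson DERIV_isCont continuous_at_imp_continuous_on, blast intro: continuous_on_subset)
  have "((\<lambda>t. \<psi>' t * I t + \<psi> t * H t) has_integral (\<psi> b * I b - \<psi> a * I a)) {a..b}"
  proof (rule fundamental_theorem_of_calculus[OF ab])
    fix t assume t: "t \<in> {a..b}"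
    have "((\<lambda>t. \<psi> t * I t) has_real_derivative \<psi>' t * I t + H t * \<psi> t) (at t within {a..b})"
      by (rule DERIV_mult[OF has_field_derivative_at_within[OF \<psi>(1)] I[OF t]])
    then show "((\<lambda>t. \<psi> t * I t) has_vector_derivative \<psi>' t * I t + \<psi> t * H t) (at t within {a..b})"
      by (simp add: has_real_derivative_iff_has_vector_derivative mult.commute)
  qed
  then have 0: "integral {a..b} (\<lambda>t. \<psi>' t * I t + \<psi> t * H t) = 0"
    using \<psi>(3) by (simp add: integral_unique I_def)
  have "integral {a..b} (\<lambda>t. \<psi>' t * A t + \<psi> t * H t)
      = integral {a..b} (\<lambda>t. \<psi>' t * (A t - I t) + (\<psi>' t * I t + \<psi> t * H t))"
    by (simp add: algebra_simps)
  also have "\<dots> = integral {a..b} (\<lambda>t. \<psi>' t * (A t - I t))"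
    using A H Ic \<psi>c 0
    by (subst integral_add) (auto intro!: integrable_continuous_real continuous_intros)
  finally show ?thesis by (simp add: I_def)
qed

text \<open>If the function increased from \<open>p\<close> to \<open>q\<close>, a plateau rising
  near \<open>p\<close> and falling near \<open>q\<close> would give the integral a negative
  value.\<close>

lemma antimono_of_test_functions:
  fixes A H :: "real \<Rightarrow> real"
  assumes ab: "a < b" and A: "continuous_on {a..b} A" and H: "continuous_on {a..b} H"
    and test: "\<And>\<psi> \<psi>'. smooth_real \<psi> \<Longrightarrow> (\<And>t. (\<psi> has_real_derivative \<psi>' t) (at t)) \<Longrightarrow>
      (\<And>t. 0 \<le> \<psi> t) \<Longrightarrow> (\<And>t. t \<le> a \<Longrightarrow> \<psi> t = 0 \<and> \<psi>' t = 0) \<Longrightarrow> (\<And>t. b \<le> t \<Longrightarrow> \<psi> t = 0 \<and> \<psi>' t = 0) \<Longrightarrow>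
      0 \<le> integral {a..b} (\<lambda>t. \<psi>' t * A t + \<psi> t * H t)"
  shows "antimono_on {a..b} (\<lambda>t. A t - integral {a..t} H)"
proof -
  define W where "W t = A t - integral {a..t} H" for t
  have Wc: "continuous_on {a..b} W"
    unfolding W_def[abs_def]
    using A H by (intro continuous_on_diff indefinite_integral_continuous_1 integrable_continuous_real)
  have "antimono_on {a..b} W"
  proof (rule antimono_on_closure_interval[OF Wc], rule monotone_onI, rule ccontr)
    fix p q assume pq: "p \<in> {a<..<b}" "q \<in> {a<..<b}" "p \<le> q" and "\<not> W q \<le> W p"
    then have "W p < W q" "p < q" by (auto simp: le_less)
    define m where "m = (W p + W q) / 2"
    have m: "W p < m" "m < W q" using \<open>W p < W q\<close> by (auto simp: m_def)
    have Wo: "continuous_on {a<..<b} W" using Wc by (rule continuous_on_subset) auto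
    have "open ({a<..<b} \<inter> W -` {..<m})" "open ({a<..<b} \<inter> W -` {m<..})"
      using Wo by (intro continuous_open_preimage; simp)+
    then obtain e1 e2 where e1: "e1 > 0" "\<And>x. dist x p < e1 \<Longrightarrow> x \<in> {a<..<b} \<inter> W -` {..<m}"
      and e2: "e2 > 0" "\<And>x. dist x q < e2 \<Longrightarrow> x \<in> {a<..<b} \<inter> W -` {m<..}"
      using pq m unfolding open_dist by (metis (no_types, lifting) IntI greaterThan_iff lessThan_iff vimageI2)
    define e where "e = min (min e1 e2) (q - p) / 3"
    have e: "0 < e" "e < e1" "e < e2" "2 * e < q - p"
    proof -
      have "3 * e \<le> e1" "3 * e \<le> e2" "3 * e \<le> q - p" "0 < e"
        using e1(1) e2(1) \<open>p < q\<close> by (auto simp: e_def)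
      then show "0 < e" "e < e1" "e < e2" "2 * e < q - p" by auto
    qed
    obtain \<psi> \<psi>' where \<psi>: "smooth_real \<psi>" "\<And>\<tau>. (\<psi> has_real_derivative \<psi>' \<tau>) (at \<tau>)"
      "\<And>\<tau>. 0 \<le> \<psi> \<tau>" "\<And>\<tau>. \<tau> \<le> p - e \<Longrightarrow> \<psi> \<tau> = 0" "\<And>\<tau>. q + e \<le> \<tau> \<Longrightarrow> \<psi> \<tau> = 0"
      "\<And>\<tau>. e \<le> \<bar>\<tau> - q\<bar> \<Longrightarrow> 0 \<le> \<psi>' \<tau>" "\<And>\<tau>. e \<le> \<bar>\<tau> - p\<bar> \<Longrightarrow> \<psi>' \<tau> \<le> 0" "0 < \<psi>' p"
      using exists_plateau[OF e(1) \<open>p < q\<close>] e(4) by metis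
    have psi'c: "continuous_on UNIV \<psi>'"
    proof -
      obtain f' where "smooth_real f'" "\<And>x. (\<psi> has_real_derivative f' x) (at x)"
        using smooth_real_derivative[OF \<psi>(1)] by blast
      moreover from this \<psi>(2) have "\<psi>' = f'" by (auto intro: DERIV_unique)
      ultimately show ?thesis by (simp add: smooth_real_continuous)
    qed
    have ends: "a \<le> p - e" "q + e \<le> b"
    proof -
      show "a \<le> p - e" using e1(2)[of "p - e"] e by (auto simp: dist_real_def)
      show "q + e \<le> b" using e2(2)[of "q + e"] e by (auto simp: dist_real_def)
    qed
    have far: "e \<le> \<bar>\<tau> - p\<bar>" "e \<le> \<bar>\<tau> - q\<bar>" if "\<tau> \<le> a \<or> b \<le> \<tau>" for \<tau>
      using that ends e \<open>p < q\<close> by auto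
    have "0 \<le> integral {a..b} (\<lambda>t. \<psi>' t * A t + \<psi> t * H t)"
    proof (rule test[OF \<psi>(1-3)])
      show "\<psi> t = 0 \<and> \<psi>' t = 0" if "t \<le> a" for t
        using \<psi>(4)[of t] \<psi>(6,7)[of t] far[of t] that ends by (auto intro: antisym)
      show "\<psi> t = 0 \<and> \<psi>' t = 0" if "b \<le> t" for t
        using \<psi>(5)[of t] \<psi>(6,7)[of t] far[of t] that ends by (auto intro: antisym)
    qed
    also have "\<dots> = integral {a..b} (\<lambda>t. \<psi>' t * W t)"
      unfolding W_def using ab A H \<psi>(2) psi'c \<psi>(5)[OF ends(2)] by (intro integral_test_by_parts) auto
    finally have 1: "0 \<le> integral {a..b} (\<lambda>t. \<psi>' t * W t)" .
    have "(\<psi>' has_integral (\<psi> b - \<psi> a)) {a..b}"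
      using ab \<psi>(2)
      by (intro fundamental_theorem_of_calculus)
        (auto simp flip: has_real_derivative_iff_has_vector_derivative intro: has_field_derivative_at_within)
    then have "integral {a..b} \<psi>' = 0" using \<psi>(4)[OF ends(1)] \<psi>(5)[OF ends(2)] by (simp add: integral_unique)
    moreover have "integral {a..b} (\<lambda>t. \<psi>' t * W t - m * \<psi>' t)
        = integral {a..b} (\<lambda>t. \<psi>' t * W t) - m * integral {a..b} \<psi>'"
      using Wc continuous_on_subset[OF psi'c subset_UNIV]
      by (subst integral_diff) (auto intro!: integrable_continuous_real continuous_intros)
    ultimately have 2: "0 \<le> integral {a..b} (\<lambda>t. \<psi>' t * (W t - m))" using 1 by (simp add: algebra_simps)
    have "integral {a..b} (\<lambda>t. \<psi>' t * (W t - m)) < 0"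
    proof (rule integral_neg_of_nonpos[where c = p])
      show "continuous_on {a..b} (\<lambda>t. \<psi>' t * (W t - m))"
        using Wc continuous_on_subset[OF psi'c subset_UNIV] by (intro continuous_intros)
      show "\<psi>' p * (W p - m) < 0" using \<psi>(8) m by (simp add: mult_pos_neg)
      fix x assume "x \<in> {a..b}"
      consider "\<bar>x - p\<bar> < e" | "\<bar>x - q\<bar> < e" | "e \<le> \<bar>x - p\<bar>" "e \<le> \<bar>x - q\<bar>" by linarith
      then show "\<psi>' x * (W x - m) \<le> 0"
      proof cases
        case 1
        then have "W x < m" using e1(2)[of x] e by (auto simp: dist_real_def)
        moreover have "0 \<le> \<psi>' x" using 1 e by (intro \<psi>(6)) linarith
        ultimately show ?thesis by (intro mult_nonneg_nonpos) auto
      next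
        case 2
        then have "m < W x" using e2(2)[of x] e by (auto simp: dist_real_def)
        moreover have "\<psi>' x \<le> 0" using 2 e by (intro \<psi>(7)) linarith
        ultimately show ?thesis by (intro mult_nonpos_nonneg) auto
      next
        case 3
        then show ?thesis using \<psi>(6,7)[of x] by (simp add: antisym)
      qed
    qed (use pq ab in auto)
    with 2 show False by simp
  qed
  then show ?thesis by (simp add: W_def[abs_def])
qed

text \<open>The same contradiction with a plateau that rises before time 0: only its fall near
  \<open>q\<close> is seen, and no initial value of \<open>A\<close> appears on the right. The case
  \<open>q = 0\<close>, reached by continuity, says \<open>A 0 \<le> 0\<close>; this is how weakly
  imposed initial data reach the solution at time 0.\<close>

lemma le_integral_of_test_functions:
  fixes A H :: "real \<Rightarrow> real"
  assumes ab: "0 < b" and A: "continuous_on {0..b} A" and H: "continuous_on {0..b} H"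
    and test: "\<And>\<psi> \<psi>'. smooth_real \<psi> \<Longrightarrow> (\<And>t. (\<psi> has_real_derivative \<psi>' t) (at t)) \<Longrightarrow>
      (\<And>t. 0 \<le> \<psi> t) \<Longrightarrow> (\<And>t. t \<le> - 2 \<Longrightarrow> \<psi> t = 0) \<Longrightarrow> (\<And>t. b \<le> t \<Longrightarrow> \<psi> t = 0 \<and> \<psi>' t = 0) \<Longrightarrow>
      0 \<le> integral {0..b} (\<lambda>t. \<psi>' t * A t + \<psi> t * H t)"
    and q: "q \<in> {0..b}"
  shows "A q \<le> integral {0..q} H"
proof -
  define W where "W t = A t - integral {0..t} H" for t
  have Wc: "continuous_on {0..b} W"
    unfolding W_def[abs_def]
    using A H by (intro continuous_on_diff indefinite_integral_continuous_1 integrable_continuous_real)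
  have pos: "W q \<le> 0" if q: "q \<in> {0<..<b}" for q
  proof (rule ccontr)
    assume "\<not> W q \<le> 0"
    then have Wq: "0 < W q" by simp
    have Wo: "continuous_on {0<..<b} W" using Wc by (rule continuous_on_subset) auto
    have "open ({0<..<b} \<inter> W -` {0<..})"
      using Wo by (intro continuous_open_preimage; simp)
    then obtain e2 where e2: "e2 > 0" "\<And>x. dist x q < e2 \<Longrightarrow> x \<in> {0<..<b} \<inter> W -` {0<..}"
      using q Wq unfolding open_dist
      by (metis (no_types, lifting) IntI greaterThan_iff vimageI2)
    define e where "e = min e2 1 / 3"
    have e: "0 < e" "e < e2" "e < 1" "2 * e < q - (- 1)"
    proof -
      have "3 * e \<le> e2" "3 * e \<le> 1" "0 < e" using e2(1) by (auto simp: e_def)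
      then show "0 < e" "e < e2" "e < 1" "2 * e < q - (- 1)" using q by auto
    qed
    have less: "- 1 < q" using q by simp
    obtain \<psi> \<psi>' where \<psi>: "smooth_real \<psi>" "\<And>\<tau>. (\<psi> has_real_derivative \<psi>' \<tau>) (at \<tau>)"
      "\<And>\<tau>. 0 \<le> \<psi> \<tau>" "\<And>\<tau>. \<tau> \<le> - 1 - e \<Longrightarrow> \<psi> \<tau> = 0" "\<And>\<tau>. q + e \<le> \<tau> \<Longrightarrow> \<psi> \<tau> = 0"
      "\<And>\<tau>. e \<le> \<bar>\<tau> - q\<bar> \<Longrightarrow> 0 \<le> \<psi>' \<tau>" "\<And>\<tau>. e \<le> \<bar>\<tau> - (- 1)\<bar> \<Longrightarrow> \<psi>' \<tau> \<le> 0" "\<psi>' q < 0"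
      using exists_plateau[OF e(1) less] e(4) by metis
    have psi'c: "continuous_on UNIV \<psi>'"
    proof -
      obtain f' where "smooth_real f'" "\<And>x. (\<psi> has_real_derivative f' x) (at x)"
        using smooth_real_derivative[OF \<psi>(1)] by blast
      moreover from this \<psi>(2) have "\<psi>' = f'" by (auto intro: DERIV_unique)
      ultimately show ?thesis by (simp add: smooth_real_continuous)
    qed
    have ends: "q + e \<le> b" using e2(2)[of "q + e"] e by (auto simp: dist_real_def)
    \<comment> \<open>The rise around -1 has half-width below 1, so at nonnegative times the plateau
      only decreases.\<close>
    have le0: "\<psi>' x \<le> 0" if "0 \<le> x" for x using that e by (intro \<psi>(7)) auto
    have "0 \<le> integral {0..b} (\<lambda>t. \<psi>' t * A t + \<psi> t * H t)"
    proof (rule test[OF \<psi>(1-3)])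
      show "\<psi> t = 0" if "t \<le> - 2" for t using \<psi>(4)[of t] that e by auto
      show "\<psi> t = 0 \<and> \<psi>' t = 0" if "b \<le> t" for t
        using \<psi>(5)[of t] \<psi>(6)[of t] le0[of t] that ends ab by (auto intro!: antisym)
    qed
    also have "\<dots> = integral {0..b} (\<lambda>t. \<psi>' t * W t)"
      unfolding W_def using ab A H \<psi>(2) psi'c \<psi>(5)[OF ends] by (intro integral_test_by_parts) auto
    finally have 1: "0 \<le> integral {0..b} (\<lambda>t. \<psi>' t * W t)" .
    have "integral {0..b} (\<lambda>t. \<psi>' t * W t) < 0"
    proof (rule integral_neg_of_nonpos[where c = q])
      show "continuous_on {0..b} (\<lambda>t. \<psi>' t * W t)"
        using Wc continuous_on_subset[OF psi'c subset_UNIV] by (intro continuous_intros)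
      show "\<psi>' q * W q < 0" using \<psi>(8) \<open>\<not> W q \<le> 0\<close> by (simp add: mult_neg_pos)
      fix x assume x: "x \<in> {0..b}"
      show "\<psi>' x * W x \<le> 0"
      proof (cases "\<bar>x - q\<bar> < e")
        case True
        then have "0 < W x" using e2(2)[of x] e by (auto simp: dist_real_def)
        then show ?thesis using le0[of x] x by (intro mult_nonpos_nonneg) auto
      next
        case False
        then have "\<psi>' x = 0" using le0[of x] \<psi>(6)[of x] x by (auto intro: antisym)
        then show ?thesis by simp
      qed
    qed (use q ab in auto)
    with 1 show False by simp
  qed
  have "W q \<le> 0"
    by (rule continuous_le_on_closure[of "{0<..<b}" W q]) (use Wc pos ab q in auto)
  then show ?thesis by (simp add: W_def)
qed

section \<open>Iterated integral inequalities\<close>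

lemma iterated_integral_bound:
  fixes F :: "nat \<Rightarrow> real \<Rightarrow> real"
  assumes K: "0 \<le> K" and cont: "\<And>j. j \<le> N \<Longrightarrow> continuous_on {a..b} (F j)"
    and start: "\<And>t. t \<in> {a..b} \<Longrightarrow> F 0 t \<le> A"
    and step: "\<And>j t. j < N \<Longrightarrow> t \<in> {a..b} \<Longrightarrow> F (Suc j) t \<le> K * integral {a..t} (F j)"
  shows "j \<le> N \<Longrightarrow> t \<in> {a..b} \<Longrightarrow> F j t \<le> A * (K * (t - a)) ^ j / fact j"
proof (induction j arbitrary: t)
  case 0
  then show ?case using start by simp
next
  case (Suc j)
  have "((\<lambda>s. A * (K * (s - a)) ^ j / fact j) has_integral
          A * K ^ j * (t - a) ^ Suc j / fact (Suc j) - A * K ^ j * (a - a) ^ Suc j / fact (Suc j)) {a..t}"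
  proof (rule fundamental_theorem_of_calculus)
    fix s
    have "((\<lambda>s. A * K ^ j * (s - a) ^ Suc j / fact (Suc j)) has_real_derivative
            A * K ^ j * (real (Suc j) * (s - a) ^ j) / fact (Suc j)) (at s within {a..t})"
      by (rule derivative_eq_intros refl | simp)+
    also have "A * K ^ j * (real (Suc j) * (s - a) ^ j) / fact (Suc j) = A * (K * (s - a)) ^ j / fact j"
      by (simp add: power_mult_distrib divide_simps del: of_nat_Suc)
    finally show "((\<lambda>s. A * K ^ j * (s - a) ^ Suc j / fact (Suc j)) has_vector_derivative
            A * (K * (s - a)) ^ j / fact j) (at s within {a..t})"
      by (simp add: has_real_derivative_iff_has_vector_derivative)
  qed (use Suc in auto)
  then have I: "((\<lambda>s. A * (K * (s - a)) ^ j / fact j) has_integral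
          A * K ^ j * (t - a) ^ Suc j / fact (Suc j)) {a..t}" by simp
  have "integral {a..t} (F j) \<le> A * K ^ j * (t - a) ^ Suc j / fact (Suc j)"
  proof (rule has_integral_le[OF integrable_integral I])
    show "F j integrable_on {a..t}"
      using Suc.prems by (intro integrable_continuous_real continuous_on_subset[OF cont]) auto
  qed (use Suc in auto)
  then have "K * integral {a..t} (F j) \<le> K * (A * K ^ j * (t - a) ^ Suc j / fact (Suc j))"
    using K by (rule mult_left_mono)
  also have "\<dots> = A * (K * (t - a)) ^ Suc j / fact (Suc j)" by (simp add: power_mult_distrib mult_ac)
  finally show ?case using step[of j t] Suc.prems by simp
qed

text \<open>The iteration applied to a constant family bounds \<open>E t\<close> by a multiple of
  every term of an exponential series, and these terms tend to 0.\<close>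

lemma gronwall_zero:
  fixes E :: "real \<Rightarrow> real"
  assumes K: "0 \<le> K" and cont: "continuous_on {a..b} E"
    and le: "\<And>t. t \<in> {a..b} \<Longrightarrow> E t \<le> K * integral {a..t} E"
    and t: "t \<in> {a..b}"
  shows "E t \<le> 0"
proof -
  have "bounded (E ` {a..b})" using cont by (intro compact_imp_bounded compact_continuous_image) auto
  then obtain A where A: "\<And>t. t \<in> {a..b} \<Longrightarrow> E t \<le> A"
    unfolding bounded_iff by (force simp: abs_le_iff)
  have "E t \<le> A * ((K * (t - a)) ^ j /\<^sub>R fact j)" for j
    using iterated_integral_bound[of K j a b "\<lambda>_. E" A j t] K cont le A t by (simp add: divide_inverse mult_ac)
  moreover have "(\<lambda>j. A * ((K * (t - a)) ^ j /\<^sub>R fact j)) \<longlonglongrightarrow> A * 0"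
    by (intro tendsto_intros summable_LIMSEQ_zero summable_exp_generic)
  ultimately show ?thesis by (intro LIMSEQ_le_const[where X = "\<lambda>j. A * ((K * (t - a)) ^ j /\<^sub>R fact j)"]) auto
qed

text \<open>Outside \<open>[-k, k]\<close> the left side is at most \<open>|u| - k\<close>, since
  \<open>ent\<close> has Lipschitz constant 1, while smoothing costs the right side at most
  \<open>d'/2\<close>.\<close>

lemma ent_le_ent:
  assumes d: "0 < d" "0 < d'" and k: "0 \<le> k" "k' + d' / 2 \<le> k"
  shows "ent k k d u \<le> ent k' k' d' u"
proof -
  have e0: "ent k k d k = 0" "ent k k d (- k) = 0" using d k by (auto intro!: ent_eq_0)
  consider "- k \<le> u" "u \<le> k" | "k < u" | "u < - k" by linarith
  then show ?thesis
  proof cases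
    case 1
    then show ?thesis using d by (simp add: ent_eq_0 ent_nonneg)
  next
    case 2
    then have "ent k k d u \<le> u - k" using ent_lipschitz[OF d(1), of k k u k] e0 by auto
    then show ?thesis using ent_ge(1)[OF d(2), of u k' k'] k by linarith
  next
    case 3
    then have "ent k k d u \<le> - u - k" using ent_lipschitz[OF d(1), of k k u "- k"] e0 by auto
    then show ?thesis using ent_ge(2)[OF d(2), of u k' k'] k by linarith
  qed
qed

section \<open>Entropy solutions on time intervals with a uniform bound\<close>

lemma spacetime_integrable_inner:
  assumes "spacetime_integrable F"
  shows "set_integrable lborel {0..} (\<lambda>t. LINT x|lborel. F t x)"
proof -
  have "integrable (lborel \<Otimes>\<^sub>M lborel)
          (\<lambda>(t, x). indicator {0..} t *\<^sub>R F t x)"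
    using assms unfolding spacetime_integrable_def set_integrable_def lborel_prod
    by (rule back_subst[of "integrable _"]) (auto simp: indicator_def fun_eq_iff)
  then have "integrable lborel (\<lambda>t. LINT x|lborel. indicator {0..} t *\<^sub>R F t x)"
    by (rule lborel_pair.integrable_fst)
  then show ?thesis by (simp add: set_integrable_def)
qed

lemma spacetime_integrable_add:
  "spacetime_integrable F \<Longrightarrow> spacetime_integrable G \<Longrightarrow> spacetime_integrable (\<lambda>t x. F t x + G t x)"
  unfolding spacetime_integrable_def by (drule (1) set_integral_add(1)) (simp add: case_prod_unfold)

lemma finite_total_variation_bounded:
  assumes "finite_total_variation g"
  obtains B where "\<And>x. \<bar>g x\<bar> \<le> B"
proof -
  obtain M where M: "\<And>n (p :: nat \<Rightarrow> real). mono p \<Longrightarrow> (\<Sum>i<n. \<bar>g (p (Suc i)) - g (p i)\<bar>) \<le> M"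
    using assms unfolding finite_total_variation_def by blast
  have step: "\<bar>g y - g x\<bar> \<le> M" if "x \<le> y" for x y
  proof -
    \<comment> \<open>A sequence with a single jump reduces the variation to one increment.\<close>
    have "mono (\<lambda>i::nat. if i = 0 then x else y)" using that by (auto simp: mono_def)
    from M[OF this, of 1] show ?thesis by simp
  qed
  have "\<bar>g x\<bar> \<le> \<bar>g 0\<bar> + M" for x
    using step[of x 0] step[of 0 x] by (cases "x \<le> 0") auto
  then show ?thesis by (rule that)
qed

locale two_lane_solution =
  fixes v1 v2 u10 u20 :: "real \<Rightarrow> real" and u1 u2 :: "real \<Rightarrow> real \<Rightarrow> real"
  assumes vel: "velocity v1" "velocity v2"
    and sol: "entropy_solution v1 v2 u10 u20 u1 u2"
begin

lemma continuous_into: "continuous_into_L1 u1" "continuous_into_L1 u2"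
  using sol unfolding entropy_solution_def weak_solution_def by auto

lemma integrable_u: "0 \<le> t \<Longrightarrow> integrable lborel (u1 t)" "0 \<le> t \<Longrightarrow> integrable lborel (u2 t)"
  using continuous_into unfolding continuous_into_L1_def by auto

section \<open>Integrals over the line at fixed times\<close>

definition L1_dist :: "real \<Rightarrow> real \<Rightarrow> real" where
  "L1_dist s t = (LINT x|lborel. \<bar>u1 s x - u1 t x\<bar>) + (LINT x|lborel. \<bar>u2 s x - u2 t x\<bar>)"

lemma L1_dist_tendsto: "0 \<le> t \<Longrightarrow> ((\<lambda>s. L1_dist s t) \<longlongrightarrow> 0) (at t within {0..})"
  using continuous_into unfolding continuous_into_L1_def L1_dist_def
  by (auto intro!: tendsto_add_zero)

lemma continuous_on_of_L1_dist:
  assumes "\<And>s t. 0 \<le> s \<Longrightarrow> 0 \<le> t \<Longrightarrow> \<bar>G s - G t\<bar> \<le> L1_dist s t"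
  shows "continuous_on {0..} G"
  unfolding continuous_on_def
proof
  fix t :: real assume t: "t \<in> {0..}"
  have "((\<lambda>s. G s - G t) \<longlongrightarrow> 0) (at t within {0..})"
  proof (rule Lim_null_comparison[OF _ L1_dist_tendsto])
    show "\<forall>\<^sub>F s in at t within {0..}. norm (G s - G t) \<le> L1_dist s t"
      unfolding eventually_at_filter using assms t by (intro always_eventually) auto
  qed (use t in simp)
  then show "(G \<longlongrightarrow> G t) (at t within {0..})" by (simp add: LIM_zero_iff)
qed

text \<open>The linear bound is asked only along \<open>u\<close>, because the entropy fluxes
  satisfy such a bound on bounded sets only.\<close>

lemma integrable_comp_u:
  assumes \<zeta>: "continuous_on UNIV \<zeta>" "AE x in lborel. \<bar>\<zeta> (u x)\<bar> \<le> c * \<bar>u x\<bar>" and u: "integrable lborel u"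
    and w: "continuous_on UNIV w" "\<And>x. \<bar>w x\<bar> \<le> D"
  shows "integrable lborel (\<lambda>x. w x * \<zeta> (u x) :: real)"
proof (rule Bochner_Integration.integrable_bound[of _ "\<lambda>x. D * (c * \<bar>u x\<bar>)"])
  have [measurable]: "\<zeta> \<in> borel_measurable borel" "w \<in> borel_measurable borel" "u \<in> borel_measurable lborel"
    using \<zeta> w u by (auto intro: borel_measurable_continuous_onI)
  show "(\<lambda>x. w x * \<zeta> (u x)) \<in> borel_measurable lborel" by measurable
  have "0 \<le> D" using w(2)[of 0] by linarith
  show "AE x in lborel. norm (w x * \<zeta> (u x)) \<le> norm (D * (c * \<bar>u x\<bar>))"
    using \<zeta>(2)
  proof eventually_elim
    case (elim x)
    have "\<bar>w x\<bar> * \<bar>\<zeta> (u x)\<bar> \<le> D * (c * \<bar>u x\<bar>)"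
      using elim w(2) \<open>0 \<le> D\<close> by (intro mult_mono) auto
    then show ?case using abs_ge_self[of "D * (c * \<bar>u x\<bar>)"] unfolding real_norm_def abs_mult[of "w x"] by linarith
  qed
qed (use u in auto)

context
  fixes k l d :: real
  assumes kld: "0 \<le> k" "0 \<le> l" "0 < d"
begin

lemma ent_abs_le: "\<bar>ent k l d u\<bar> \<le> 1 * \<bar>u\<bar>"
  using ent_lipschitz[OF kld(3), of k l u 0] ent_eq_0[OF kld(3), of l 0 k] kld by simp

lemma continuous_ent: "continuous_on UNIV (ent k l d)"
  using DERIV_ent[OF kld(3)] by (meson DERIV_isCont continuous_at_imp_continuous_on)

lemma continuous_dent: "continuous_on UNIV (dent k l d)"
  using DERIV_dent[OF kld(3)] by (meson DERIV_isCont continuous_at_imp_continuous_on)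

lemma integrable_ent:
  assumes "continuous_on UNIV w" "\<And>x. \<bar>w x\<bar> \<le> D" "0 \<le> t"
  shows "integrable lborel (\<lambda>x. w x * ent k l d (u1 t x))" "integrable lborel (\<lambda>x. w x * ent k l d (u2 t x))"
  by (rule integrable_comp_u[OF continuous_ent AE_I2[OF ent_abs_le] integrable_u(1)[OF assms(3)] assms(1,2)],
      rule integrable_comp_u[OF continuous_ent AE_I2[OF ent_abs_le] integrable_u(2)[OF assms(3)] assms(1,2)])

end

definition excess :: "(real \<Rightarrow> real) \<Rightarrow> real \<Rightarrow> real \<Rightarrow> real \<Rightarrow> real \<Rightarrow> real" where
  "excess w k l d t = (LINT x|lborel. w x * ent k l d (u1 t x)) + (LINT x|lborel. w x * ent k l d (u2 t x))"

lemma continuous_excess: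
  assumes kld: "0 \<le> k" "0 \<le> l" "0 < d" and w: "continuous_on UNIV w" "\<And>x. \<bar>w x\<bar> \<le> 1"
  shows "continuous_on {0..} (excess w k l d)"
proof (rule continuous_on_of_L1_dist)
  fix s t :: real assume st: "0 \<le> s" "0 \<le> t"
  have *: "\<bar>(LINT x|lborel. w x * ent k l d (f x)) - (LINT x|lborel. w x * ent k l d (g x))\<bar>
      \<le> (LINT x|lborel. \<bar>f x - g x\<bar>)"
    if "integrable lborel f" "integrable lborel g" "integrable lborel (\<lambda>x. w x * ent k l d (f x))"
      "integrable lborel (\<lambda>x. w x * ent k l d (g x))" for f g
  proof -
    have "\<bar>(LINT x|lborel. w x * ent k l d (f x)) - (LINT x|lborel. w x * ent k l d (g x))\<bar>
        = \<bar>LINT x|lborel. w x * ent k l d (f x) - w x * ent k l d (g x)\<bar>"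
      using that by simp
    also have "\<dots> \<le> (LINT x|lborel. \<bar>w x * ent k l d (f x) - w x * ent k l d (g x)\<bar>)"
      by (rule integral_abs_bound)
    also have "\<dots> \<le> (LINT x|lborel. \<bar>f x - g x\<bar>)"
    proof (rule integral_mono)
      fix x
      have "\<bar>w x\<bar> * \<bar>ent k l d (f x) - ent k l d (g x)\<bar> \<le> 1 * \<bar>f x - g x\<bar>"
        using w(2) ent_lipschitz[OF kld(3)] by (intro mult_mono) auto
      then show "\<bar>w x * ent k l d (f x) - w x * ent k l d (g x)\<bar> \<le> \<bar>f x - g x\<bar>"
        by (simp add: abs_mult flip: right_diff_distrib)
    qed (use that in auto)
    finally show ?thesis .
  qed
  show "\<bar>excess w k l d s - excess w k l d t\<bar> \<le> L1_dist s t"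
    unfolding excess_def L1_dist_def
    using *[OF integrable_u(1)[OF st(1)] integrable_u(1)[OF st(2)]
        integrable_ent(1)[OF kld w st(1)] integrable_ent(1)[OF kld w st(2)]]
      *[OF integrable_u(2)[OF st(1)] integrable_u(2)[OF st(2)]
        integrable_ent(2)[OF kld w st(1)] integrable_ent(2)[OF kld w st(2)]]
    by linarith
qed

lemma excess_nonneg: "0 < d \<Longrightarrow> (\<And>x. 0 \<le> w x) \<Longrightarrow> 0 \<le> excess w k l d t"
  unfolding excess_def by (intro add_nonneg_nonneg integral_nonneg_AE AE_I2 mult_nonneg_nonneg) (auto simp: ent_nonneg)

lemma integrable_of_bound:
  fixes g :: "real \<Rightarrow> real"
  assumes "0 \<le> t" "g \<in> borel_measurable lborel" "AE x in lborel. \<bar>g x\<bar> \<le> c * (\<bar>u1 t x\<bar> + \<bar>u2 t x\<bar>)"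
  shows "integrable lborel g"
proof (rule Bochner_Integration.integrable_bound[of _ "\<lambda>x. c * (\<bar>u1 t x\<bar> + \<bar>u2 t x\<bar>)"])
  show "AE x in lborel. norm (g x) \<le> norm (c * (\<bar>u1 t x\<bar> + \<bar>u2 t x\<bar>))"
    using assms(3)
  proof eventually_elim
    case (elim x)
    then show ?case using abs_ge_self[of "c * (\<bar>u1 t x\<bar> + \<bar>u2 t x\<bar>)"] unfolding real_norm_def by linarith
  qed
qed (use assms integrable_u in auto)

text \<open>The bounds are natural numbers so that countably many closed sets of times cover the
  half-line.\<close>

definition bounded_at :: "nat \<Rightarrow> real \<Rightarrow> bool" where
  "bounded_at n t \<longleftrightarrow> (AE x in lborel. \<bar>u1 t x\<bar> \<le> real n \<and> \<bar>u2 t x\<bar> \<le> real n)"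

lemma velocity_measurable: "velocity v \<Longrightarrow> v \<in> borel_measurable borel"
  unfolding velocity_def by (auto intro: borel_measurable_continuous_onI lipschitz_on_continuous_on)

text \<open>Both entropy inequalities are tested with \<open>\<psi> t * w x\<close> and added,
  whereupon the source terms combine to \<open>transfer\<close>. The bound \<open>M\<close> serves
  to justify integrability and does not occur in the conclusion.\<close>

lemma weak_inequality:
  assumes kld: "0 \<le> k" "0 \<le> l" "0 < d"
    and ab: "0 \<le> a" "a \<le> b" and bounded: "\<And>t. t \<in> {a..b} \<Longrightarrow> bounded_at M t"
    and q1: "entropy_pair v1 (ent k l d) q1" "continuous_on UNIV q1" "\<And>x. \<bar>x\<bar> \<le> real M \<Longrightarrow> \<bar>q1 x\<bar> \<le> Q * \<bar>x\<bar>"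
    and q2: "entropy_pair v2 (ent k l d) q2" "continuous_on UNIV q2" "\<And>x. \<bar>x\<bar> \<le> real M \<Longrightarrow> \<bar>q2 x\<bar> \<le> Q * \<bar>x\<bar>"
    and w: "smooth_real w" "\<And>x. (w has_real_derivative w' x) (at x)" "continuous_on UNIV w'"
      "\<And>x. 0 \<le> w x" "\<And>x. w x \<le> 1" "\<And>x. w x \<noteq> 0 \<Longrightarrow> \<bar>x\<bar> \<le> R" "\<And>x. \<bar>w' x\<bar> \<le> D"
    and \<psi>: "smooth_real \<psi>" "\<And>t. (\<psi> has_real_derivative \<psi>' t) (at t)" "\<And>t. 0 \<le> \<psi> t"
      "\<And>t. \<psi> t \<noteq> 0 \<Longrightarrow> \<bar>t\<bar> \<le> R"
      "\<And>t. 0 \<le> t \<Longrightarrow> t \<notin> {a..b} \<Longrightarrow> \<psi> t = 0 \<and> \<psi>' t = 0"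
    and init: "\<psi> 0 = 0 \<or> (\<forall>x. ent k l d (u10 x) = 0 \<and> ent k l d (u20 x) = 0)"
    and H: "continuous_on {a..b} H"
      "\<And>t. t \<in> {a..b} \<Longrightarrow>
        (LINT x|lborel. w' x * (q1 (u1 t x) + q2 (u2 t x)) + w x * transfer k l d v1 v2 (u1 t x) (u2 t x)) \<le> H t"
  shows "0 \<le> integral {a..b} (\<lambda>t. \<psi>' t * excess w k l d t + \<psi> t * H t)"
proof -
  define S where "S t x = lane_change v1 v2 (u1 t x) (u2 t x)" for t x
  define \<phi> where "\<phi> t x = \<psi> t * w x" for t x
  have test: "test_function \<phi>"
    unfolding \<phi>_def[abs_def] using \<psi> w by (intro test_function_product[where R = R])
  have \<phi>0: "\<forall>t\<ge>0. \<forall>x. 0 \<le> \<phi> t x" using \<psi>(3) w(4) by (simp add: \<phi>_def)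
  have pt: "partial_t \<phi> t x = \<psi>' t * w x" for t x
    unfolding partial_t_def \<phi>_def by (intro DERIV_imp_deriv DERIV_cmult_right \<psi>(2))
  have px: "partial_x \<phi> t x = \<psi> t * w' x" for t x
    unfolding partial_x_def \<phi>_def by (intro DERIV_imp_deriv DERIV_cmult w(2))
  have de: "deriv (ent k l d) = dent k l d"
    by (rule ext, rule DERIV_imp_deriv, rule DERIV_ent[OF kld(3)])
  \<comment> \<open>Either the test function vanishes at time 0 or the entropies of the data do, so
    the initial terms drop out in both cases.\<close>
  have init0: "(LINT x|lborel. ent k l d (u10 x) * \<phi> 0 x) = 0" "(LINT x|lborel. ent k l d (u20 x) * \<phi> 0 x) = 0"
    using init by (auto simp: \<phi>_def)
  define F1 where "F1 t x = ent k l d (u1 t x) * (\<psi>' t * w x) + q1 (u1 t x) * (\<psi> t * w' x)" for t x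
  define F2 where "F2 t x = ent k l d (u2 t x) * (\<psi>' t * w x) + q2 (u2 t x) * (\<psi> t * w' x)" for t x
  define G1 where "G1 t x = dent k l d (u1 t x) * (\<psi> t * w x) * (- S t x)" for t x
  define G2 where "G2 t x = dent k l d (u2 t x) * (\<psi> t * w x) * S t x" for t x
  have ei: "entropy_inequality v1 (\<lambda>t x. - S t x) u10 u1" "entropy_inequality v2 S u20 u2"
    using sol unfolding entropy_solution_def S_def[abs_def] by auto
  have 1: "spacetime_integrable F1" "spacetime_integrable G1"
      "spacetime_integral F1 \<ge> - spacetime_integral G1"
    using ei(1)[unfolded entropy_inequality_def, rule_format, OF q1(1) test] \<phi>0 init0
    by (auto simp: pt px de F1_def[abs_def] G1_def[abs_def] \<phi>_def[symmetric] intro: spacetime_integrable_add)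
  have 2: "spacetime_integrable F2" "spacetime_integrable G2"
      "spacetime_integral F2 \<ge> - spacetime_integral G2"
    using ei(2)[unfolded entropy_inequality_def, rule_format, OF q2(1) test] \<phi>0 init0
    by (auto simp: pt px de F2_def[abs_def] G2_def[abs_def] \<phi>_def[symmetric] intro: spacetime_integrable_add)
  \<comment> \<open>Integrating over the line first leaves a function of time alone, which can be
    compared pointwise with the integrand of the claim.\<close>
  define T where "T t = (LINT x|lborel. F1 t x) + (LINT x|lborel. G1 t x) + (LINT x|lborel. F2 t x) + (LINT x|lborel. G2 t x)" for t
  note inner = 1(1,2)[THEN spacetime_integrable_inner] 2(1,2)[THEN spacetime_integrable_inner]
  have Tint: "set_integrable lborel {0..} T"
    unfolding T_def[abs_def] by (intro set_integral_add inner)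
  have "0 \<le> spacetime_integral F1 + spacetime_integral G1 + spacetime_integral F2 + spacetime_integral G2"
    using 1(3) 2(3) by simp
  also have "\<dots> = (LINT t:{0..}|lborel. T t)"
    unfolding T_def spacetime_integral_def by (simp add: set_integral_add inner)
  finally have T0: "0 \<le> (LINT t:{0..}|lborel. T t)" .
  define P where "P t = \<psi>' t * excess w k l d t + \<psi> t * H t" for t
  have wc: "continuous_on UNIV w" using w(1) by (rule smooth_real_continuous)
  have w_abs: "\<bar>w x\<bar> \<le> 1" for x using w(4,5)[of x] by simp
  have D: "0 \<le> D" using w(7)[of 0] by linarith
  have \<psi>c: "continuous_on UNIV \<psi>" "continuous_on UNIV \<psi>'"
  proof -
    obtain f' where "smooth_real f'" "\<And>x. (\<psi> has_real_derivative f' x) (at x)"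
      using smooth_real_derivative[OF \<psi>(1)] by blast
    moreover from this \<psi>(2) have "\<psi>' = f'" by (auto intro: DERIV_unique)
    ultimately show "continuous_on UNIV \<psi>'" "continuous_on UNIV \<psi>" using \<psi>(1)
      by (simp_all add: smooth_real_continuous)
  qed
  \<comment> \<open>On \<open>[-M, M]\<close> the velocities are bounded, so the lane-change term is
    dominated by the densities and is integrable.\<close>
  obtain A where A: "0 \<le> A" "\<And>x. \<bar>x\<bar> \<le> real M \<Longrightarrow> \<bar>v1 x\<bar> \<le> A" "\<And>x. \<bar>x\<bar> \<le> real M \<Longrightarrow> \<bar>v2 x\<bar> \<le> A"
  proof -
    obtain L1 where L1: "0 \<le> L1" "\<And>x y. \<bar>v1 x - v1 y\<bar> \<le> L1 * \<bar>x - y\<bar>"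
      using velocity_lipschitz[OF vel(1)] by blast
    obtain L2 where L2: "0 \<le> L2" "\<And>x y. \<bar>v2 x - v2 y\<bar> \<le> L2 * \<bar>x - y\<bar>"
      using velocity_lipschitz[OF vel(2)] by blast
    define A where "A = \<bar>v1 0\<bar> + \<bar>v2 0\<bar> + L1 * M + L2 * M"
    have nn: "0 \<le> L1 * M" "0 \<le> L2 * M" using L1(1) L2(1) by auto
    have "\<bar>v1 x\<bar> \<le> A" "\<bar>v2 x\<bar> \<le> A" if x: "\<bar>x\<bar> \<le> real M" for x
      using L1(2)[of x 0] L2(2)[of x 0] mult_left_mono[OF x L1(1)] mult_left_mono[OF x L2(1)] nn
      by (auto simp: A_def)
    moreover have "0 \<le> A" using nn by (simp add: A_def)
    ultimately show ?thesis using that by blast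
  qed
  have [measurable]: "v1 \<in> borel_measurable borel" "v2 \<in> borel_measurable borel"
    "q1 \<in> borel_measurable borel" "q2 \<in> borel_measurable borel" "w \<in> borel_measurable borel"
    "w' \<in> borel_measurable borel" "dent k l d \<in> borel_measurable borel"
    using vel q1(2) q2(2) w(3) wc continuous_dent[OF kld]
    by (auto intro: borel_measurable_continuous_onI velocity_measurable)
  have TP: "T t \<le> P t" if t: "t \<in> {a..b}" for t
  proof -
    have t0: "0 \<le> t" using t ab by simp
    have [measurable]: "u1 t \<in> borel_measurable lborel" "u2 t \<in> borel_measurable lborel"
      using integrable_u[OF t0] by auto
    have Sm [measurable]: "S t \<in> borel_measurable lborel"
      unfolding S_def[abs_def] lane_change_eq by measurable
    have bd: "AE x in lborel. \<bar>u1 t x\<bar> \<le> real M \<and> \<bar>u2 t x\<bar> \<le> real M"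
      using bounded[OF t] by (simp add: bounded_at_def)
    have ie: "integrable lborel (\<lambda>x. w x * ent k l d (u1 t x))" "integrable lborel (\<lambda>x. w x * ent k l d (u2 t x))"
      using integrable_ent[OF kld wc w_abs t0] by auto
    have iq1: "integrable lborel (\<lambda>x. w' x * q1 (u1 t x))"
      by (rule integrable_comp_u[OF q1(2) _ integrable_u(1)[OF t0] w(3,7), of Q])
        (use bd q1(3) in \<open>auto elim: eventually_mono\<close>)
    have iq2: "integrable lborel (\<lambda>x. w' x * q2 (u2 t x))"
      by (rule integrable_comp_u[OF q2(2) _ integrable_u(2)[OF t0] w(3,7), of Q])
        (use bd q2(3) in \<open>auto elim: eventually_mono\<close>)
    have iS: "integrable lborel (\<lambda>x. w x * g x * S t x)"
      if [measurable]: "g \<in> borel_measurable lborel" and g: "\<And>x. \<bar>g x\<bar> \<le> 1" for g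
    proof (rule integrable_of_bound[OF t0, of _ "2 * A"])
      show "AE x in lborel. \<bar>w x * g x * S t x\<bar> \<le> 2 * A * (\<bar>u1 t x\<bar> + \<bar>u2 t x\<bar>)"
        using bd
      proof eventually_elim
        case (elim x)
        have "\<bar>S t x\<bar> \<le> 2 * A * (\<bar>u1 t x\<bar> + \<bar>u2 t x\<bar>)"
          unfolding S_def using elim A by (intro lane_change_abs_le) auto
        moreover have "\<bar>w x\<bar> * \<bar>g x\<bar> * \<bar>S t x\<bar> \<le> 1 * 1 * \<bar>S t x\<bar>"
          using w_abs g by (intro mult_mono) auto
        ultimately show ?case by (simp add: abs_mult)
      qed
    qed measurable
    have iS1: "integrable lborel (\<lambda>x. w x * dent k l d (u1 t x) * S t x)"
      and iS2: "integrable lborel (\<lambda>x. w x * dent k l d (u2 t x) * S t x)"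
      by (rule iS; use dent_abs_le in simp)+
    have "T t = \<psi>' t * excess w k l d t + \<psi> t *
        (LINT x|lborel. w' x * (q1 (u1 t x) + q2 (u2 t x)) + w x * transfer k l d v1 v2 (u1 t x) (u2 t x))"
    proof -
      have "(LINT x|lborel. F1 t x) = (LINT x|lborel. \<psi>' t * (w x * ent k l d (u1 t x)) + \<psi> t * (w' x * q1 (u1 t x)))"
        by (simp add: F1_def mult_ac)
      also have "\<dots> = \<psi>' t * (LINT x|lborel. w x * ent k l d (u1 t x)) + \<psi> t * (LINT x|lborel. w' x * q1 (u1 t x))"
        using ie iq1 by simp
      finally have F1: "(LINT x|lborel. F1 t x) = \<dots>" .
      have "(LINT x|lborel. F2 t x) = (LINT x|lborel. \<psi>' t * (w x * ent k l d (u2 t x)) + \<psi> t * (w' x * q2 (u2 t x)))"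
        by (simp add: F2_def mult_ac)
      also have "\<dots> = \<psi>' t * (LINT x|lborel. w x * ent k l d (u2 t x)) + \<psi> t * (LINT x|lborel. w' x * q2 (u2 t x))"
        using ie iq2 by simp
      finally have F2: "(LINT x|lborel. F2 t x) = \<dots>" .
      have "(LINT x|lborel. G1 t x) = (LINT x|lborel. - (\<psi> t * (w x * dent k l d (u1 t x) * S t x)))"
        by (simp add: G1_def mult_ac)
      then have G1: "(LINT x|lborel. G1 t x) = - (\<psi> t * (LINT x|lborel. w x * dent k l d (u1 t x) * S t x))"
        by simp
      have "(LINT x|lborel. G2 t x) = (LINT x|lborel. \<psi> t * (w x * dent k l d (u2 t x) * S t x))"
        by (simp add: G2_def mult_ac)
      then have G2: "(LINT x|lborel. G2 t x) = \<psi> t * (LINT x|lborel. w x * dent k l d (u2 t x) * S t x)"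
        by simp
      have "(LINT x|lborel. w' x * (q1 (u1 t x) + q2 (u2 t x)) + w x * transfer k l d v1 v2 (u1 t x) (u2 t x))
        = (LINT x|lborel. (w' x * q1 (u1 t x) + w' x * q2 (u2 t x))
            + (w x * dent k l d (u2 t x) * S t x - w x * dent k l d (u1 t x) * S t x))"
        by (simp add: transfer_def S_def algebra_simps)
      also have "\<dots> = ((LINT x|lborel. w' x * q1 (u1 t x)) + (LINT x|lborel. w' x * q2 (u2 t x)))
            + ((LINT x|lborel. w x * dent k l d (u2 t x) * S t x) - (LINT x|lborel. w x * dent k l d (u1 t x) * S t x))"
        using iq1 iq2 iS1 iS2 by simp
      finally have Z: "(LINT x|lborel. w' x * (q1 (u1 t x) + q2 (u2 t x)) + w x * transfer k l d v1 v2 (u1 t x) (u2 t x)) = \<dots>" .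
      show ?thesis unfolding T_def F1 F2 G1 G2 Z excess_def by (simp only: algebra_simps)
    qed
    also have "\<dots> \<le> P t"
      unfolding P_def using H(2)[OF t] \<psi>(3)[of t] by (intro add_left_mono mult_left_mono) auto
    finally show ?thesis .
  qed
  have Pc: "continuous_on {a..b} P"
    unfolding P_def[abs_def]
    using H(1) \<psi>c continuous_excess[OF kld wc w_abs] ab
    by (intro continuous_intros) (auto elim: continuous_on_subset)
  then have Pint: "set_integrable lborel {a..b} P"
    by (rule borel_integrable_atLeastAtMost'[unfolded set_integrable_def, folded set_integrable_def])
  have "(LINT t:{0..}|lborel. T t) \<le> (LINT t:{a..b}|lborel. P t)"
    unfolding set_lebesgue_integral_def
  proof (rule integral_mono)
    show "integrable lborel (\<lambda>t. indicator {0..} t *\<^sub>R T t)" using Tint by (simp add: set_integrable_def)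
    show "integrable lborel (\<lambda>t. indicator {a..b} t *\<^sub>R P t)" using Pint by (simp add: set_integrable_def)
    fix t
    have "T t = 0" if "0 \<le> t" "t \<notin> {a..b}"
      using \<psi>(5)[OF that] by (simp add: T_def F1_def F2_def G1_def G2_def)
    then show "indicator {0..} t *\<^sub>R T t \<le> indicator {a..b} t *\<^sub>R P t"
      using TP[of t] ab by (auto simp: indicator_def)
  qed
  also have "\<dots> = integral {a..b} P" using Pint by (rule set_borel_integral_eq_integral(2))
  finally have "0 \<le> integral {a..b} P" using T0 by simp
  then show ?thesis unfolding P_def[abs_def] .
qed

section \<open>Removing the spatial cutoff\<close>

abbreviation total_excess :: "real \<Rightarrow> real \<Rightarrow> real \<Rightarrow> real \<Rightarrow> real" where
  "total_excess \<equiv> excess (\<lambda>_. 1)"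

definition mass :: "real \<Rightarrow> real" where
  "mass t = (LINT x|lborel. \<bar>u1 t x\<bar>) + (LINT x|lborel. \<bar>u2 t x\<bar>)"

lemma continuous_mass: "continuous_on {0..} mass"
proof (rule continuous_on_of_L1_dist)
  fix s t :: real assume st: "0 \<le> s" "0 \<le> t"
  have *: "\<bar>(LINT x|lborel. \<bar>f x\<bar>) - (LINT x|lborel. \<bar>g x\<bar>)\<bar> \<le> (LINT x|lborel. \<bar>f x - g x\<bar>)"
    if fg: "integrable lborel f" "integrable lborel g" for f g :: "real \<Rightarrow> real"
  proof -
    have "\<bar>(LINT x|lborel. \<bar>f x\<bar>) - (LINT x|lborel. \<bar>g x\<bar>)\<bar> = \<bar>LINT x|lborel. \<bar>f x\<bar> - \<bar>g x\<bar>\<bar>"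
      using that by simp
    also have "\<dots> \<le> (LINT x|lborel. \<bar>\<bar>f x\<bar> - \<bar>g x\<bar>\<bar>)" by (rule integral_abs_bound)
    also have "\<dots> \<le> (LINT x|lborel. \<bar>f x - g x\<bar>)" using fg by (intro integral_mono) auto
    finally show ?thesis .
  qed
  show "\<bar>mass s - mass t\<bar> \<le> L1_dist s t"
    using *[OF integrable_u(1)[OF st(1)] integrable_u(1)[OF st(2)]]
      *[OF integrable_u(2)[OF st(1)] integrable_u(2)[OF st(2)]]
    unfolding mass_def L1_dist_def by linarith
qed

lemma mass_bounded:
  assumes "0 \<le> a"
  obtains N where "0 \<le> N" "\<And>t. t \<in> {a..b} \<Longrightarrow> mass t \<le> N"
proof -
  have "continuous_on {a..b} mass"
    using continuous_mass by (rule continuous_on_subset) (use assms in auto)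
  then have "bounded (mass ` {a..b})"
    by (intro compact_imp_bounded compact_continuous_image) auto
  then obtain N where "0 < N" "\<And>t. t \<in> {a..b} \<Longrightarrow> \<bar>mass t\<bar> \<le> N"
    unfolding bounded_pos by auto
  then show ?thesis by (intro that[of N]) force+
qed

lemma total_excess_le_mass:
  assumes kld: "0 \<le> k" "0 \<le> l" "0 < d" and t: "0 \<le> t"
  shows "total_excess k l d t \<le> mass t"
  unfolding excess_def mass_def
  using integrable_ent[OF kld continuous_on_const, of 1 1 t] integrable_u[OF t] ent_abs_le[OF kld] t
  by (intro add_mono integral_mono) (auto intro: order_trans[OF abs_ge_self])

lemma entropy_flux_bound:
  assumes "entropy_pair v \<eta> q" "q 0 = 0"
  obtains Q where "0 \<le> Q" "\<And>x. \<bar>x\<bar> \<le> M \<Longrightarrow> \<bar>q x\<bar> \<le> Q * \<bar>x\<bar>"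
proof -
  obtain Q where Q: "Q-lipschitz_on {-M..M} q"
    using assms(1) unfolding entropy_pair_def by blast
  show ?thesis
  proof (rule that[OF lipschitz_on_nonneg[OF Q]])
    fix x assume x: "\<bar>x\<bar> \<le> M"
    then have "x \<in> {-M..M}" "0 \<in> {-M..M}" by auto
    then show "\<bar>q x\<bar> \<le> Q * \<bar>x\<bar>"
      using lipschitz_onD[OF Q, of x 0] assms(2) by (auto simp: dist_real_def)
  qed
qed

text \<open>The cutoffs \<open>\<beta> (r n * x)\<close> with \<open>r n = 1 / (n + 1)\<close> have
  derivatives of size at most \<open>r n * D0\<close>. The fluxes are at most \<open>Q |u|\<close>,
  hence their contribution is at most \<open>r n * D0 * Q * N\<close>, where \<open>N\<close> bounds
  the mass. The constant \<open>Q\<close> depends on \<open>M\<close>, but it enters only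
  \<open>c\<close>, which tends to 0.\<close>

lemma cutoff_inequality:
  assumes kld: "0 \<le> k" "0 \<le> l" "0 < d" and kld': "0 \<le> k'" "0 \<le> l'" "0 < d'" and K: "0 \<le> K"
    and ab: "0 \<le> a" "a \<le> b" and bounded: "\<And>t. t \<in> {a..b} \<Longrightarrow> bounded_at M t"
    and transfer: "\<And>x y. \<bar>x\<bar> \<le> real M \<Longrightarrow> \<bar>y\<bar> \<le> real M \<Longrightarrow>
      transfer k l d v1 v2 x y \<le> K * (ent k' l' d' x + ent k' l' d' y)"
  obtains w :: "nat \<Rightarrow> real \<Rightarrow> real" and c :: "nat \<Rightarrow> real"
  where "c \<longlonglongrightarrow> 0" "\<And>n. continuous_on UNIV (w n)" "\<And>n x. \<bar>w n x\<bar> \<le> 1" "\<And>x. (\<lambda>n. w n x) \<longlonglongrightarrow> 1"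
    "\<And>n \<psi> \<psi>' R. smooth_real \<psi> \<Longrightarrow> (\<And>t. (\<psi> has_real_derivative \<psi>' t) (at t)) \<Longrightarrow> (\<And>t. 0 \<le> \<psi> t) \<Longrightarrow>
      (\<And>t. \<psi> t \<noteq> 0 \<Longrightarrow> \<bar>t\<bar> \<le> R) \<Longrightarrow> (\<And>t. 0 \<le> t \<Longrightarrow> t \<notin> {a..b} \<Longrightarrow> \<psi> t = 0 \<and> \<psi>' t = 0) \<Longrightarrow>
      \<psi> 0 = 0 \<or> (\<forall>x. ent k l d (u10 x) = 0 \<and> ent k l d (u20 x) = 0) \<Longrightarrow>
      0 \<le> integral {a..b} (\<lambda>t. \<psi>' t * excess (w n) k l d t + \<psi> t * (c n + K * total_excess k' l' d' t))"
proof -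
  obtain q1 where q1: "entropy_pair v1 (ent k l d) q1" "continuous_on UNIV q1" "q1 0 = 0"
    using entropy_pair_ent[OF vel(1) kld(3)] by blast
  obtain q2 where q2: "entropy_pair v2 (ent k l d) q2" "continuous_on UNIV q2" "q2 0 = 0"
    using entropy_pair_ent[OF vel(2) kld(3)] by blast
  obtain Q1 where Q1: "0 \<le> Q1" "\<And>x. \<bar>x\<bar> \<le> real M \<Longrightarrow> \<bar>q1 x\<bar> \<le> Q1 * \<bar>x\<bar>"
    using entropy_flux_bound[OF q1(1,3)] by blast
  obtain Q2 where Q2: "0 \<le> Q2" "\<And>x. \<bar>x\<bar> \<le> real M \<Longrightarrow> \<bar>q2 x\<bar> \<le> Q2 * \<bar>x\<bar>"
    using entropy_flux_bound[OF q2(1,3)] by blast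
  define Q where "Q = Q1 + Q2"
  have Q: "0 \<le> Q" "\<bar>q1 x\<bar> \<le> Q * \<bar>x\<bar>" "\<bar>q2 x\<bar> \<le> Q * \<bar>x\<bar>" if "\<bar>x\<bar> \<le> real M" for x
  proof -
    have "0 \<le> Q1 * \<bar>x\<bar>" "0 \<le> Q2 * \<bar>x\<bar>" using Q1(1) Q2(1) by auto
    then show "0 \<le> Q" "\<bar>q1 x\<bar> \<le> Q * \<bar>x\<bar>" "\<bar>q2 x\<bar> \<le> Q * \<bar>x\<bar>"
      using Q1(1) Q2(1) Q1(2)[OF that] Q2(2)[OF that] unfolding Q_def distrib_right by linarith+
  qed
  have Q0: "0 \<le> Q" using Q1(1) Q2(1) by (simp add: Q_def)
  obtain N where N: "0 \<le> N" "\<And>t. t \<in> {a..b} \<Longrightarrow> mass t \<le> N"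
    using mass_bounded[OF ab(1)] by blast
  obtain \<beta> :: "real \<Rightarrow> real" where \<beta>: "smooth_real \<beta>" "\<And>x. 0 \<le> \<beta> x" "\<And>x. \<beta> x \<le> 1" "\<beta> 0 = 1"
    "\<And>x. \<beta> x \<noteq> 0 \<longleftrightarrow> \<bar>x\<bar> < 1"
    using exists_bump by metis
  obtain \<beta>' where \<beta>': "smooth_real \<beta>'" "\<And>x. (\<beta> has_real_derivative \<beta>' x) (at x)"
    using smooth_real_derivative[OF \<beta>(1)] by blast
  have "bounded (\<beta>' ` {-1..1})"
    using smooth_real_continuous[OF \<beta>'(1)] by (intro compact_imp_bounded compact_continuous_image) auto
  then obtain D0 where D0: "0 < D0" "\<And>x. x \<in> {-1..1} \<Longrightarrow> \<bar>\<beta>' x\<bar> \<le> D0"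
    unfolding bounded_pos by auto
  \<comment> \<open>Outside \<open>[-1, 1]\<close> the bump is locally 0, so the bound on its
    derivative extends to the whole line.\<close>
  have D0: "0 < D0" "\<bar>\<beta>' x\<bar> \<le> D0" for x
  proof -
    show "\<bar>\<beta>' x\<bar> \<le> D0"
    proof (cases "\<bar>x\<bar> \<le> 1")
      case False
      have "open {z :: real. \<bar>z\<bar> > 1}" by (intro open_Collect_less continuous_intros)
      then have "\<forall>\<^sub>F z in nhds x. \<beta> z = 0"
        using eventually_nhds_in_open[of "{z. \<bar>z\<bar> > 1}" x] False \<beta>(5)
        by (auto elim!: eventually_mono) (meson less_asym)
      then have "((\<lambda>_. 0) has_real_derivative \<beta>' x) (at x)"
        using \<beta>'(2)[of x] DERIV_cong_ev[of x x \<beta> "\<lambda>_. 0" "\<beta>' x" "\<beta>' x"] by simp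
      from DERIV_unique[OF this DERIV_const] have "\<beta>' x = 0" .
      then show ?thesis using D0(1) by simp
    qed (use D0 in \<open>auto simp: abs_le_iff\<close>)
  qed (rule D0(1))
  define r where "r n = inverse (real (Suc n))" for n
  have r: "0 < r n" "r n \<le> 1" for n by (auto simp: r_def inverse_le_1_iff)
  have r0: "r \<longlonglongrightarrow> 0" unfolding r_def by (rule LIMSEQ_inverse_real_of_nat)
  define w where "w n x = 1 * \<beta> (r n * x + 0)" for n x
  define w' where "w' n x = r n * \<beta>' (r n * x)" for n x
  define c where "c n = r n * D0 * Q * N" for n
  have ws: "smooth_real (w n)" for n unfolding w_def[abs_def] by (rule smooth_real_affine[OF \<beta>(1)])
  show ?thesis
  proof (rule that[of c w])
    show "c \<longlonglongrightarrow> 0" unfolding c_def[abs_def] using r0 by (auto intro!: tendsto_mult_left_zero)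
    show "continuous_on UNIV (w n)" for n using ws by (rule smooth_real_continuous)
    show "\<bar>w n x\<bar> \<le> 1" for n x using \<beta>(2,3) by (simp add: w_def)
    show "(\<lambda>n. w n x) \<longlonglongrightarrow> 1" for x
    proof -
      have "isCont \<beta> 0" using smooth_real_continuous[OF \<beta>(1), of UNIV] by (simp add: continuous_on_eq_continuous_at)
      moreover have "(\<lambda>n. r n * x + 0) \<longlonglongrightarrow> 0" using r0 by (auto intro!: tendsto_mult_left_zero)
      ultimately have "(\<lambda>n. \<beta> (r n * x + 0)) \<longlonglongrightarrow> \<beta> 0" by (rule isCont_tendsto_compose)
      then show ?thesis by (simp add: w_def \<beta>(4))
    qed
  next
    fix n \<psi> \<psi>' R
    assume \<psi>: "smooth_real \<psi>" "\<And>t. (\<psi> has_real_derivative \<psi>' t) (at t)" "\<And>t. 0 \<le> \<psi> t"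
      "\<And>t. \<psi> t \<noteq> 0 \<Longrightarrow> \<bar>t\<bar> \<le> R" "\<And>t. 0 \<le> t \<Longrightarrow> t \<notin> {a..b} \<Longrightarrow> \<psi> t = 0 \<and> \<psi>' t = 0"
      and init: "\<psi> 0 = 0 \<or> (\<forall>x. ent k l d (u10 x) = 0 \<and> ent k l d (u20 x) = 0)"
    show "0 \<le> integral {a..b} (\<lambda>t. \<psi>' t * excess (w n) k l d t + \<psi> t * (c n + K * total_excess k' l' d' t))"
    proof (rule weak_inequality[OF kld ab bounded q1(1,2) Q(2) q2(1,2) Q(3) ws,
          where w' = "w' n" and R = "max R (real (Suc n))" and D = "r n * D0"])
      show "(w n has_real_derivative w' n x) (at x)" for x
        unfolding w_def[abs_def] w'_def
        by (rule derivative_eq_intros DERIV_chain2[OF \<beta>'(2)] refl | simp)+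
      show "continuous_on UNIV (w' n)"
        unfolding w'_def[abs_def]
        by (intro continuous_intros continuous_on_compose2[OF smooth_real_continuous[OF \<beta>'(1), of UNIV]]) auto
      show "0 \<le> w n x" "w n x \<le> 1" for x using \<beta>(2,3) by (simp_all add: w_def)
      show "\<bar>x\<bar> \<le> max R (real (Suc n))" if "w n x \<noteq> 0" for x
      proof -
        have "\<bar>r n * x\<bar> < 1" using that \<beta>(5) by (simp add: w_def)
        then have "r n * \<bar>x\<bar> < 1" using r(1)[of n] by (simp add: abs_mult)
        then have "\<bar>x\<bar> < real (Suc n)" unfolding r_def by (simp add: field_simps)
        then show ?thesis by simp
      qed
      show "\<bar>w' n x\<bar> \<le> r n * D0" for x
        using D0(2) r(1)[of n] by (simp add: w'_def abs_mult mult_left_mono)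
      show "\<bar>t\<bar> \<le> max R (real (Suc n))" if "\<psi> t \<noteq> 0" for t using \<psi>(4)[OF that] by simp
      have "continuous_on {a..b} (total_excess k' l' d')"
        by (rule continuous_on_subset[OF continuous_excess[OF kld']]) (use ab in auto)
      then show "continuous_on {a..b} (\<lambda>t. c n + K * total_excess k' l' d' t)"
        by (intro continuous_intros)
      fix t assume t: "t \<in> {a..b}"
      then have t0: "0 \<le> t" using ab by simp
      have ie: "integrable lborel (\<lambda>x. ent k' l' d' (u1 t x))" "integrable lborel (\<lambda>x. ent k' l' d' (u2 t x))"
        using integrable_ent[OF kld' continuous_on_const, of 1 1 t] t0 by simp_all
      have "(LINT x|lborel. w' n x * (q1 (u1 t x) + q2 (u2 t x)) + w n x * transfer k l d v1 v2 (u1 t x) (u2 t x))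
        \<le> (LINT x|lborel. r n * D0 * Q * (\<bar>u1 t x\<bar> + \<bar>u2 t x\<bar>)
              + K * (ent k' l' d' (u1 t x) + ent k' l' d' (u2 t x)))"
      proof (rule integral_mono_AE')
        show "integrable lborel (\<lambda>x. r n * D0 * Q * (\<bar>u1 t x\<bar> + \<bar>u2 t x\<bar>)
              + K * (ent k' l' d' (u1 t x) + ent k' l' d' (u2 t x)))"
          using ie integrable_u[OF t0] by simp
        show "AE x in lborel. 0 \<le> r n * D0 * Q * (\<bar>u1 t x\<bar> + \<bar>u2 t x\<bar>)
              + K * (ent k' l' d' (u1 t x) + ent k' l' d' (u2 t x))"
          using K D0(1) Q0 less_imp_le[OF r(1)] ent_nonneg[OF kld'(3)]
          by (intro AE_I2 add_nonneg_nonneg mult_nonneg_nonneg) auto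
        show "AE x in lborel. w' n x * (q1 (u1 t x) + q2 (u2 t x)) + w n x * transfer k l d v1 v2 (u1 t x) (u2 t x)
           \<le> r n * D0 * Q * (\<bar>u1 t x\<bar> + \<bar>u2 t x\<bar>) + K * (ent k' l' d' (u1 t x) + ent k' l' d' (u2 t x))"
          using bounded[OF t] unfolding bounded_at_def
        proof eventually_elim
          case (elim x)
          have "\<bar>q1 (u1 t x) + q2 (u2 t x)\<bar> \<le> Q * (\<bar>u1 t x\<bar> + \<bar>u2 t x\<bar>)"
          proof -
            have "\<bar>q1 (u1 t x)\<bar> \<le> Q * \<bar>u1 t x\<bar>" "\<bar>q2 (u2 t x)\<bar> \<le> Q * \<bar>u2 t x\<bar>"
              using elim by (auto intro: Q)
            then show ?thesis unfolding distrib_left by linarith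
          qed
          then have "\<bar>w' n x\<bar> * \<bar>q1 (u1 t x) + q2 (u2 t x)\<bar> \<le> (r n * D0) * (Q * (\<bar>u1 t x\<bar> + \<bar>u2 t x\<bar>))"
            using D0 r(1)[of n] by (intro mult_mono) (auto simp: w'_def abs_mult mult_left_mono)
          then have 1: "w' n x * (q1 (u1 t x) + q2 (u2 t x)) \<le> r n * D0 * Q * (\<bar>u1 t x\<bar> + \<bar>u2 t x\<bar>)"
            unfolding abs_mult[symmetric] mult.assoc by (rule order_trans[OF abs_ge_self])
          have e0: "0 \<le> K * (ent k' l' d' (u1 t x) + ent k' l' d' (u2 t x))"
            using K ent_nonneg[OF kld'(3)] by simp
          have "w n x * transfer k l d v1 v2 (u1 t x) (u2 t x)
              \<le> w n x * (K * (ent k' l' d' (u1 t x) + ent k' l' d' (u2 t x)))"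
            using transfer[of "u1 t x" "u2 t x"] elim \<beta>(2) by (intro mult_left_mono) (auto simp: w_def)
          also have "\<dots> \<le> 1 * (K * (ent k' l' d' (u1 t x) + ent k' l' d' (u2 t x)))"
            using \<beta>(3) e0 by (intro mult_right_mono) (auto simp: w_def)
          finally show ?case using 1 by simp
        qed
      qed
      also have "\<dots> = r n * D0 * Q * mass t + K * total_excess k' l' d' t"
        using ie integrable_u[OF t0] by (simp add: mass_def excess_def)
      also have "\<dots> \<le> c n + K * total_excess k' l' d' t"
        using N(2)[OF t] r(1)[of n] D0 Q0 by (simp add: c_def mult_left_mono)
      finally show "(LINT x|lborel. w' n x * (q1 (u1 t x) + q2 (u2 t x)) + w n x * transfer k l d v1 v2 (u1 t x) (u2 t x))
        \<le> c n + K * total_excess k' l' d' t" .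
    qed (assumption | fact \<psi> init)+
  qed
qed

lemma excess_tendsto:
  assumes kld: "0 \<le> k" "0 \<le> l" "0 < d" and t: "0 \<le> t"
    and w: "\<And>n. continuous_on UNIV (w n)" "\<And>n x. \<bar>w n x\<bar> \<le> 1" "\<And>x. (\<lambda>n. w n x) \<longlonglongrightarrow> 1"
  shows "(\<lambda>n. excess (w n) k l d t) \<longlonglongrightarrow> total_excess k l d t"
proof -
  have *: "(\<lambda>n. LINT x|lborel. w n x * ent k l d (u x)) \<longlonglongrightarrow> (LINT x|lborel. 1 * ent k l d (u x))"
    if "integrable lborel (\<lambda>x. 1 * ent k l d (u x))" "\<And>n. integrable lborel (\<lambda>x. w n x * ent k l d (u x))" for u
  proof (rule integral_dominated_convergence)
    show "integrable lborel (\<lambda>x. 1 * ent k l d (u x))" by fact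
    show "AE x in lborel. (\<lambda>n. w n x * ent k l d (u x)) \<longlonglongrightarrow> 1 * ent k l d (u x)"
      using w(3) by (intro AE_I2 tendsto_mult tendsto_const)
    show "AE x in lborel. norm (w n x * ent k l d (u x)) \<le> 1 * ent k l d (u x)" for n
      using w(2) ent_nonneg[OF kld(3)] by (intro AE_I2) (simp add: abs_mult mult_left_le_one_le)
  qed (use that in auto)
  show ?thesis
    unfolding excess_def
    using integrable_ent[OF kld continuous_on_const, of 1 1 t] integrable_ent[OF kld w(1,2) t] t
    by (intro tendsto_add *) simp_all
qed

text \<open>The limit of the cutoff inequalities: the flux disappears, and the only remaining
  constant is the \<open>K\<close> of the hypothesis on \<open>transfer\<close>. If \<open>K\<close>
  does not depend on \<open>M\<close>, neither does the conclusion.\<close>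

lemma total_excess_slab:
  assumes kld: "0 \<le> k" "0 \<le> l" "0 < d" and kld': "0 \<le> k'" "0 \<le> l'" "0 < d'" and K: "0 \<le> K"
    and ab: "0 \<le> a" "a < b" and bounded: "\<And>t. t \<in> {a..b} \<Longrightarrow> bounded_at M t"
    and transfer: "\<And>x y. \<bar>x\<bar> \<le> real M \<Longrightarrow> \<bar>y\<bar> \<le> real M \<Longrightarrow>
      transfer k l d v1 v2 x y \<le> K * (ent k' l' d' x + ent k' l' d' y)"
  shows "antimono_on {a..b} (\<lambda>t. total_excess k l d t - K * integral {a..t} (total_excess k' l' d'))"
proof -
  obtain w :: "nat \<Rightarrow> real \<Rightarrow> real" and c :: "nat \<Rightarrow> real"
  where c: "c \<longlonglongrightarrow> 0" and w: "\<And>n. continuous_on UNIV (w n)" "\<And>n x. \<bar>w n x\<bar> \<le> 1" "\<And>x. (\<lambda>n. w n x) \<longlonglongrightarrow> 1"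
    and ineq: "\<And>n \<psi> \<psi>' R. smooth_real \<psi> \<Longrightarrow> (\<And>t. (\<psi> has_real_derivative \<psi>' t) (at t)) \<Longrightarrow> (\<And>t. 0 \<le> \<psi> t) \<Longrightarrow>
      (\<And>t. \<psi> t \<noteq> 0 \<Longrightarrow> \<bar>t\<bar> \<le> R) \<Longrightarrow> (\<And>t. 0 \<le> t \<Longrightarrow> t \<notin> {a..b} \<Longrightarrow> \<psi> t = 0 \<and> \<psi>' t = 0) \<Longrightarrow>
      \<psi> 0 = 0 \<or> (\<forall>x. ent k l d (u10 x) = 0 \<and> ent k l d (u20 x) = 0) \<Longrightarrow>
      0 \<le> integral {a..b} (\<lambda>t. \<psi>' t * excess (w n) k l d t + \<psi> t * (c n + K * total_excess k' l' d' t))"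
  proof (rule cutoff_inequality[OF kld kld' K ab(1) less_imp_le[OF ab(2)] bounded transfer], goal_cases)
    case (4 w c)
    show ?case by (rule that) (fact 4)+
  qed
  have Ec: "continuous_on {a..b} (total_excess k' l' d')"
    by (rule continuous_on_subset[OF continuous_excess[OF kld']]) (use ab in auto)
  have int: "integral {a..t} (\<lambda>t. c n + K * total_excess k' l' d' t)
      = c n * (t - a) + K * integral {a..t} (total_excess k' l' d')" if "t \<in> {a..b}" for n t
    using that by (subst integral_add) (auto intro!: integrable_continuous_real continuous_intros continuous_on_subset[OF Ec])
  have anti: "antimono_on {a..b} (\<lambda>t. excess (w n) k l d t - integral {a..t} (\<lambda>t. c n + K * total_excess k' l' d' t))" for n
  proof (rule antimono_of_test_functions[OF ab(2)])
    show "continuous_on {a..b} (excess (w n) k l d)"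
      by (rule continuous_on_subset[OF continuous_excess[OF kld w(1,2)]]) (use ab in auto)
    show "continuous_on {a..b} (\<lambda>t. c n + K * total_excess k' l' d' t)"
      using Ec by (intro continuous_intros)
    fix \<psi> \<psi>' :: "real \<Rightarrow> real"
    assume \<psi>: "smooth_real \<psi>" "\<And>t. (\<psi> has_real_derivative \<psi>' t) (at t)" "\<And>t. 0 \<le> \<psi> t"
      "\<And>t. t \<le> a \<Longrightarrow> \<psi> t = 0 \<and> \<psi>' t = 0" "\<And>t. b \<le> t \<Longrightarrow> \<psi> t = 0 \<and> \<psi>' t = 0"
    show "0 \<le> integral {a..b} (\<lambda>t. \<psi>' t * excess (w n) k l d t + \<psi> t * (c n + K * total_excess k' l' d' t))"
    proof (rule ineq[OF \<psi>(1-3), of b])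
      show "\<bar>t\<bar> \<le> b" if "\<psi> t \<noteq> 0" for t
        using \<psi>(4)[of t] \<psi>(5)[of t] that ab by (cases "t \<le> a"; cases "b \<le> t") auto
      show "\<psi> t = 0 \<and> \<psi>' t = 0" if "t \<notin> {a..b}" for t
        using \<psi>(4)[of t] \<psi>(5)[of t] that by auto
      show "\<psi> 0 = 0 \<or> (\<forall>x. ent k l d (u10 x) = 0 \<and> ent k l d (u20 x) = 0)"
        using \<psi>(4)[of 0] ab by simp
    qed
  qed
  show ?thesis
  proof (rule monotone_onI)
    fix s t assume st: "s \<in> {a..b}" "t \<in> {a..b}" "s \<le> t"
    define I where "I t = K * integral {a..t} (total_excess k' l' d')" for t
    have le: "excess (w n) k l d t - (c n * (t - a) + I t) \<le> excess (w n) k l d s - (c n * (s - a) + I s)" for n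
      using monotone_onD[OF anti[of n] st] unfolding int[OF st(1)] int[OF st(2)] I_def .
    have lim: "(\<lambda>n. excess (w n) k l d z - (c n * (z - a) + I z)) \<longlonglongrightarrow> total_excess k l d z - (0 * (z - a) + I z)"
      if "z \<in> {a..b}" for z
      by (intro tendsto_intros c excess_tendsto[OF kld _ w]) (use that ab in auto)
    have "total_excess k l d t - (0 * (t - a) + I t) \<le> total_excess k l d s - (0 * (s - a) + I s)"
      by (rule LIMSEQ_le[OF lim[OF st(2)] lim[OF st(1)]]) (use le in blast)
    then show "total_excess k l d t - K * integral {a..t} (total_excess k' l' d')
        \<le> total_excess k l d s - K * integral {a..s} (total_excess k' l' d')"
      by (simp add: I_def)
  qed
qed

text \<open>The counterpart for data of zero entropy, tested with functions that need not vanish at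
  time 0. It includes \<open>t = 0\<close>, where the right side is 0.\<close>

lemma total_excess_initial:
  assumes kld: "0 \<le> k" "0 \<le> l" "0 < d" and kld': "0 \<le> k'" "0 \<le> l'" "0 < d'" and K: "0 \<le> K"
    and b: "0 < b" and bounded: "\<And>t. t \<in> {0..b} \<Longrightarrow> bounded_at M t"
    and transfer: "\<And>x y. \<bar>x\<bar> \<le> real M \<Longrightarrow> \<bar>y\<bar> \<le> real M \<Longrightarrow>
      transfer k l d v1 v2 x y \<le> K * (ent k' l' d' x + ent k' l' d' y)"
    and init: "\<And>x. ent k l d (u10 x) = 0" "\<And>x. ent k l d (u20 x) = 0"
    and t: "t \<in> {0..b}"
  shows "total_excess k l d t \<le> K * integral {0..t} (total_excess k' l' d')"
proof -
  obtain w :: "nat \<Rightarrow> real \<Rightarrow> real" and c :: "nat \<Rightarrow> real"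
  where c: "c \<longlonglongrightarrow> 0" and w: "\<And>n. continuous_on UNIV (w n)" "\<And>n x. \<bar>w n x\<bar> \<le> 1" "\<And>x. (\<lambda>n. w n x) \<longlonglongrightarrow> 1"
    and ineq: "\<And>n \<psi> \<psi>' R. smooth_real \<psi> \<Longrightarrow> (\<And>t. (\<psi> has_real_derivative \<psi>' t) (at t)) \<Longrightarrow> (\<And>t. 0 \<le> \<psi> t) \<Longrightarrow>
      (\<And>t. \<psi> t \<noteq> 0 \<Longrightarrow> \<bar>t\<bar> \<le> R) \<Longrightarrow> (\<And>t. 0 \<le> t \<Longrightarrow> t \<notin> {0..b} \<Longrightarrow> \<psi> t = 0 \<and> \<psi>' t = 0) \<Longrightarrow>
      \<psi> 0 = 0 \<or> (\<forall>x. ent k l d (u10 x) = 0 \<and> ent k l d (u20 x) = 0) \<Longrightarrow>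
      0 \<le> integral {0..b} (\<lambda>t. \<psi>' t * excess (w n) k l d t + \<psi> t * (c n + K * total_excess k' l' d' t))"
  proof (rule cutoff_inequality[OF kld kld' K order_refl less_imp_le[OF b] bounded transfer], goal_cases)
    case (4 w c)
    show ?case by (rule that) (fact 4)+
  qed
  have Ec: "continuous_on {0..b} (total_excess k' l' d')"
    by (rule continuous_on_subset[OF continuous_excess[OF kld']]) auto
  have int: "integral {0..t} (\<lambda>t. c n + K * total_excess k' l' d' t)
      = c n * t + K * integral {0..t} (total_excess k' l' d')" for n
    using t by (subst integral_add) (auto intro!: integrable_continuous_real continuous_intros continuous_on_subset[OF Ec])
  have "excess (w n) k l d t \<le> c n * t + K * integral {0..t} (total_excess k' l' d')" for n
    unfolding int[symmetric]
  proof (rule le_integral_of_test_functions[OF b _ _ _ t])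
    show "continuous_on {0..b} (excess (w n) k l d)"
      by (rule continuous_on_subset[OF continuous_excess[OF kld w(1,2)]]) auto
    show "continuous_on {0..b} (\<lambda>t. c n + K * total_excess k' l' d' t)"
      using Ec by (intro continuous_intros)
    fix \<psi> \<psi>' :: "real \<Rightarrow> real"
    assume \<psi>: "smooth_real \<psi>" "\<And>t. (\<psi> has_real_derivative \<psi>' t) (at t)" "\<And>t. 0 \<le> \<psi> t"
      "\<And>t. t \<le> - 2 \<Longrightarrow> \<psi> t = 0" "\<And>t. b \<le> t \<Longrightarrow> \<psi> t = 0 \<and> \<psi>' t = 0"
    show "0 \<le> integral {0..b} (\<lambda>t. \<psi>' t * excess (w n) k l d t + \<psi> t * (c n + K * total_excess k' l' d' t))"
    proof (rule ineq[OF \<psi>(1-3), of "b + 2"])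
      show "\<bar>t\<bar> \<le> b + 2" if "\<psi> t \<noteq> 0" for t
        using \<psi>(4)[of t] \<psi>(5)[of t] that b by (cases "t \<le> - 2"; cases "b \<le> t") auto
      show "\<psi> t = 0 \<and> \<psi>' t = 0" if "0 \<le> t" "t \<notin> {0..b}" for t
        using \<psi>(5)[of t] that by auto
    qed (use init in auto)
  qed
  moreover have "(\<lambda>n. c n * t + K * integral {0..t} (total_excess k' l' d')) \<longlonglongrightarrow>
      0 * t + K * integral {0..t} (total_excess k' l' d')"
    by (intro tendsto_intros c)
  moreover have "(\<lambda>n. excess (w n) k l d t) \<longlonglongrightarrow> total_excess k l d t"
    using t by (intro excess_tendsto kld w) auto
  ultimately have "total_excess k l d t \<le> 0 * t + K * integral {0..t} (total_excess k' l' d')"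
    by (intro LIMSEQ_le) auto
  then show ?thesis by simp
qed

section \<open>Local boundedness in time\<close>

lemma total_excess_eq_0_iff:
  assumes kld: "0 \<le> k" "0 \<le> l" "0 < d" and t: "0 \<le> t"
  shows "total_excess k l d t = 0 \<longleftrightarrow> (AE x in lborel. u1 t x \<in> {-l..k}) \<and> (AE x in lborel. u2 t x \<in> {-l..k})"
proof -
  have *: "(LINT x|lborel. 1 * ent k l d (f x)) = 0 \<longleftrightarrow> (AE x in lborel. f x \<in> {-l..k})"
    if "integrable lborel (\<lambda>x. 1 * ent k l d (f x))" for f
  proof -
    have "ent k l d u = 0 \<longleftrightarrow> u \<in> {-l..k}" for u
      using ent_eq_0[OF kld(3)] ent_pos[OF kld(3), of u l k] by (cases "u \<in> {-l..k}") auto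
    then show ?thesis
      using integral_nonneg_eq_0_iff_AE[OF that] ent_nonneg[OF kld(3)] by simp
  qed
  have i: "integrable lborel (\<lambda>x. 1 * ent k l d (u1 t x))" "integrable lborel (\<lambda>x. 1 * ent k l d (u2 t x))"
    using integrable_ent[OF kld continuous_on_const, of 1 1 t] t by simp_all
  have "0 \<le> (LINT x|lborel. 1 * ent k l d (f x))" for f
    using ent_nonneg[OF kld(3)] by (intro integral_nonneg_AE AE_I2) simp
  then show ?thesis
    unfolding excess_def using *[OF i(1)] *[OF i(2)] by (metis add_nonneg_eq_0_iff)
qed

lemma total_excess_nonneg: "0 < d \<Longrightarrow> 0 \<le> total_excess k l d t"
  by (rule excess_nonneg) auto

lemma bounded_at_iff:
  assumes "0 \<le> t"
  shows "bounded_at n t \<longleftrightarrow> total_excess (real n) (real n) 1 t = 0"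
  unfolding bounded_at_def
  by (subst total_excess_eq_0_iff) (use assms in \<open>auto simp: abs_le_iff minus_le_iff AE_conj_iff conj_ac\<close>)

text \<open>Bounds that hold almost everywhere survive convergence in L^1: the set is the zero set
  of a function that is continuous in time. These are the closed sets of the Baire argument.\<close>

lemma closed_bounded_at: "closed {t. 0 \<le> t \<and> bounded_at n t}"
proof -
  have "closed {t \<in> {0..}. total_excess (real n) (real n) 1 t = 0}"
    by (intro continuous_closed_preimage_constant continuous_excess) auto
  moreover have "{t \<in> {0..}. total_excess (real n) (real n) 1 t = 0} = {t. 0 \<le> t \<and> bounded_at n t}"
    by (auto simp: bounded_at_iff)
  ultimately show ?thesis by simp
qed

text \<open>This is where the BV regularity of the solution enters: finite total variation implies
  boundedness.\<close>

lemma bounded_at_exists: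
  assumes "0 \<le> t"
  shows "\<exists>n. bounded_at n t"
proof -
  have bv: "L1_BV (u1 t)" "L1_BV (u2 t)"
    using sol assms unfolding entropy_solution_def weak_solution_def by auto
  have *: "\<exists>B. AE x in lborel. \<bar>f x\<bar> \<le> B" if "L1_BV f" for f
  proof -
    obtain g where g: "AE x in lborel. f x = g x" "finite_total_variation g"
      using \<open>L1_BV f\<close> unfolding L1_BV_def by blast
    obtain B where "\<And>x. \<bar>g x\<bar> \<le> B" using finite_total_variation_bounded[OF g(2)] by blast
    then have "AE x in lborel. \<bar>f x\<bar> \<le> B" using g(1) by (auto elim: eventually_mono)
    then show ?thesis by blast
  qed
  obtain B1 B2 where B: "AE x in lborel. \<bar>u1 t x\<bar> \<le> B1" "AE x in lborel. \<bar>u2 t x\<bar> \<le> B2"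
    using *[OF bv(1)] *[OF bv(2)] by blast
  obtain n where n: "max B1 B2 \<le> real n" using real_arch_simple by blast
  have "bounded_at n t" unfolding bounded_at_def
    using B by eventually_elim (use n in auto)
  then show ?thesis by blast
qed

text \<open>\<open>N\<close> equal steps from \<open>m + 1\<close> to \<open>m + 2\<close>. Starting
  at \<open>m + 1\<close> keeps all thresholds at least 1, so that the velocities are nonpositive
  beyond them, and above a bound \<open>m\<close> valid at the starting time.\<close>

definition threshold :: "nat \<Rightarrow> nat \<Rightarrow> nat \<Rightarrow> real" where
  "threshold m N j = real m + 1 + real j / real N"

text \<open>The smoothing width is half the distance between neighbouring thresholds.\<close>

abbreviation level :: "nat \<Rightarrow> nat \<Rightarrow> nat \<Rightarrow> real \<Rightarrow> real" where
  "level m N j \<equiv> total_excess (threshold m N j) (threshold m N j) (1 / (2 * real N))"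

lemma threshold_nonneg: "0 \<le> threshold m N j"
  by (simp add: threshold_def)

text \<open>With \<open>k\<close>, \<open>k1\<close> the neighbouring thresholds, a density
  \<open>z\<close> beyond \<open>k1\<close> has smoothed excess at least
  \<open>|z| - k1 + 1/(2 N)\<close> over \<open>k\<close>. Multiplied by \<open>2 N\<close>, this
  dominates \<open>1 + |z|\<close> up to a factor that depends on \<open>m\<close> only.\<close>

lemma transfer_level:
  "\<exists>C>0. \<forall>N j x y. j < N \<longrightarrow>
     transfer (threshold m N (Suc j)) (threshold m N (Suc j)) (1 / (2 * real N)) v1 v2 x y
     \<le> C * real N * (ent (threshold m N j) (threshold m N j) (1 / (2 * real N)) x
                     + ent (threshold m N j) (threshold m N j) (1 / (2 * real N)) y)"
proof -
  \<comment> \<open>The highest threshold is \<open>m + 2\<close> and the smoothing width at most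
    1/2, so \<open>m + 3\<close> suffices for all \<open>N\<close> and \<open>j\<close>, and the
    constant is uniform in them.\<close>
  obtain C where C: "0 < C" "\<And>k d x y. 1 \<le> k \<Longrightarrow> 0 < d \<Longrightarrow> k + d \<le> real m + 3 \<Longrightarrow>
    transfer k k d v1 v2 x y \<le>
      C * ((if k < \<bar>x\<bar> then 1 + \<bar>x\<bar> else 0) + (if k < \<bar>y\<bar> then 1 + \<bar>y\<bar> else 0))"
    using transfer_growth[OF vel, of "real m + 3"] by (metis add_nonneg_pos of_nat_0_le_iff zero_less_numeral)
  show ?thesis
  proof (intro exI[of _ "C * ((real m + 4) * 2)"] conjI allI impI)
    show "0 < C * ((real m + 4) * 2)" using C(1) by simp
    fix N j :: nat and x y :: real assume j: "j < N"
    define k where "k = threshold m N j"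
    define k1 where "k1 = threshold m N (Suc j)"
    define d where "d = 1 / (2 * real N)"
    have N: "0 < real N" "1 \<le> real N" using j by auto
    have d: "0 < d" "d \<le> 1 / 2" "2 * real N * d = 1" using N by (auto simp: d_def divide_simps)
    have k1: "k1 = k + 2 * d" using N by (simp add: k1_def k_def d_def threshold_def add_divide_distrib)
    have "real (Suc j) / real N \<le> 1" using j by (simp add: divide_le_eq)
    then have k12: "1 \<le> k1" "k1 \<le> real m + 2" by (auto simp: k1_def threshold_def)
    have e: "(if k1 < \<bar>z\<bar> then 1 + \<bar>z\<bar> else 0) \<le> (real m + 4) * (2 * real N) * ent k k d z" for z
    proof (cases "k1 < \<bar>z\<bar>")
      case True
      have "\<bar>z\<bar> - k - d / 2 \<le> ent k k d z"
        using ent_ge[OF d(1), of z k k] by (cases "0 \<le> z") auto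
      then have "\<bar>z\<bar> - k1 + d \<le> ent k k d z" using k1 d by simp
      then have "2 * real N * (\<bar>z\<bar> - k1 + d) \<le> 2 * real N * ent k k d z" using N by simp
      moreover have "2 * real N * (\<bar>z\<bar> - k1 + d) = 2 * real N * (\<bar>z\<bar> - k1) + 1"
        using d(3) by (simp add: algebra_simps)
      moreover have "\<bar>z\<bar> - k1 \<le> 2 * real N * (\<bar>z\<bar> - k1)"
        using True N mult_right_mono[of 1 "2 * real N" "\<bar>z\<bar> - k1"] by simp
      ultimately have z: "\<bar>z\<bar> - k1 + 1 \<le> 2 * real N * ent k k d z" by linarith
      have "1 + \<bar>z\<bar> \<le> (real m + 4) * (\<bar>z\<bar> - k1 + 1)"
      proof -
        have "0 \<le> (real m + 3) * (\<bar>z\<bar> - k1)" using True by simp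
        then have "\<bar>z\<bar> - k1 + (real m + 4) \<le> (real m + 4) * (\<bar>z\<bar> - k1 + 1)" by (simp add: algebra_simps)
        then show ?thesis using k12 by linarith
      qed
      also have "\<dots> \<le> (real m + 4) * (2 * real N * ent k k d z)" using z by (intro mult_left_mono) auto
      finally show ?thesis using True by (simp only: mult.assoc if_True)
    next
      case False
      then show ?thesis using ent_nonneg[OF d(1), of k k z] by simp
    qed
    have "transfer k1 k1 d v1 v2 x y \<le> C * ((if k1 < \<bar>x\<bar> then 1 + \<bar>x\<bar> else 0) + (if k1 < \<bar>y\<bar> then 1 + \<bar>y\<bar> else 0))"
      using k12 d by (intro C) auto
    also have "\<dots> \<le> C * ((real m + 4) * (2 * real N) * ent k k d x + (real m + 4) * (2 * real N) * ent k k d y)"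
      using C(1) by (intro mult_left_mono add_mono e) auto
    also have "\<dots> = C * ((real m + 4) * 2) * real N * (ent k k d x + ent k k d y)"
      by (simp only: distrib_left mult_ac)
    finally show "transfer (threshold m N (Suc j)) (threshold m N (Suc j)) (1 / (2 * real N)) v1 v2 x y
     \<le> C * ((real m + 4) * 2) * real N * (ent (threshold m N j) (threshold m N j) (1 / (2 * real N)) x
                     + ent (threshold m N j) (threshold m N j) (1 / (2 * real N)) y)"
      by (simp only: k_def k1_def d_def)
  qed
qed

lemma continuous_level: "0 < N \<Longrightarrow> continuous_on {0..} (level m N j)"
  by (rule continuous_excess) (auto simp: threshold_nonneg)

text \<open>Raising the threshold from \<open>m + 1\<close> to \<open>m + 2\<close> in \<open>N\<close> steps gains a factor \<open>(C N \<tau>)\<^sup>N / N!\<close>, which is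
  exponentially small in \<open>N\<close> once \<open>\<tau>\<close> is small.\<close>

lemma bounded_at_growth_step:
  assumes C: "0 < C" and ab: "0 \<le> a" "a \<le> b" "b \<le> a + 1 / (6 * C)" and bnd: "bounded_at m a"
    and anti: "\<And>N j. j < N \<Longrightarrow>
      antimono_on {a..b} (\<lambda>t. level m N (Suc j) t - C * real N * integral {0..t} (level m N j))"
  shows "bounded_at (m + 3) b"
proof -
  obtain A where A: "0 \<le> A" "\<And>t. t \<in> {a..b} \<Longrightarrow> mass t \<le> A"
    using mass_bounded[OF ab(1)] by blast
  have b0: "0 \<le> b" using ab by simp
  have le: "total_excess (real (m + 3)) (real (m + 3)) 1 b \<le> A * (1 / 2) ^ N" if N: "0 < N" for N
  proof -
    have NN: "1 \<le> real N" using N by simp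
    define d where "d = 1 / (2 * real N)"
    have d: "0 < d" "d \<le> 1 / 2" using NN by (auto simp: d_def divide_simps)
    have cont: "continuous_on S (level m N j)" if "S \<subseteq> {0..}" for S j
      by (rule continuous_on_subset[OF continuous_level[OF N] that])
    \<comment> \<open>All thresholds lie above the bound \<open>m\<close> valid at time
      \<open>a\<close>, so every level starts from 0.\<close>
    have zero: "level m N j a = 0" for j
    proof (subst total_excess_eq_0_iff)
      have "real m \<le> threshold m N j" by (simp add: threshold_def)
      then have "u \<in> {- threshold m N j..threshold m N j}" if "\<bar>u\<bar> \<le> real m" for u
        using that by (auto simp: abs_le_iff)
      then show "(AE x in lborel. u1 a x \<in> {- threshold m N j..threshold m N j}) \<and>
          (AE x in lborel. u2 a x \<in> {- threshold m N j..threshold m N j})"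
        by (intro conjI; intro eventually_mono[OF bnd[unfolded bounded_at_def]]) blast+
    qed (use N ab in \<open>auto simp: threshold_nonneg\<close>)
    have step: "level m N (Suc j) t \<le> C * real N * integral {a..t} (level m N j)"
      if j: "j < N" and t: "t \<in> {a..b}" for j t
    proof -
      have "integral {0..t} (level m N j) = integral {0..a} (level m N j) + integral {a..t} (level m N j)"
        using t ab by (intro Henstock_Kurzweil_Integration.integral_combine[symmetric] integrable_continuous_real cont) auto
      moreover have "level m N (Suc j) t - C * real N * integral {0..t} (level m N j)
          \<le> level m N (Suc j) a - C * real N * integral {0..a} (level m N j)"
        using monotone_onD[OF anti[OF j], of a t] t ab by auto
      ultimately show ?thesis using zero[of "Suc j"] by (simp add: algebra_simps)
    qed
    have "level m N N b \<le> A * (C * real N * (b - a)) ^ N / fact N"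
    proof (rule iterated_integral_bound[where F = "level m N" and N = N and b = b])
      show "level m N 0 t \<le> A" if "t \<in> {a..b}" for t
        using total_excess_le_mass[of "threshold m N 0" "threshold m N 0" "1 / (2 * real N)" t] A(2)[OF that] that ab N
        by (auto simp: threshold_nonneg)
    qed (use C ab step in \<open>auto intro: cont\<close>)
    also have "\<dots> = A * (C * (b - a)) ^ N * (real N ^ N / fact N)"
      by (simp add: power_mult_distrib)
    \<comment> \<open>The factor 1/6 comes from the length of the interval, the factor 3 from
      \<open>N^N / N! \<le> e^N \<le> 3^N\<close>; together they leave
      \<open>(1/2)^N\<close>.\<close>
    also have "\<dots> \<le> A * (1 / 6) ^ N * 3 ^ N"
    proof (intro mult_mono mult_left_mono power_mono)
      show "C * (b - a) \<le> 1 / 6" using ab(3) C by (simp add: field_simps)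
      have "real N ^ N / fact N \<le> exp (real N)" by (rule power_divide_fact_le_exp) simp
      also have "\<dots> = exp 1 ^ N" by (simp add: exp_of_nat_mult[symmetric])
      also have "\<dots> \<le> 3 ^ N" by (intro power_mono exp_le) simp
      finally show "real N ^ N / fact N \<le> 3 ^ N" .
    qed (use A C ab in auto)
    also have "\<dots> = A * (1 / 2) ^ N" by (simp add: mult.assoc flip: power_mult_distrib)
    finally have "level m N N b \<le> A * (1 / 2) ^ N" .
    \<comment> \<open>The highest threshold is \<open>m + 2\<close> and its smoothing costs at most
      1/4, so the integer \<open>m + 3\<close> lies safely above.\<close>
    moreover have "total_excess (real (m + 3)) (real (m + 3)) 1 b \<le> level m N N b"
    proof -
      have "ent (real (m + 3)) (real (m + 3)) 1 u \<le> ent (threshold m N N) (threshold m N N) d u" for u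
        using d N by (intro ent_le_ent) (auto simp: threshold_def)
      then show ?thesis
        unfolding excess_def d_def[symmetric]
        using integrable_ent[OF _ _ _ continuous_on_const, of "real (m + 3)" "real (m + 3)" 1 1 1 b]
          integrable_ent[OF threshold_nonneg threshold_nonneg d(1) continuous_on_const, of 1 1 b] b0
        by (intro add_mono integral_mono) auto
    qed
    ultimately show ?thesis by simp
  qed
  have "total_excess (real (m + 3)) (real (m + 3)) 1 b \<le> A * 0"
  proof (rule LIMSEQ_le_const)
    show "(\<lambda>N. A * (1 / 2) ^ N) \<longlonglongrightarrow> A * 0" by (intro tendsto_intros) auto
    show "\<exists>M. \<forall>N\<ge>M. total_excess (real (m + 3)) (real (m + 3)) 1 b \<le> A * (1 / 2) ^ N"
      using le by (intro exI[of _ 1]) auto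
  qed
  then show ?thesis
    using total_excess_nonneg[of 1 "real (m + 3)" "real (m + 3)" b] b0 by (simp add: bounded_at_iff)
qed

text \<open>The differential inequalities for all \<open>m\<close>, \<open>N\<close> and
  \<open>j\<close> together form the family for the Baire argument, since each starting bound needs
  its own thresholds. Once they hold at all times, the growth step applies from any time, on an
  interval whose length depends only on the bound there.\<close>

lemma bounded_at_growth:
  "\<exists>\<tau>>0. \<exists>m. \<forall>a b. 0 \<le> a \<and> a \<le> b \<and> b \<le> a + \<tau> \<and> bounded_at n a \<longrightarrow> bounded_at m b"
proof -
  obtain C where C: "\<And>m. 0 < C m" and tr: "\<And>m N j x y. j < N \<Longrightarrow>
     transfer (threshold m N (Suc j)) (threshold m N (Suc j)) (1 / (2 * real N)) v1 v2 x y
     \<le> C m * real N * (ent (threshold m N j) (threshold m N j) (1 / (2 * real N)) x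
                     + ent (threshold m N j) (threshold m N j) (1 / (2 * real N)) y)"
    using transfer_level by metis
  \<comment> \<open>Integrating from 0 instead of \<open>a\<close> changes the function on
    \<open>[a, b]\<close> by a constant only, and makes it independent of the interval, as a
    statement on all of \<open>[0, \<infinity>)\<close> requires.\<close>
  define W where "W m N j t = level m N (Suc j) t - C m * real N * integral {0..t} (level m N j)" for m N j t
  define \<W> where "\<W> = {W m N j | m N j. j < N}"
  have anti: "antimono_on {0..} w" if "w \<in> \<W>" for w
  proof (rule baire_antimono[where good = bounded_at and \<W> = \<W>])
    show "continuous_on {0..} w" if mem: "w \<in> \<W>" for w
    proof -
      obtain m N j where w: "w = W m N j" "j < N" using mem by (auto simp: \<W>_def)
      have "continuous_on {0..} (\<lambda>t. integral {0..t} (level m N j))"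
        unfolding continuous_on_eq_continuous_within
      proof
        fix t :: real assume t: "t \<in> {0..}"
        have "continuous_on {0..t + 1} (level m N j)"
          by (rule continuous_on_subset[OF continuous_level]) (use w in auto)
        then have "continuous_on {0..t + 1} (\<lambda>t. integral {0..t} (level m N j))"
          by (intro indefinite_integral_continuous_1 integrable_continuous_real)
        moreover have "at t within {0..} = at t within {0..t + 1}"
          by (rule at_within_nhd[of _ "{t - 1<..<t + 1}"]) (use t in auto)
        ultimately show "continuous (at t within {0..}) (\<lambda>t. integral {0..t} (level m N j))"
          using t by (auto simp: continuous_on_eq_continuous_within)
      qed
      then show ?thesis
        unfolding w(1) W_def[abs_def] using w(2) by (intro continuous_intros continuous_level) auto
    qed
    show "antimono_on {a..b} w"
      if ab: "0 \<le> a" "a < b" and bd: "\<And>t. t \<in> {a..b} \<Longrightarrow> bounded_at n t" and "w \<in> \<W>" for n a b w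
    proof -
      obtain m N j where w: "w = W m N j" "j < N" using \<open>w \<in> \<W>\<close> by (auto simp: \<W>_def)
      have anti: "antimono_on {a..b} (\<lambda>t. level m N (Suc j) t - C m * real N * integral {a..t} (level m N j))"
        by (rule total_excess_slab[OF _ _ _ _ _ _ _ ab bd]) (use w C tr in \<open>auto simp: threshold_nonneg less_imp_le\<close>)
      have eq: "w t = level m N (Suc j) t - C m * real N * integral {a..t} (level m N j)
          - C m * real N * integral {0..a} (level m N j)" if "t \<in> {a..b}" for t
      proof -
        have "continuous_on {0..t} (level m N j)"
          by (rule continuous_on_subset[OF continuous_level]) (use w in auto)
        then have "integral {0..t} (level m N j) = integral {0..a} (level m N j) + integral {a..t} (level m N j)"
          using that ab by (intro Henstock_Kurzweil_Integration.integral_combine[symmetric] integrable_continuous_real) auto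
        then show ?thesis by (simp add: w W_def algebra_simps)
      qed
      show ?thesis
      proof (rule monotone_onI)
        fix s t assume st: "s \<in> {a..b}" "t \<in> {a..b}" "s \<le> t"
        show "w t \<le> w s"
          using monotone_onD[OF anti st] unfolding eq[OF st(1)] eq[OF st(2)] by simp
      qed
    qed
    show "\<exists>\<tau>>0. \<exists>m. \<forall>a b. 0 \<le> a \<and> a \<le> b \<and> b \<le> a + \<tau> \<and> bounded_at n a \<and>
        (\<forall>W\<in>\<W>. antimono_on {a..b} W) \<longrightarrow> bounded_at m b" for n
    proof (intro exI[of _ "1 / (6 * C n)"] exI[of _ "n + 3"] conjI allI impI)
      show "0 < 1 / (6 * C n)" using C by simp
      fix a b assume *: "0 \<le> a \<and> a \<le> b \<and> b \<le> a + 1 / (6 * C n) \<and> bounded_at n a \<and>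
        (\<forall>W\<in>\<W>. antimono_on {a..b} W)"
      have "antimono_on {a..b} (W n N j)" if "j < N" for N j
        using * that unfolding \<W>_def by blast
      with * C show "bounded_at (n + 3) b"
        by (intro bounded_at_growth_step[of "C n" a b n]) (auto simp: W_def[abs_def])
    qed
  qed (use that closed_bounded_at bounded_at_exists in auto)
  show ?thesis
  proof (intro exI[of _ "1 / (6 * C n)"] exI[of _ "n + 3"] conjI allI impI)
    show "0 < 1 / (6 * C n)" using C by simp
    fix a b assume *: "0 \<le> a \<and> a \<le> b \<and> b \<le> a + 1 / (6 * C n) \<and> bounded_at n a"
    have "antimono_on {a..b} (W n N j)" if "j < N" for N j
      by (rule monotone_on_subset[OF anti]) (use * that in \<open>auto simp: \<W>_def\<close>)
    with * C show "bounded_at (n + 3) b"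
      by (intro bounded_at_growth_step[of "C n" a b n]) (auto simp: W_def[abs_def])
  qed
qed

section \<open>Invariance of the unit interval\<close>

abbreviation defect :: "real \<Rightarrow> real" where
  "defect \<equiv> total_excess 1 0 1"

lemma continuous_defect: "0 \<le> a \<Longrightarrow> continuous_on {a..b} defect"
  by (rule continuous_on_subset[OF continuous_excess]) auto

text \<open>The notion of solution does not identify \<open>u1 0\<close> with \<open>u10\<close>
  directly; the data enter through the initial terms of the inequalities. Some bound at time 0,
  carried to a short interval, allows Gronwall's inequality there, and this yields the value at 0
  itself.\<close>

lemma defect_initial:
  assumes "\<And>x. u10 x \<in> {0..1}" "\<And>x. u20 x \<in> {0..1}"
  shows "defect 0 = 0"
proof -
  obtain n where n: "bounded_at n 0" using bounded_at_exists by blast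
  obtain \<tau> m where \<tau>: "0 < \<tau>" "\<And>a b. 0 \<le> a \<Longrightarrow> a \<le> b \<Longrightarrow> b \<le> a + \<tau> \<Longrightarrow> bounded_at n a \<Longrightarrow> bounded_at m b"
    using bounded_at_growth[of n] by blast
  obtain K where K: "0 \<le> K" "\<And>x y. \<bar>x\<bar> \<le> real m \<Longrightarrow> \<bar>y\<bar> \<le> real m \<Longrightarrow>
    transfer 1 0 1 v1 v2 x y \<le> K * (ent 1 0 1 x + ent 1 0 1 y)"
    using transfer_decay[OF vel of_nat_0_le_iff[of m]] by blast
  have ini: "ent 1 0 1 (u10 x) = 0" "ent 1 0 1 (u20 x) = 0" for x
    using assms[of x] by (auto intro!: ent_eq_0)
  have bd: "bounded_at m t" if "t \<in> {0..\<tau>}" for t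
    using \<tau>(2)[of 0 t] n that by simp
  have "defect t \<le> K * integral {0..t} defect" if "t \<in> {0..\<tau>}" for t
    by (rule total_excess_initial[OF _ _ _ _ _ _ K(1) \<tau>(1) bd K(2) ini that]) auto
  then have "defect 0 \<le> 0"
    using \<tau>(1) by (intro gronwall_zero[OF K(1) continuous_defect[of 0 \<tau>]]) auto
  then show ?thesis using total_excess_nonneg[of 1 1 0 0] by simp
qed

text \<open>The step length is uniform because zero defect at \<open>a\<close> always gives the same
  bound 1 at \<open>a\<close>. Steps depending on a growing bound might add up to a finite time
  only.\<close>

lemma defect_propagates:
  "\<exists>\<tau>>0. \<forall>a t. 0 \<le> a \<longrightarrow> defect a = 0 \<longrightarrow> t \<in> {a..a + \<tau>} \<longrightarrow> defect t = 0"
proof -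
  obtain \<tau> m where \<tau>: "0 < \<tau>" "\<And>a b. 0 \<le> a \<Longrightarrow> a \<le> b \<Longrightarrow> b \<le> a + \<tau> \<Longrightarrow> bounded_at 1 a \<Longrightarrow> bounded_at m b"
    using bounded_at_growth[of 1] by blast
  obtain K where K: "0 \<le> K" "\<And>x y. \<bar>x\<bar> \<le> real m \<Longrightarrow> \<bar>y\<bar> \<le> real m \<Longrightarrow>
    transfer 1 0 1 v1 v2 x y \<le> K * (ent 1 0 1 x + ent 1 0 1 y)"
    using transfer_decay[OF vel of_nat_0_le_iff[of m]] by blast
  have "defect t = 0" if a: "0 \<le> a" "defect a = 0" and t: "t \<in> {a..a + \<tau>}" for a t
  proof -
    have "bounded_at 1 a"
    proof -
      have "AE x in lborel. u1 a x \<in> {- 0..1}" "AE x in lborel. u2 a x \<in> {- 0..1}"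
        using a total_excess_eq_0_iff[of 1 0 1 a] by simp_all
      then show ?thesis unfolding bounded_at_def by eventually_elim (auto simp: abs_le_iff)
    qed
    then have bd: "bounded_at m t" if "t \<in> {a..a + \<tau>}" for t
      using \<tau>(2)[of a t] a that by simp
    have less: "a < a + \<tau>" using \<tau>(1) by simp
    have anti: "antimono_on {a..a + \<tau>} (\<lambda>t. defect t - K * integral {a..t} defect)"
      by (rule total_excess_slab[OF _ _ _ _ _ _ K(1) a(1) less bd K(2)]) auto
    have "defect t \<le> K * integral {a..t} defect" if "t \<in> {a..a + \<tau>}" for t
      using monotone_onD[OF anti, of a t] that \<tau>(1) a(2) by simp
    then have "defect t \<le> 0"
      using t by (intro gronwall_zero[OF K(1) continuous_defect[OF a(1), of "a + \<tau>"]]) auto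
    then show ?thesis using total_excess_nonneg[of 1 1 0 t] by simp
  qed
  with \<tau>(1) show ?thesis by blast
qed

lemma defect_zero:
  assumes "\<And>x. u10 x \<in> {0..1}" "\<And>x. u20 x \<in> {0..1}" and t: "0 \<le> t"
  shows "defect t = 0"
proof -
  obtain \<tau> where \<tau>: "0 < \<tau>" "\<And>a t. 0 \<le> a \<Longrightarrow> defect a = 0 \<Longrightarrow> t \<in> {a..a + \<tau>} \<Longrightarrow> defect t = 0"
    using defect_propagates by blast
  have zero: "\<forall>t\<in>{0..real k * \<tau>}. defect t = 0" for k
  proof (induction k)
    case 0
    then show ?case using defect_initial[OF assms(1,2)] by simp
  next
    case (Suc k)
    show ?case
    proof
      fix t assume t: "t \<in> {0..real (Suc k) * \<tau>}"
      show "defect t = 0"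
      proof (cases "t \<le> real k * \<tau>")
        case False
        have k: "0 \<le> real k * \<tau>" using \<tau>(1) by simp
        then have "defect (real k * \<tau>) = 0" using Suc by simp
        moreover have "t \<in> {real k * \<tau>..real k * \<tau> + \<tau>}" using t False by (simp add: algebra_simps)
        ultimately show ?thesis by (rule \<tau>(2)[OF k])
      qed (use Suc t in auto)
    qed
  qed
  obtain k :: nat where "t / \<tau> \<le> real k" using real_arch_simple by blast
  then have "t \<in> {0..real k * \<tau>}" using t \<tau>(1) by (simp add: divide_le_eq)
  with zero show ?thesis by blast
qed

end

theorem lemma2p4:
  fixes v1 v2 u10 u20 :: "real \<Rightarrow> real"
    and u1 u2 :: "real \<Rightarrow> real \<Rightarrow> real"
  assumes "velocity v1" and "velocity v2"
    and "L1_BV u10" and "L1_BV u20"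
    and "entropy_solution v1 v2 u10 u20 u1 u2"
    and "\<forall>x. u10 x \<in> {0..1}" and "\<forall>x. u20 x \<in> {0..1}"
  shows "\<forall>t>0. (AE x in lborel. u1 t x \<in> {0..1}) \<and> (AE x in lborel. u2 t x \<in> {0..1})"
proof (intro allI impI)
  fix t :: real assume t: "0 < t"
  interpret two_lane_solution v1 v2 u10 u20 u1 u2
    by unfold_locales fact+
  have "defect t = 0" using assms(6,7) t by (intro defect_zero) auto
  then show "(AE x in lborel. u1 t x \<in> {0..1}) \<and> (AE x in lborel. u2 t x \<in> {0..1})"
    using total_excess_eq_0_iff[of 1 0 1 t] t by simp
qed

end
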